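(* Let $n$ be an odd number, $h_n:=(n-1)/2$, and let $\ell$ be an integer with $0\le\ell\le h_n-1$. Let $U\subset\mathbb R^{n+1}$ be a bounded slice Cauchy domain and, for $I\in\mathbb S$, set $ds_I=ds(-I)$. (i) If $f$ is a left slice hyperholomorphic function on a set that contains $\overline U$, then $\breve f^\circ(x)=\Delta_{n+1}^\ell\overline D^{\,h_n-\ell}f(x)$ is axially polyanalytic of order $h_n-\ell+1$ and $$\breve f^\circ(x)=\frac1{2\pi}\int_{\partial(U\cap\mathbb C_I)}\mathcal P_\ell^L(s,x)\,ds_I\,f(s),\qquad\forall x\in U.$$ (ii) If $f$ is a right slice hyperholomorphic function on a set that contains $\overline U$, then $\breve f^\circ(x)=f(x)\Delta_{n+1}^\ell\overline D^{\,h_n-\ell}$ is axially polyanalytic of order $h_n-\ell+1$ and $$\breve f^\circ(x)=\frac1{2\pi}\int_{\partial(U\cap\mathbb C_I)}f(s)\,ds_I\,\mathcal P_\ell^R(s,x),\qquad\forall x\in U.$$ Moreover, these integrals depend neither on $U$ nor on the imaginary unit $I\in\mathbb S$, and are independent of the kernel of $\Delta_{n+1}^\ell\overline D^{\,h_n-\ell}$ (i.e. replacing $f$ by another left, resp. right, slice hyperholomorphic function with the same image under this operator does not change them).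
   Context: $\mathbb R_n$ is the real Clifford algebra generated by $e_1,\dots,e_n$ with $e_ie_j+e_je_i=-2\delta_{ij}$. A point $(x_0,\dots,x_n)\in\mathbb R^{n+1}$ is identified with the paravector $x=x_0+\underline x$, $\underline x=\sum_{j=1}^n x_je_j$; $\overline x=x_0-\underline x$, $|x|^2=\sum_{j=0}^nx_j^2$. $\mathbb S$ is the set of $\underline x$ with $|\underline x|=1$; for $I\in\mathbb S$, $\mathbb C_I=\mathbb R+I\mathbb R$. $[x]=\{x_0+I|\underline x|: I\in\mathbb S\}$. An open $U\subset\mathbb R^{n+1}$ is axially symmetric if $[x]\subset U$ for all $x\in U$; it is a slice Cauchy domain if it is axially symmetric and, for every $I\in\mathbb S$, $\partial(U\cap\mathbb C_I)$ is a finite union of non-intersecting piecewise continuously differentiable Jordan curves in $\mathbb C_I$ (positively oriented). For $U$ axially symmetric open let $\mathcal U=\{(u,v)\in\mathbb R^2: u+\mathbb S v\subset U\}$. $f:U\to\mathbb R_n$ is left (resp. right) slice hyperholomorphic if $f(u+Iv)=\alpha(u,v)+I\beta(u,v)$ (resp. $\alpha(u,v)+\beta(u,v)I$) for all $I\in\mathbb S$, $(u,v)\in\mathcal U$, with differentiable $\alpha,\beta:\mathcal U\to\mathbb R_n$ satisfying $\alpha(u,-v)=\alpha(u,v)$, $\beta(u,-v)=-\beta(u,v)$ and $\partial_u\alpha=\partial_v\beta$, $\partial_v\alpha=-\partial_u\beta$. $Df=\partial_{x_0}f+\sum_{i}e_i\partial_{x_i}f$, $\overline Df=\partial_{x_0}f-\sum_{i}e_i\partial_{x_i}f$;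 from the right, $fD=\partial_{x_0}f+\sum_i\partial_{x_i}f\,e_i$, $f\overline D=\partial_{x_0}f-\sum_i\partial_{x_i}f\,e_i$. $\Delta_{n+1}=\sum_{j=0}^n\partial_{x_j}^2$. A function $g$ of class $\mathcal C^m$ is left (resp. right) axially polyanalytic of order $m$ if $D^mg=0$ (resp. $gD^m=0$) and $g(x)=A(x_0,|\underline x|)+\frac{\underline x}{|\underline x|}B(x_0,|\underline x|)$ (resp. $A+B\frac{\underline x}{|\underline x|}$) with $\mathbb R_n$-valued $A$ even and $B$ odd in the second variable; in (i) "left", in (ii) "right" is meant. Kernels: for $s\notin[x]$, $\mathcal Q_{c,s}(x)=s^2-2x_0s+|x|^2$; $F_n^L(s,x)=\gamma_n(s-\overline x)\mathcal Q_{c,s}(x)^{-\frac{n+1}2}$, $F_n^R(s,x)=\gamma_n\mathcal Q_{c,s}(x)^{-\frac{n+1}2}(s-\overline x)$, $\gamma_n=[\Gamma(\frac{n+1}2)]^22^{n-1}(-1)^{\frac{n-1}2}$; $$\mathcal P_\ell^L(s,x)=\frac{(-1)^{h_n-\ell}}{(h_n-\ell)!}F_n^L(s,x)(s-x_0)^{h_n-\ell},\qquad \mathcal P_\ell^R(s,x)=\frac{(-1)^{h_n-\ell}}{(h_n-\ell)!}(s-x_0)^{h_n-\ell}F_n^R(s,x).$$ *)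

theory Defs
  imports "HOL-Complex_Analysis.Complex_Analysis"
begin

section \<open>The real Clifford algebra\<close>

text \<open>
  The algebra on generators indexed by \<^typ>\<open>'n\<close>, realised on its basis of blades: a multivector is
  its family of coefficients with respect to the ordered products of generators
  $e_A = e_{i_1} \cdots e_{i_k}$, where $A = \{i_1 < \dots < i_k\}$ ranges over all sets of indices.
\<close>

typedef 'n clifford = "UNIV :: ('n set \<Rightarrow> real) set"
  morphisms coord Clifford
  by simp

lemma coord_Clifford [simp]: "coord (Clifford a) = a"
  by (simp add: Clifford_inverse)

lemma clifford_eq_iff: "a = b \<longleftrightarrow> (\<forall>A. coord a A = coord b A)"
  by (auto simp flip: coord_inject)

text \<open>
  Reordering $e_A e_B$ into $\pm e_{A \mathbin{\triangle} B}$ costs one factor $-1$ for each pair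
  $(i, j) \in A \times B$ with $j < i$ (a transposition of anticommuting generators) and one for each
  pair with $j = i$ (the relation $e_i^2 = -1$).
\<close>

definition blade_sign :: "'n::{finite,linorder} set \<Rightarrow> 'n set \<Rightarrow> real" where
  "blade_sign A B = (\<Prod>i\<in>A. \<Prod>j\<in>B. if j \<le> i then - 1 else 1)"

instantiation clifford :: (finite) real_vector
begin

definition "0 = Clifford (\<lambda>_. 0)"
definition "a + b = Clifford (\<lambda>A. coord a A + coord b A)"
definition "a - b = Clifford (\<lambda>A. coord a A - coord b A)"
definition "- a = Clifford (\<lambda>A. - coord a A)"
definition "r *\<^sub>R a = Clifford (\<lambda>A. r * coord a A)"

instance
  by standard
    (simp_all add: clifford_eq_iff zero_clifford_def plus_clifford_def minus_clifford_def
      uminus_clifford_def scaleR_clifford_def algebra_simps)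

end

lemma coord_linear [simp]:
  "coord 0 A = 0" "coord (a + b) A = coord a A + coord b A"
  "coord (a - b) A = coord a A - coord b A" "coord (- a) A = - coord a A"
  "coord (r *\<^sub>R a) A = r * coord a A"
  by (simp_all add: zero_clifford_def plus_clifford_def minus_clifford_def
      uminus_clifford_def scaleR_clifford_def)

lemma blade_sign_sym_diff_left:
  "blade_sign (sym_diff A B) C = blade_sign A C * blade_sign B C"
proof -
  define f :: "'a \<Rightarrow> real" where "f i = (\<Prod>j\<in>C. if j \<le> i then - 1 else 1)" for i
  have f: "f i * f i = 1" for i
    by (auto simp: f_def simp flip: prod.distrib intro!: prod.neutral)
  have A: "prod f A = prod f (A - B) * prod f (A \<inter> B)"
    by (metis Int_Diff_Un Int_Diff_disjoint finite mult.commute prod.union_disjoint)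
  have B: "prod f B = prod f (B - A) * prod f (A \<inter> B)"
    by (metis Int_Diff_Un Int_Diff_disjoint Int_commute finite mult.commute prod.union_disjoint)
  have "prod f (A \<inter> B) * prod f (A \<inter> B) = 1"
    by (simp add: f flip: prod.distrib)
  moreover have "prod f (sym_diff A B) = prod f (A - B) * prod f (B - A)"
    by (rule prod.union_disjoint) auto
  ultimately have "prod f (sym_diff A B) = prod f A * prod f B"
    unfolding A B by (simp add: mult.commute mult.left_commute)
  then show ?thesis
    by (simp add: blade_sign_def f_def)
qed

lemma blade_sign_sym_diff_right:
  "blade_sign A (sym_diff B C) = blade_sign A B * blade_sign A C"
proof -
  have "(\<Prod>j\<in>sym_diff B C. if j \<le> i then - 1 else 1) =
      (\<Prod>j\<in>B. if j \<le> i then - 1 else 1) * (\<Prod>j\<in>C. if j \<le> i then - 1 else (1::real))" for i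
  proof -
    define f :: "'a \<Rightarrow> real" where "f j = (if j \<le> i then - 1 else 1)" for j
    have f: "f j * f j = 1" for j
      by (simp add: f_def)
    have B: "prod f B = prod f (B - C) * prod f (B \<inter> C)"
      by (metis Int_Diff_Un Int_Diff_disjoint finite mult.commute prod.union_disjoint)
    have C: "prod f C = prod f (C - B) * prod f (B \<inter> C)"
      by (metis Int_Diff_Un Int_Diff_disjoint Int_commute finite mult.commute prod.union_disjoint)
    have "prod f (B \<inter> C) * prod f (B \<inter> C) = 1"
      by (simp add: f flip: prod.distrib)
    moreover have "prod f (sym_diff B C) = prod f (B - C) * prod f (C - B)"
      by (rule prod.union_disjoint) auto
    ultimately have "prod f (sym_diff B C) = prod f B * prod f C"
      unfolding B C by (simp add: mult.commute mult.left_commute)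
    then show ?thesis
      by (simp add: f_def)
  qed
  then show ?thesis
    by (simp add: blade_sign_def prod.distrib)
qed

lemma blade_sign_empty [simp]: "blade_sign {} A = 1" "blade_sign A {} = 1"
  by (simp_all add: blade_sign_def)

lemma sum_sym_diff_shift:
  fixes f :: "'n::finite set \<Rightarrow> 'b::comm_monoid_add"
  shows "(\<Sum>B\<in>UNIV. f (sym_diff A B)) = (\<Sum>B\<in>UNIV. f B)"
  by (rule sum.reindex_bij_witness[of _ "sym_diff A" "sym_diff A"]) (auto simp: set_eq_iff)

instantiation clifford :: ("{finite,linorder}") real_algebra_1
begin

definition "1 = Clifford (\<lambda>A. if A = {} then 1 else 0)"
definition "a * b = Clifford (\<lambda>C. \<Sum>A\<in>UNIV.
  blade_sign A (sym_diff A C) * coord a A * coord b (sym_diff A C))"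

instance
proof
  fix a b c :: "'a clifford" and r :: real
  have sd: "sym_diff (sym_diff A B) (sym_diff A C) = sym_diff B C"
    "sym_diff A (sym_diff A C) = C" for A B C :: "'a set"
    by auto
  have "coord ((a * b) * c) D = coord (a * (b * c)) D" for D
  proof -
    have "coord ((a * b) * c) D = (\<Sum>B\<in>UNIV. \<Sum>A\<in>UNIV. blade_sign B (sym_diff B D) *
        (blade_sign A (sym_diff A B) * coord a A * coord b (sym_diff A B)) * coord c (sym_diff B D))"
      by (simp add: times_clifford_def sum_distrib_left sum_distrib_right)
    also have "\<dots> = (\<Sum>A\<in>UNIV. \<Sum>B\<in>UNIV. blade_sign B (sym_diff B D) *
        (blade_sign A (sym_diff A B) * coord a A * coord b (sym_diff A B)) * coord c (sym_diff B D))"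
      by (rule sum.swap)
    also have "\<dots> = (\<Sum>A\<in>UNIV. \<Sum>B\<in>UNIV. blade_sign (sym_diff A B) (sym_diff (sym_diff A B) D) *
        (blade_sign A (sym_diff A (sym_diff A B)) * coord a A * coord b (sym_diff A (sym_diff A B))) *
        coord c (sym_diff (sym_diff A B) D))"
      by (intro sum.cong refl sum_sym_diff_shift[symmetric])
    also have "\<dots> = (\<Sum>A\<in>UNIV. \<Sum>B\<in>UNIV. blade_sign A (sym_diff A D) * coord a A *
        (blade_sign B (sym_diff B (sym_diff A D)) * coord b B * coord c (sym_diff B (sym_diff A D))))"
    proof (intro sum.cong refl)
      fix A B :: "'a set"
      have 1: "sym_diff (sym_diff A B) D = sym_diff B (sym_diff A D)"
        by auto
      have "blade_sign A (sym_diff A D) =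
          blade_sign A B * blade_sign A (sym_diff B (sym_diff A D))"
        by (subst blade_sign_sym_diff_right[symmetric]) (simp only: sd)
      then show "blade_sign (sym_diff A B) (sym_diff (sym_diff A B) D) *
          (blade_sign A (sym_diff A (sym_diff A B)) * coord a A * coord b (sym_diff A (sym_diff A B))) *
          coord c (sym_diff (sym_diff A B) D) =
        blade_sign A (sym_diff A D) * coord a A *
        (blade_sign B (sym_diff B (sym_diff A D)) * coord b B * coord c (sym_diff B (sym_diff A D)))"
        unfolding sd 1 blade_sign_sym_diff_left by (simp add: mult_ac)
    qed
    also have "\<dots> = coord (a * (b * c)) D"
      by (simp add: times_clifford_def sum_distrib_left)
    finally show ?thesis .
  qed
  then show "a * b * c = a * (b * c)"
    by (simp add: clifford_eq_iff)
  show "(a + b) * c = a * c + b * c" "a * (b + c) = a * b + a * c"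
    "r *\<^sub>R a * b = r *\<^sub>R (a * b)" "a * r *\<^sub>R b = r *\<^sub>R (a * b)"
    by (simp_all add: clifford_eq_iff times_clifford_def sum.distrib sum_distrib_left algebra_simps)
  show "1 * a = a"
    by (simp add: clifford_eq_iff times_clifford_def one_clifford_def if_distrib if_distribR
        cong: if_cong)
  have "coord (a * 1) C = coord a C" for C
  proof -
    have "blade_sign A (sym_diff A C) * coord a A * coord 1 (sym_diff A C) =
        (if A = C then coord a A else 0)" for A :: "'a set"
    proof (cases "A = C")
      case False
      then have "sym_diff A C \<noteq> {}" by blast
      with False show ?thesis by (simp only: one_clifford_def coord_Clifford if_False mult_zero_right)
    qed (simp add: one_clifford_def)
    then have "coord (a * 1) C = (\<Sum>A\<in>UNIV. if A = C then coord a A else 0)"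
      by (simp only: times_clifford_def coord_Clifford)
    then show ?thesis by simp
  qed
  then show "a * 1 = a"
    by (simp add: clifford_eq_iff)
  show "(0::'a clifford) \<noteq> 1"
    by (auto simp: clifford_eq_iff one_clifford_def)
qed

end

text \<open>
  The norm is the Euclidean norm of the coefficients; it is only submultiplicative up to a constant,
  so no instance of \<^class>\<open>real_normed_algebra\<close> is available.
\<close>

definition blade :: "'n set \<Rightarrow> 'n clifford" where
  "blade A = Clifford (\<lambda>B. if B = A then 1 else 0)"

lemma coord_blade: "coord (blade A) B = (if B = A then 1 else 0)"
  by (simp add: blade_def)

lemma blade_eq_iff [simp]: "blade A = blade B \<longleftrightarrow> A = B"
  by (metis coord_blade zero_neq_one)

instantiation clifford :: (finite) euclidean_space
begin

definition inner_clifford :: "'a clifford \<Rightarrow> 'a clifford \<Rightarrow> real" where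
  "inner_clifford a b = (\<Sum>A\<in>UNIV. coord a A * coord b A)"
definition norm_clifford :: "'a clifford \<Rightarrow> real" where
  "norm_clifford a = sqrt (inner a a)"
definition sgn_clifford :: "'a clifford \<Rightarrow> 'a clifford" where
  "sgn_clifford a = a /\<^sub>R norm a"
definition dist_clifford :: "'a clifford \<Rightarrow> 'a clifford \<Rightarrow> real" where
  "dist_clifford a b = norm (a - b)"
definition uniformity_clifford :: "('a clifford \<times> 'a clifford) filter" where
  "uniformity_clifford = (INF e\<in>{0 <..}. principal {(a, b). dist a b < e})"
definition open_clifford :: "'a clifford set \<Rightarrow> bool" where
  "open_clifford U \<longleftrightarrow> (\<forall>a\<in>U. eventually (\<lambda>(a', b). a' = a \<longrightarrow> b \<in> U) uniformity)"
definition Basis_clifford :: "'a clifford set" where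
  "Basis_clifford = range blade"

instance
proof
  fix a b c :: "'a clifford" and r :: real and U :: "'a clifford set"
  show "sgn a = a /\<^sub>R norm a" "dist a b = norm (a - b)" "norm a = sqrt (inner a a)"
    "(uniformity :: ('a clifford \<times> 'a clifford) filter) = (INF e\<in>{0 <..}. principal {(a, b). dist a b < e})"
    "open U \<longleftrightarrow> (\<forall>a\<in>U. eventually (\<lambda>(a', b). a' = a \<longrightarrow> b \<in> U) uniformity)"
    by (simp_all only: sgn_clifford_def dist_clifford_def norm_clifford_def
        uniformity_clifford_def open_clifford_def)
  show "inner a b = inner b a"
    by (simp add: inner_clifford_def mult.commute)
  show "inner (a + b) c = inner a c + inner b c" "inner (r *\<^sub>R a) b = r * inner a b"
    by (simp_all add: inner_clifford_def sum.distrib sum_distrib_left algebra_simps)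
  show "0 \<le> inner a a"
    by (simp add: inner_clifford_def sum_nonneg)
  show "inner a a = 0 \<longleftrightarrow> a = 0"
    by (simp add: inner_clifford_def sum_nonneg_eq_0_iff clifford_eq_iff)
  show "(Basis :: 'a clifford set) \<noteq> {}" "finite (Basis :: 'a clifford set)"
    by (simp_all add: Basis_clifford_def)
  have *: "inner a (blade A) = coord a A" for A and a :: "'a clifford"
    by (simp add: inner_clifford_def coord_blade if_distrib if_distribR cong: if_cong)
  show "inner a b = (if a = b then 1 else 0)" if ab: "a \<in> Basis" "b \<in> Basis"
  proof -
    obtain A B where "a = blade A" "b = blade B"
      using ab by (auto simp: Basis_clifford_def)
    then show ?thesis
      by (simp add: * coord_blade)
  qed
  show "(\<forall>u\<in>Basis. inner a u = 0) \<longleftrightarrow> a = 0"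
    by (simp add: Basis_clifford_def * clifford_eq_iff)
qed

end

definition gen :: "'n \<Rightarrow> 'n clifford" where
  "gen i = blade {i}"

lemma gen_anticommute:
  "gen i * gen j + gen j * gen i = (if i = j then - 2 else (0::'n::{finite,linorder} clifford))"
proof -
  have *: "blade A * blade B = blade_sign A B *\<^sub>R blade (sym_diff A B)" for A B :: "'n set"
  proof -
    have eq: "sym_diff A C = B \<longleftrightarrow> C = sym_diff A B" for C
      by auto
    have "coord (blade A * blade B) C = (if C = sym_diff A B then blade_sign A B else 0)" for C
    proof -
      have "coord (blade A * blade B) C =
          (\<Sum>A'\<in>UNIV. if A' = A then blade_sign A (sym_diff A C) * coord (blade B) (sym_diff A C) else 0)"
        unfolding times_clifford_def coord_Clifford coord_blade
        by (intro sum.cong refl) (simp only: mult_1_right mult_zero_right mult_zero_left split: if_split, simp)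
      also have "\<dots> = blade_sign A (sym_diff A C) * coord (blade B) (sym_diff A C)"
        by simp
      also have "\<dots> = (if sym_diff A C = B then blade_sign A B else 0)"
        unfolding coord_blade by (simp only: mult_1_right mult_zero_right split: if_split) simp
      finally show ?thesis
        by (simp only: eq)
    qed
    then show ?thesis
      by (simp add: clifford_eq_iff coord_blade del: Un_iff Diff_iff)
  qed
  have one: "blade {} = (1 :: 'n clifford)"
    by (simp add: blade_def one_clifford_def)
  show ?thesis
  proof (cases "i = j")
    case True
    then show ?thesis
      by (simp add: gen_def * one blade_sign_def)
  next
    case False
    have swap: "sym_diff {j} {i} = sym_diff {i} {j}"
      by auto
    have "blade_sign {i} {j} + blade_sign {j} {i} = 0"
      using False by (auto simp: blade_sign_def)
    then have "blade_sign {i} {j} *\<^sub>R blade (sym_diff {i} {j}) +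
        blade_sign {j} {i} *\<^sub>R blade (sym_diff {i} {j}) = 0"
      by (metis scaleR_left_distrib scaleR_zero_left)
    with False show ?thesis
      by (simp only: gen_def * swap if_False)
  qed
qed

text \<open>Two-sided inverse; unspecified for non-units.\<close>

definition clifford_inverse :: "'n::{finite,linorder} clifford \<Rightarrow> 'n clifford" where
  "clifford_inverse a = (THE b. a * b = 1 \<and> b * a = 1)"


section \<open>Paravectors and axially symmetric sets\<close>

text \<open>
  $\mathbb{R}^{n+1}$ is \<^typ>\<open>real \<times> (real ^ 'n)\<close>, the pair $(x_0, \underline x)$, and \<open>paravec\<close> is the
  identification with a subspace of the algebra. The index type plays the role of $\{1, \dots, n\}$.
\<close>

type_synonym 'n point = "real \<times> (real, 'n) vec"

definition paravec :: "'n::{finite,linorder} point \<Rightarrow> 'n clifford" where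
  "paravec x = fst x *\<^sub>R 1 + (\<Sum>j\<in>UNIV. vec_nth (snd x) j *\<^sub>R gen j)"

abbreviation vec_unit :: "real ^ ('n::{finite,linorder}) \<Rightarrow> 'n clifford" where
  "vec_unit I \<equiv> paravec (0, I)"

definition para_cnj :: "'n::{finite,linorder} point \<Rightarrow> 'n point" where
  "para_cnj x = (fst x, - snd x)"

definition axial_class :: "'n::finite point \<Rightarrow> 'n point set" where
  "axial_class x = {(fst x, norm (snd x) *\<^sub>R I) | I. I \<in> sphere 0 1}"

definition axially_symmetric :: "'n::finite point set \<Rightarrow> bool" where
  "axially_symmetric U \<longleftrightarrow> (\<forall>x\<in>U. axial_class x \<subseteq> U)"

text \<open>The set $\mathcal U$ of all $(u,v)$ with $u + \mathbb S v \subset U$; negative $v$ included.\<close>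

definition uv_set :: "'n::finite point set \<Rightarrow> (real \<times> real) set" where
  "uv_set U = {(u, v). \<forall>I\<in>sphere 0 1. (u, v *\<^sub>R I) \<in> U}"

text \<open>The plane $\mathbb C_I$ is parametrised by $u + iv \mapsto u + Iv$.\<close>

definition embed_C :: "real ^ 'n \<Rightarrow> complex \<Rightarrow> 'n point" where
  "embed_C I z = (Re z, Im z *\<^sub>R I)"

definition slice :: "'n point set \<Rightarrow> real ^ 'n \<Rightarrow> complex set" where
  "slice U I = {z. embed_C I z \<in> U}"

text \<open>
  A finite family of disjoint piecewise $C^1$ Jordan curves that make up the boundary of \<open>V\<close>. That
  they are positively oriented with respect to \<open>V\<close> (which need be neither connected nor simply
  connected, so that inner curves run clockwise) is expressed by the total winding number.
\<close>

definition positive_boundary :: "complex set \<Rightarrow> (real \<Rightarrow> complex) set \<Rightarrow> bool" where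
  "positive_boundary V \<Gamma> \<longleftrightarrow>
     finite \<Gamma> \<and>
     (\<forall>\<gamma>\<in>\<Gamma>. valid_path \<gamma> \<and> simple_path \<gamma> \<and> pathfinish \<gamma> = pathstart \<gamma>) \<and>
     pairwise (\<lambda>\<gamma> \<delta>. path_image \<gamma> \<inter> path_image \<delta> = {}) \<Gamma> \<and>
     (\<Union>\<gamma>\<in>\<Gamma>. path_image \<gamma>) = frontier V \<and>
     (\<forall>z\<in>V. (\<Sum>\<gamma>\<in>\<Gamma>. winding_number \<gamma> z) = 1) \<and>
     (\<forall>z. z \<notin> closure V \<longrightarrow> (\<Sum>\<gamma>\<in>\<Gamma>. winding_number \<gamma> z) = 0)"

definition slice_cauchy_domain :: "'n::finite point set \<Rightarrow> bool" where
  "slice_cauchy_domain U \<longleftrightarrow>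
     open U \<and> axially_symmetric U \<and>
     (\<forall>I\<in>sphere 0 1. \<exists>\<Gamma>. positive_boundary (slice U I) \<Gamma>)"


section \<open>Differential operators\<close>

definition partial :: "'a::real_normed_vector \<Rightarrow> ('a \<Rightarrow> 'b::real_normed_vector) \<Rightarrow> 'a \<Rightarrow> 'b" where
  "partial b f x = vector_derivative (\<lambda>t. f (x + t *\<^sub>R b)) (at 0)"

primrec Ck_on :: "nat \<Rightarrow> 'a::euclidean_space set \<Rightarrow> ('a \<Rightarrow> 'b::real_normed_vector) \<Rightarrow> bool" where
  "Ck_on 0 S f \<longleftrightarrow> continuous_on S f"
| "Ck_on (Suc k) S f \<longleftrightarrow> continuous_on S f \<and>
     (\<forall>b\<in>Basis. (\<forall>x\<in>S. (\<lambda>t. f (x + t *\<^sub>R b)) differentiable (at (0::real))) \<and>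
        Ck_on k S (partial b f))"

abbreviation d_0 :: "('n::finite point \<Rightarrow> 'b::real_normed_vector) \<Rightarrow> 'n point \<Rightarrow> 'b" where
  "d_0 \<equiv> partial (1, 0)"

abbreviation d_vec :: "'n \<Rightarrow> ('n::finite point \<Rightarrow> 'b::real_normed_vector) \<Rightarrow> 'n point \<Rightarrow> 'b" where
  "d_vec i \<equiv> partial (0, axis i 1)"

type_synonym 'n field_fun = "'n point \<Rightarrow> 'n clifford"

definition D_left :: "'n::{finite,linorder} field_fun \<Rightarrow> 'n field_fun" where
  "D_left f x = d_0 f x + (\<Sum>i\<in>UNIV. gen i * d_vec i f x)"

definition Dbar_left :: "'n::{finite,linorder} field_fun \<Rightarrow> 'n field_fun" where
  "Dbar_left f x = d_0 f x - (\<Sum>i\<in>UNIV. gen i * d_vec i f x)"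

definition D_right :: "'n::{finite,linorder} field_fun \<Rightarrow> 'n field_fun" where
  "D_right f x = d_0 f x + (\<Sum>i\<in>UNIV. d_vec i f x * gen i)"

definition Dbar_right :: "'n::{finite,linorder} field_fun \<Rightarrow> 'n field_fun" where
  "Dbar_right f x = d_0 f x - (\<Sum>i\<in>UNIV. d_vec i f x * gen i)"

definition laplace :: "'n::{finite,linorder} field_fun \<Rightarrow> 'n field_fun" where
  "laplace f x = d_0 (d_0 f) x + (\<Sum>i\<in>UNIV. d_vec i (d_vec i f) x)"


section \<open>Slice hyperholomorphic and axially polyanalytic functions\<close>

definition slice_components ::
  "'n::{finite,linorder} point set \<Rightarrow> (real \<times> real \<Rightarrow> 'n clifford) \<Rightarrow> (real \<times> real \<Rightarrow> 'n clifford) \<Rightarrow> bool"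
where
  "slice_components U \<alpha> \<beta> \<longleftrightarrow>
     (\<forall>(u, v)\<in>uv_set U.
        \<alpha> differentiable (at (u, v)) \<and> \<beta> differentiable (at (u, v)) \<and>
        \<alpha> (u, - v) = \<alpha> (u, v) \<and> \<beta> (u, - v) = - \<beta> (u, v) \<and>
        partial (1, 0) \<alpha> (u, v) = partial (0, 1) \<beta> (u, v) \<and>
        partial (0, 1) \<alpha> (u, v) = - partial (1, 0) \<beta> (u, v))"

definition left_slice_hyperholomorphic ::
  "'n::{finite,linorder} point set \<Rightarrow> 'n field_fun \<Rightarrow> bool" where
  "left_slice_hyperholomorphic U f \<longleftrightarrow> open U \<and> axially_symmetric U \<and>
     (\<exists>\<alpha> \<beta>. slice_components U \<alpha> \<beta> \<and>
        (\<forall>I\<in>sphere 0 1. \<forall>(u, v)\<in>uv_set U. f (u, v *\<^sub>R I) = \<alpha> (u, v) + vec_unit I * \<beta> (u, v)))"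

definition right_slice_hyperholomorphic ::
  "'n::{finite,linorder} point set \<Rightarrow> 'n field_fun \<Rightarrow> bool" where
  "right_slice_hyperholomorphic U f \<longleftrightarrow> open U \<and> axially_symmetric U \<and>
     (\<exists>\<alpha> \<beta>. slice_components U \<alpha> \<beta> \<and>
        (\<forall>I\<in>sphere 0 1. \<forall>(u, v)\<in>uv_set U. f (u, v *\<^sub>R I) = \<alpha> (u, v) + \<beta> (u, v) * vec_unit I))"

definition even_odd_on ::
  "(real \<times> real) set \<Rightarrow> (real \<times> real \<Rightarrow> 'b::real_vector) \<Rightarrow> (real \<times> real \<Rightarrow> 'b) \<Rightarrow> bool" where
  "even_odd_on P A B \<longleftrightarrow> (\<forall>(u, v)\<in>P. A (u, - v) = A (u, v) \<and> B (u, - v) = - B (u, v))"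

text \<open>
  Below, \<^term>\<open>sgn (snd x)\<close> is $\underline x / |\underline x|$, and $0$ if $\underline x = 0$, where
  $B$ vanishes by oddness.
\<close>

definition left_axially_polyanalytic ::
  "nat \<Rightarrow> 'n::{finite,linorder} point set \<Rightarrow> 'n field_fun \<Rightarrow> bool" where
  "left_axially_polyanalytic m U g \<longleftrightarrow>
     Ck_on m U g \<and> (\<forall>x\<in>U. (D_left ^^ m) g x = 0) \<and>
     (\<exists>A B. even_odd_on (uv_set U) A B \<and>
        (\<forall>x\<in>U. g x = A (fst x, norm (snd x)) + vec_unit (sgn (snd x)) * B (fst x, norm (snd x))))"

definition right_axially_polyanalytic ::
  "nat \<Rightarrow> 'n::{finite,linorder} point set \<Rightarrow> 'n field_fun \<Rightarrow> bool" where
  "right_axially_polyanalytic m U g \<longleftrightarrow>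
     Ck_on m U g \<and> (\<forall>x\<in>U. (D_right ^^ m) g x = 0) \<and>
     (\<exists>A B. even_odd_on (uv_set U) A B \<and>
        (\<forall>x\<in>U. g x = A (fst x, norm (snd x)) + B (fst x, norm (snd x)) * vec_unit (sgn (snd x))))"


section \<open>Kernels and slice integrals\<close>

text \<open>For odd $n$: the exponents $h_n = (n-1)/2$ and $(n+1)/2$ are natural numbers.\<close>

definition sce_exponent :: "'n::finite itself \<Rightarrow> nat" where
  "sce_exponent _ = (CARD('n) - 1) div 2"

definition gamma_const :: "'n::finite itself \<Rightarrow> real" where
  "gamma_const _ =
     (Gamma ((real CARD('n) + 1) / 2))\<^sup>2 * 2 ^ (CARD('n) - 1) * (- 1) ^ ((CARD('n) - 1) div 2)"

definition Q_c :: "'n::{finite,linorder} point \<Rightarrow> 'n point \<Rightarrow> 'n clifford" where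
  "Q_c s x = (paravec s)\<^sup>2 - (2 * fst x) *\<^sub>R paravec s + ((norm x)\<^sup>2) *\<^sub>R 1"

definition F_left :: "'n::{finite,linorder} point \<Rightarrow> 'n point \<Rightarrow> 'n clifford" where
  "F_left s x = gamma_const TYPE('n) *\<^sub>R
     ((paravec s - paravec (para_cnj x)) * clifford_inverse (Q_c s x) ^ ((CARD('n) + 1) div 2))"

definition F_right :: "'n::{finite,linorder} point \<Rightarrow> 'n point \<Rightarrow> 'n clifford" where
  "F_right s x = gamma_const TYPE('n) *\<^sub>R
     (clifford_inverse (Q_c s x) ^ ((CARD('n) + 1) div 2) * (paravec s - paravec (para_cnj x)))"

definition P_left :: "nat \<Rightarrow> 'n::{finite,linorder} point \<Rightarrow> 'n point \<Rightarrow> 'n clifford" where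
  "P_left l s x = (let k = sce_exponent TYPE('n) - l in
     ((- 1) ^ k / fact k) *\<^sub>R (F_left s x * (paravec s - fst x *\<^sub>R 1) ^ k))"

definition P_right :: "nat \<Rightarrow> 'n::{finite,linorder} point \<Rightarrow> 'n point \<Rightarrow> 'n clifford" where
  "P_right l s x = (let k = sce_exponent TYPE('n) - l in
     ((- 1) ^ k / fact k) *\<^sub>R ((paravec s - fst x *\<^sub>R 1) ^ k * F_right s x))"

text \<open>
  \<open>slice_integral I \<Gamma> K f\<close> is the integral of $K(s)\, ds_I\, f(s)$ over the curves of \<open>\<Gamma>\<close> in
  $\mathbb C_I$. Along $\gamma$, $ds_I = ds\,(-I)$ is the element $\gamma'(t)\,(-I)\,dt$ of
  $\mathbb C_I$; it does not commute with the values of $K$ and $f$, hence its place in the middle.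
\<close>

definition slice_integral ::
  "real ^ ('n::{finite,linorder}) \<Rightarrow> (real \<Rightarrow> complex) set \<Rightarrow> 'n field_fun \<Rightarrow> 'n field_fun \<Rightarrow> 'n clifford"
where
  "slice_integral I \<Gamma> K f = (\<Sum>\<gamma>\<in>\<Gamma>. integral {0..1} (\<lambda>t.
     K (embed_C I (\<gamma> t)) *
     (paravec (embed_C I (vector_derivative \<gamma> (at t within {0..1}))) * - vec_unit I) *
     f (embed_C I (\<gamma> t))))"

definition left_poly_map :: "nat \<Rightarrow> 'n::{finite,linorder} field_fun \<Rightarrow> 'n field_fun" where
  "left_poly_map l f = (laplace ^^ l) ((Dbar_left ^^ (sce_exponent TYPE('n) - l)) f)"

definition right_poly_map :: "nat \<Rightarrow> 'n::{finite,linorder} field_fun \<Rightarrow> 'n field_fun" where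
  "right_poly_map l f = (Dbar_right ^^ (sce_exponent TYPE('n) - l)) ((laplace ^^ l) f)"

definition left_poly_integral ::
  "nat \<Rightarrow> real ^ ('n::{finite,linorder}) \<Rightarrow> (real \<Rightarrow> complex) set \<Rightarrow> 'n field_fun \<Rightarrow> 'n field_fun" where
  "left_poly_integral l I \<Gamma> f x =
     (1 / (2 * pi)) *\<^sub>R slice_integral I \<Gamma> (\<lambda>s. P_left l s x) f"

definition right_poly_integral ::
  "nat \<Rightarrow> real ^ ('n::{finite,linorder}) \<Rightarrow> (real \<Rightarrow> complex) set \<Rightarrow> 'n field_fun \<Rightarrow> 'n field_fun" where
  "right_poly_integral l I \<Gamma> f x =
     (1 / (2 * pi)) *\<^sub>R slice_integral I \<Gamma> f (\<lambda>s. P_right l s x)"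

end

theory Submission
  imports Defs
begin

text \<open>
  A slice hyperholomorphic $f = \alpha + I\beta$ is, blade by blade, a holomorphic function $F$ with
  $F(\bar z) = \overline{F(z)}$. With $w = s - x_0$ and $q = w^2 + |\underline x|^2$, the sums $J_{j,m}$
  (\<open>residue_field\<close>) of the residues of $w^j q^{-m} F(s)$ at $z$ and $\bar z$, where $z = x_0 + i|\underline x|$, satisfy
  $\partial_0 J_{j,m} = 2m J_{j+1,m+1} - j J_{j-1,m}$ and $\partial_i J_{j,m} = -2m x_i J_{j,m+1}$.
  Hence the fields $Y_{j,m} = J_{j+1,m} + \underline x J_{j,m}$ (\<open>axial_field\<close>) are smooth, $f = Y_{0,1}$, and
  $D Y_{j,m} = (2m-1-n) J_{j,m} - j Y_{j-1,m}$, $\overline D J_{0,m} = 2m Y_{0,m+1}$,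
  $\overline D Y_{0,m} = (n-1-2m) J_{0,m} + 4m Y_{1,m+1}$.
  So $\Delta^\ell f$ is a multiple of $Y_{0,\ell+1}$. For $n = 2h+1$, $\overline D^k Y_{0,h+1-k}$ is a
  multiple of $Y_{k,h+1}$ (induction on $k$ for all $F$, where $Y_{1,m}$ for $F$ is $Y_{0,m}$ for $sF$
  minus $x_0 Y_{0,m}$ for $F$), and $D$ maps $Y_{k,h+1}$ to $-k Y_{k-1,h+1}$. The residue theorem for
  cycles turns the residues in $Y_{k,h+1}$ into the integral over the boundary curves.
\<close>

section \<open>The residue theorem for cycles\<close>

text \<open>The norm of the vector part is not differentiable on the real axis, and \<alpha>,
  \<beta> are only assumed differentiable. Residue sums remove both obstacles: near any point they
  are integrals over fixed circles, so smoothness is read off under the integral sign; and only the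
  square of the norm enters the kernel, so differentiation at real points, where the two poles
  merge, needs no limit argument. The differential formulas are identities in the family F rather
  than in f. This leaves the freedom to replace F(s) by s F(s), which closes the induction for
  powers of the conjugate operator: that operator alone does not stay within the fields Y_{0,m}. The
  slice of U may be disconnected and may have holes, so its boundary is a cycle known only through
  its total winding numbers. The residue theorem is therefore extended from one loop in a connected
  set to such cycles.\<close>

lemma valid_loop_through_cycle:
  fixes S :: "complex set"
  assumes S: "open S" "connected S" "S \<noteq> {}" and "finite G"
    and "\<And>\<gamma>. \<gamma> \<in> G \<Longrightarrow> valid_path \<gamma> \<and> pathfinish \<gamma> = pathstart \<gamma> \<and> path_image \<gamma> \<subseteq> S"
  shows "\<exists>p. valid_path p \<and> pathfinish p = pathstart p \<and> path_image p \<subseteq> S \<and>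
    (\<forall>f. f holomorphic_on S \<longrightarrow> contour_integral p f = (\<Sum>\<gamma>\<in>G. contour_integral \<gamma> f))"
  using \<open>finite G\<close> assms(5)
proof (induction G)
  case empty
  obtain a where "a \<in> S" using S by blast
  then show ?case
    by (intro exI[of _ "linepath a a"] conjI allI impI)
      (simp_all only: valid_path_linepath pathstart_linepath pathfinish_linepath path_image_linepath
        contour_integral_trivial sum.empty closed_segment_idem, simp)
next
  case (insert \<gamma> G)
  then obtain p where p: "valid_path p" "pathfinish p = pathstart p" "path_image p \<subseteq> S"
    and pf: "\<And>f. f holomorphic_on S \<Longrightarrow> contour_integral p f = (\<Sum>\<gamma>\<in>G. contour_integral \<gamma> f)"
    by blast
  have \<gamma>: "valid_path \<gamma>" "pathfinish \<gamma> = pathstart \<gamma>" "path_image \<gamma> \<subseteq> S"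
    using insert.prems by auto
  have "pathstart p \<in> S" "pathstart \<gamma> \<in> S"
    using p(3) \<gamma>(3) by auto
  then obtain g where g: "polynomial_function g" "path_image g \<subseteq> S"
      "pathstart g = pathstart p" "pathfinish g = pathstart \<gamma>"
    using connected_open_polynomial_connected[OF S(1,2)] by metis
  have vg: "valid_path g"
    by (rule valid_path_polynomial_function[OF g(1)])
  \<comment> \<open>From the base point of \<open>p\<close> travel along \<open>g\<close>, once
    round \<gamma>, and back along \<open>g\<close>: in the integral the two passages of
    \<open>g\<close> cancel.\<close>
  define q where "q = p +++ (g +++ (\<gamma> +++ reversepath g))"
  have "valid_path q"
    using p \<gamma> g vg by (auto simp: q_def intro!: valid_path_join)
  moreover have "pathfinish q = pathstart q"
    using p g by (simp add: q_def)
  moreover have "path_image q \<subseteq> S"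
    using p \<gamma> g by (auto simp: q_def path_image_join)
  moreover have "contour_integral q f = (\<Sum>\<gamma>\<in>insert \<gamma> G. contour_integral \<gamma> f)"
    if f: "f holomorphic_on S" for f
  proof -
    have i: "f contour_integrable_on r" if "valid_path r" "path_image r \<subseteq> S" for r
      using contour_integrable_holomorphic_simple[OF f S(1) that] .
    have "contour_integral q f = contour_integral p f + contour_integral \<gamma> f"
      using p \<gamma> g vg i[of g] i[of p] i[of \<gamma>]
      by (simp add: q_def contour_integrable_reversepath contour_integral_reversepath)
    then show ?thesis
      using insert.hyps pf[OF f] by simp
  qed
  ultimately show ?case by blast
qed

text \<open>The joined loop has the integrals of the cycle for all functions holomorphic off
  \<open>pts\<close>, among them 1/(w - z) for z outside \<open>S - pts\<close>. So its winding
  numbers there are the sums over the cycle, and the residue theorem for one loop applies.\<close>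

lemma Residue_theorem_cycle_connected:
  fixes S :: "complex set"
  assumes S: "open S" "connected S" and "finite pts" "finite G"
    and f: "f holomorphic_on S - pts"
    and G: "\<And>\<gamma>. \<gamma> \<in> G \<Longrightarrow> valid_path \<gamma> \<and> pathfinish \<gamma> = pathstart \<gamma> \<and> path_image \<gamma> \<subseteq> S - pts"
    and 0: "\<And>z. z \<notin> S \<Longrightarrow> (\<Sum>\<gamma>\<in>G. winding_number \<gamma> z) = 0"
  shows "(\<Sum>\<gamma>\<in>G. contour_integral \<gamma> f) =
    2 * pi * \<i> * (\<Sum>p\<in>pts. (\<Sum>\<gamma>\<in>G. winding_number \<gamma> p) * residue f p)"
proof (cases "S - pts = {}")
  case True
  \<comment> \<open>A path image is nonempty, so no curve fits into the empty set.\<close>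
  then have "G = {}" using G by fastforce
  then show ?thesis by simp
next
  case False
  have o: "open (S - pts)"
    using S(1) \<open>finite pts\<close> by (simp add: finite_imp_closed open_Diff)
  have c: "connected (S - pts)"
    using S \<open>finite pts\<close> by (intro connected_open_delete_finite) auto
  obtain p where p: "valid_path p" "pathfinish p = pathstart p" "path_image p \<subseteq> S - pts"
    and pf: "\<And>f. f holomorphic_on S - pts \<Longrightarrow>
      contour_integral p f = (\<Sum>\<gamma>\<in>G. contour_integral \<gamma> f)"
    using valid_loop_through_cycle[OF o c False \<open>finite G\<close> G] by blast
  have w: "winding_number p z = (\<Sum>\<gamma>\<in>G. winding_number \<gamma> z)" if z: "z \<notin> S - pts" for z
  proof -
    have "(\<lambda>w. 1 / (w - z)) holomorphic_on S - pts"
      using z by (intro holomorphic_intros) auto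
    note * = pf[OF this]
    have "winding_number p z = 1 / (2 * pi * \<i>) * contour_integral p (\<lambda>w. 1 / (w - z))"
      by (rule winding_number_valid_path) (use p z in auto)
    also have "\<dots> = (\<Sum>\<gamma>\<in>G. 1 / (2 * pi * \<i>) * contour_integral \<gamma> (\<lambda>w. 1 / (w - z)))"
      by (simp only: * sum_distrib_left)
    also have "\<dots> = (\<Sum>\<gamma>\<in>G. winding_number \<gamma> z)"
    proof (rule sum.cong[OF refl])
      fix \<gamma> assume "\<gamma> \<in> G"
      then have "valid_path \<gamma>" "z \<notin> path_image \<gamma>" using G z by blast+
      then show "1 / (2 * pi * \<i>) * contour_integral \<gamma> (\<lambda>w. 1 / (w - z)) = winding_number \<gamma> z"
        by (simp add: winding_number_valid_path)
    qed
    finally show ?thesis .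
  qed
  have "contour_integral p f = 2 * pi * \<i> * (\<Sum>z\<in>pts. winding_number p z * residue f z)"
    by (rule Residue_theorem[OF S \<open>finite pts\<close> f p]) (simp add: w 0)
  then show ?thesis
    using pf[OF f] by (simp add: w)
qed

text \<open>
  The part of a cycle that lies in one component \<open>C\<close> is itself null homologous there: on \<open>C\<close> outside
  \<open>K\<close> its winding number is the negative of that of the remaining part, which is constant on \<open>C\<close>, and
  every component of the complement of \<open>K \<inter> C\<close>, in particular the unbounded one, meets \<open>C\<close>.
\<close>

lemma winding_number_cycle_component:
  fixes S :: "complex set"
  assumes S: "open S" and K: "compact K" "K \<subseteq> S" and "finite G"
    and G: "\<And>\<gamma>. \<gamma> \<in> G \<Longrightarrow> path \<gamma> \<and> pathfinish \<gamma> = pathstart \<gamma> \<and> path_image \<gamma> \<subseteq> K"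
    and 0: "\<And>z. z \<notin> K \<Longrightarrow> (\<Sum>\<gamma>\<in>G. winding_number \<gamma> z) = 0"
    and C: "C \<in> components S" and z: "z \<notin> C"
  shows "(\<Sum>\<gamma> | \<gamma> \<in> G \<and> path_image \<gamma> \<subseteq> C. winding_number \<gamma> z) = 0"
proof -
  define H where "H = {\<gamma>\<in>G. path_image \<gamma> \<subseteq> C}"
  define KC where "KC = K \<inter> C"
  have "open C" using C S by (rule open_components[rotated])
  have dich: "path_image \<gamma> \<subseteq> C \<or> path_image \<gamma> \<inter> C = {}" if "\<gamma> \<in> G" for \<gamma>
    using components_maximal[OF C, of "path_image \<gamma>"] G[OF that] K(2) connected_path_image[of \<gamma>]
    by blast
  have H: "path \<gamma>" "pathfinish \<gamma> = pathstart \<gamma>" "path_image \<gamma> \<subseteq> KC" if "\<gamma> \<in> H" for \<gamma>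
    using that G by (auto simp: H_def KC_def)
  have R: "path \<gamma>" "pathfinish \<gamma> = pathstart \<gamma>" "path_image \<gamma> \<inter> C = {}" if "\<gamma> \<in> G - H" for \<gamma>
    using that G dich by (auto simp: H_def)
  have fin: "finite H" "finite (G - H)" using \<open>finite G\<close> by (auto simp: H_def)
  have split: "(\<Sum>\<gamma>\<in>G. winding_number \<gamma> y) = (\<Sum>\<gamma>\<in>H. winding_number \<gamma> y) + (\<Sum>\<gamma>\<in>G-H. winding_number \<gamma> y)" for y
    using sum.subset_diff[of H G] \<open>finite G\<close> by (simp add: H_def add.commute)
  have const: "(\<Sum>\<gamma>\<in>M. winding_number \<gamma> y) = (\<Sum>\<gamma>\<in>M. winding_number \<gamma> y')"
    if "connected B" "y \<in> B" "y' \<in> B"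
      "\<And>\<gamma>. \<gamma> \<in> M \<Longrightarrow> path \<gamma> \<and> pathfinish \<gamma> = pathstart \<gamma> \<and> B \<inter> path_image \<gamma> = {}" for M B y y'
  proof (rule sum.cong[OF refl])
    fix \<gamma> assume "\<gamma> \<in> M"
    then have "winding_number \<gamma> constant_on B"
      using that(4)[of \<gamma>] by (intro winding_number_constant[OF _ _ that(1)]) auto
    then show "winding_number \<gamma> y = winding_number \<gamma> y'"
      using that(2,3) by (auto simp: constant_on_def)
  qed
  \<comment> \<open>Taking the other components, which form an open set, away from \<open>K\<close>
    leaves exactly \<open>KC\<close>; hence \<open>KC\<close> is compact although \<open>C\<close>
    need not be closed.\<close>
  have "open (\<Union>(components S - {C}))"
    using S open_components by blast
  moreover have "KC = K - \<Union>(components S - {C})"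
    using K(2) Union_components[of S] C components_nonoverlap[of _ S C]
    unfolding KC_def by blast
  ultimately have cKC: "compact KC"
    using K(1) by (simp add: compact_diff)
  show ?thesis
  proof (cases "KC = {}")
    case True
    then have "H = {}" using H(3) by fastforce
    then have "(\<Sum>\<gamma>\<in>H. winding_number \<gamma> z) = 0" by simp
    then show ?thesis unfolding H_def .
  next
    case False
    obtain c where c: "c \<in> C" using C in_components_nonempty by blast
    define k where "k = (\<Sum>\<gamma>\<in>G-H. winding_number \<gamma> c)"
    have k: "(\<Sum>\<gamma>\<in>G-H. winding_number \<gamma> y) = k" if "y \<in> C" for y
      unfolding k_def by (rule const[OF in_components_connected[OF C] that c]) (use R in auto)
    have HC: "(\<Sum>\<gamma>\<in>H. winding_number \<gamma> y) = - k" if "y \<in> C" "y \<notin> KC" for y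
      using that split[of y] 0[of y] k[of y] by (simp add: KC_def add_eq_0_iff2)
    have HO: "(\<Sum>\<gamma>\<in>H. winding_number \<gamma> y) = - k" if y: "y \<notin> KC" for y
    proof -
      define B where "B = connected_component_set (- KC) y"
      have yB: "y \<in> B" using y by (simp add: B_def)
      have B: "B \<in> components (- KC)"
        using y by (auto simp: B_def components_def)
      have oK: "open (- KC)" using cKC by (simp add: compact_imp_closed open_Compl)
      have BKC: "B \<subseteq> - KC" using B in_components_subset by blast
      \<comment> \<open>Otherwise a boundary point of \<open>B\<close> would lie in
        \<open>KC\<close>, hence in the open set \<open>C\<close>, which would then meet
        \<open>B\<close> after all.\<close>
      have "B \<inter> C \<noteq> {}"
      proof
        assume "B \<inter> C = {}"
        have "B \<noteq> UNIV" using BKC False by blast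
        then have "frontier B \<noteq> {}" using yB frontier_not_empty by blast
        then obtain b where b: "b \<in> frontier B" by blast
        have "open B" using oK B open_components by blast
        then have "b \<in> KC"
          using frontier_of_components_subset[OF B] b oK cKC
          by (auto simp: frontier_def interior_open compact_imp_closed)
        then have "b \<in> C" by (simp add: KC_def)
        moreover have "b \<in> closure B" using b by (simp add: frontier_def)
        ultimately show False
          using open_Int_closure_eq_empty[OF \<open>open C\<close>, of B] \<open>B \<inter> C = {}\<close> by blast
      qed
      then obtain d where d: "d \<in> B" "d \<in> C" by blast
      have "(\<Sum>\<gamma>\<in>H. winding_number \<gamma> y) = (\<Sum>\<gamma>\<in>H. winding_number \<gamma> d)"
        by (rule const[of B]) (use yB d H BKC in_components_connected[OF B] in fastforce)+
      also have "\<dots> = - k" by (rule HC) (use d BKC in auto)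
      finally show ?thesis .
    qed
    \<comment> \<open>Far away from \<open>KC\<close> all winding numbers vanish; this point fixes
      the constant as \<open>k = 0\<close>.\<close>
    obtain r where r: "KC \<subseteq> ball 0 r" "r > 0"
      using bounded_subset_ballD[OF compact_imp_bounded[OF cKC]] by blast
    have far: "of_real r \<notin> ball (0::complex) r" using r by simp
    have "(\<Sum>\<gamma>\<in>H. winding_number \<gamma> (of_real r)) = 0"
    proof (intro sum.neutral ballI winding_number_zero_outside[of _ "ball 0 r"])
      show "path_image \<gamma> \<subseteq> ball 0 r" if "\<gamma> \<in> H" for \<gamma>
        using H(3)[OF that] r(1) by blast
    qed (use H far in auto)
    then have "k = 0" using HO[of "of_real r"] subsetD[OF r(1)] far by fastforce
    moreover have "z \<notin> KC" using z by (simp add: KC_def)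
    ultimately show ?thesis using HO[of z] unfolding H_def by simp
  qed
qed

text \<open>Each curve is connected and so lies in one component of \<open>S\<close>. The connected
  version is applied to the curves of each component; points of \<open>pts\<close> outside that
  component contribute nothing there, because that part of the cycle has total winding number 0
  around them.\<close>

theorem Residue_theorem_cycle:
  fixes S :: "complex set"
  assumes S: "open S" and K: "compact K" "K \<subseteq> S" and "finite G" "finite pts"
    and f: "f holomorphic_on S - pts"
    and G: "\<And>\<gamma>. \<gamma> \<in> G \<Longrightarrow> valid_path \<gamma> \<and> pathfinish \<gamma> = pathstart \<gamma> \<and> path_image \<gamma> \<subseteq> K - pts"
    and 0: "\<And>z. z \<notin> K \<Longrightarrow> (\<Sum>\<gamma>\<in>G. winding_number \<gamma> z) = 0"
  shows "(\<Sum>\<gamma>\<in>G. contour_integral \<gamma> f) =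
    2 * pi * \<i> * (\<Sum>p\<in>pts. (\<Sum>\<gamma>\<in>G. winding_number \<gamma> p) * residue f p)"
proof -
  define comp where "comp \<gamma> = connected_component_set S (pathstart \<gamma>)" for \<gamma> :: "real \<Rightarrow> complex"
  have comp: "comp \<gamma> \<in> components S" "path_image \<gamma> \<subseteq> comp \<gamma>" if "\<gamma> \<in> G" for \<gamma>
  proof -
    have *: "path_image \<gamma> \<subseteq> S" "pathstart \<gamma> \<in> path_image \<gamma>" "connected (path_image \<gamma>)"
      using G[OF that] K by (auto simp: connected_path_image valid_path_imp_path)
    then show "comp \<gamma> \<in> components S"
      by (auto simp: comp_def components_def)
    show "path_image \<gamma> \<subseteq> comp \<gamma>"
      unfolding comp_def by (rule connected_component_maximal) (use * in auto)
  qed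
  have eq: "{\<gamma>\<in>G. comp \<gamma> = C} = {\<gamma>\<in>G. path_image \<gamma> \<subseteq> C}" if C: "C \<in> components S" for C
  proof -
    have "comp \<gamma> = C" if "\<gamma> \<in> G" "path_image \<gamma> \<subseteq> C" for \<gamma>
    proof -
      have "pathstart \<gamma> \<in> C \<inter> comp \<gamma>"
        using comp[OF that(1)] that(2) by auto
      then show ?thesis
        using components_nonoverlap[OF comp(1)[OF that(1)] C] by blast
    qed
    moreover have "path_image \<gamma> \<subseteq> C" if "\<gamma> \<in> G" "comp \<gamma> = C" for \<gamma>
      using comp(2)[OF that(1)] that(2) by simp
    ultimately show ?thesis by blast
  qed
  have group: "(\<Sum>C\<in>comp ` G. \<Sum>\<gamma> | \<gamma> \<in> G \<and> comp \<gamma> = C. h \<gamma>) = sum h G" for h :: "_ \<Rightarrow> complex"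
    by (rule sum.group) (use \<open>finite G\<close> in auto)
  have C: "(\<Sum>\<gamma> | \<gamma> \<in> G \<and> comp \<gamma> = C. contour_integral \<gamma> f) =
      2 * pi * \<i> * (\<Sum>p\<in>pts. (\<Sum>\<gamma> | \<gamma> \<in> G \<and> comp \<gamma> = C. winding_number \<gamma> p) * residue f p)"
    if "C \<in> comp ` G" for C
  proof (rule Residue_theorem_cycle_connected)
    have C: "C \<in> components S" using that comp by auto
    show "open C" "connected C"
      using C S open_components in_components_connected by auto
    show "finite pts" "finite {\<gamma> \<in> G. comp \<gamma> = C}" by fact (simp add: \<open>finite G\<close>)
    show "f holomorphic_on C - pts"
      by (rule holomorphic_on_subset[OF f]) (use C in_components_subset in blast)
    show "valid_path \<gamma> \<and> pathfinish \<gamma> = pathstart \<gamma> \<and> path_image \<gamma> \<subseteq> C - pts"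
      if "\<gamma> \<in> {\<gamma> \<in> G. comp \<gamma> = C}" for \<gamma>
      using that G comp by blast
    show "(\<Sum>\<gamma> | \<gamma> \<in> G \<and> comp \<gamma> = C. winding_number \<gamma> z) = 0" if "z \<notin> C" for z
      unfolding eq[OF C]
      by (rule winding_number_cycle_component[OF S K \<open>finite G\<close> _ 0 C that])
        (use G valid_path_imp_path in blast)+
  qed
  have "(\<Sum>\<gamma>\<in>G. contour_integral \<gamma> f) = (\<Sum>C\<in>comp ` G.
      2 * pi * \<i> * (\<Sum>p\<in>pts. (\<Sum>\<gamma> | \<gamma> \<in> G \<and> comp \<gamma> = C. winding_number \<gamma> p) * residue f p))"
    unfolding group[symmetric] by (rule sum.cong[OF refl C])
  also have "\<dots> = 2 * pi * \<i> * (\<Sum>p\<in>pts. (\<Sum>C\<in>comp ` G. \<Sum>\<gamma> | \<gamma> \<in> G \<and> comp \<gamma> = C. winding_number \<gamma> p) * residue f p)"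
    unfolding sum_distrib_left[symmetric] sum_distrib_right by (subst sum.swap) simp
  finally show ?thesis unfolding group .
qed

section \<open>Residue sums of the kernels\<close>

text \<open>Only the square of Im z enters: the kernel does not distinguish z from its conjugate,
  and no norm survives when z comes from a point of the Euclidean space.\<close>

definition kern :: "nat \<Rightarrow> nat \<Rightarrow> complex \<Rightarrow> complex \<Rightarrow> complex" where
  "kern j m z s = (s - of_real (Re z)) ^ j / ((s - of_real (Re z))\<^sup>2 + of_real ((Im z)\<^sup>2)) ^ m"

text \<open>The sum runs over a set: at real z the two poles coincide and their common residue is
  counted once.\<close>

definition res_sum :: "nat \<Rightarrow> nat \<Rightarrow> (complex \<Rightarrow> complex) \<Rightarrow> complex \<Rightarrow> complex" where
  "res_sum j m F z = (\<Sum>p\<in>{z, cnj z}. residue (\<lambda>s. kern j m z s * F s) p)"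

lemma kern_denominator:
  "(s - of_real (Re z))\<^sup>2 + of_real ((Im z)\<^sup>2) = (s - z) * (s - cnj z)"
  by (simp add: complex_eq_iff power2_eq_square algebra_simps)

lemma kern_cnj [simp]: "kern j m (cnj z) s = kern j m z s"
  by (simp add: kern_def)

lemma res_sum_cnj [simp]: "res_sum j m F (cnj z) = res_sum j m F z"
  by (simp add: res_sum_def insert_commute)

lemma kern_holomorphic: "kern j m z holomorphic_on - {z, cnj z}"
  unfolding kern_def kern_denominator by (intro holomorphic_intros) auto

section \<open>Residue sums on an open set invariant under conjugation\<close>

locale symmetric_domain =
  fixes \<Omega> :: "complex set"
  assumes open_dom: "open \<Omega>" and cnj_dom: "z \<in> \<Omega> \<Longrightarrow> cnj z \<in> \<Omega>"
begin

lemma kern_times_holomorphic: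
  assumes "F holomorphic_on \<Omega>"
  shows "(\<lambda>s. kern j m z s * F s) holomorphic_on \<Omega> - {z, cnj z}"
  by (intro holomorphic_intros holomorphic_on_subset[OF kern_holomorphic]
      holomorphic_on_subset[OF assms]) auto

text \<open>The identity holds only off the poles, and additivity of residues needs a punctured
  neighbourhood on which the functions are holomorphic. Both are obtained around one pole by
  deleting the other one from the domain.\<close>

lemma residue_sum_combination:
  assumes "g1 holomorphic_on \<Omega> - {z, cnj z}" "g2 holomorphic_on \<Omega> - {z, cnj z}" and z: "z \<in> \<Omega>"
    and eq: "\<And>s. s \<in> \<Omega> - {z, cnj z} \<Longrightarrow> g s = g1 s + c * g2 s"
  shows "(\<Sum>p\<in>{z, cnj z}. residue g p) =
    (\<Sum>p\<in>{z, cnj z}. residue g1 p) + c * (\<Sum>p\<in>{z, cnj z}. residue g2 p)"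
proof -
  have "residue g p = residue g1 p + c * residue g2 p" if p: "p \<in> {z, cnj z}" for p
  proof -
    define T where "T = \<Omega> - ({z, cnj z} - {p})"
    have T: "open T" "p \<in> T" "T - {p} = \<Omega> - {z, cnj z}"
      using open_dom p z cnj_dom by (auto simp: T_def open_Diff finite_imp_closed)
    have "eventually (\<lambda>s. s \<in> T - {p}) (at p)"
      using eventually_at_in_open[OF T(1,2)] by simp
    then have "eventually (\<lambda>s. g s = g1 s + c * g2 s) (at p)"
      by eventually_elim (use eq T(3) in blast)
    then have "residue g p = residue (\<lambda>s. g1 s + c * g2 s) p"
      by (rule residue_cong) simp
    also have "\<dots> = residue g1 p + residue (\<lambda>s. c * g2 s) p"
      by (rule residue_add[OF T(1,2)]; unfold T(3); intro holomorphic_intros assms)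
    also have "residue (\<lambda>s. c * g2 s) p = c * residue g2 p"
      by (rule residue_lmul[OF T(1,2)]) (unfold T(3), fact)
    finally show ?thesis .
  qed
  then show ?thesis
    by (simp add: sum.distrib sum_distrib_left)
qed

text \<open>Substitute s = w + Re z with w = s - Re z.\<close>

lemma res_sum_shift:
  assumes F: "F holomorphic_on \<Omega>" and z: "z \<in> \<Omega>"
  shows "res_sum j m (\<lambda>s. s * F s) z = res_sum (Suc j) m F z + of_real (Re z) * res_sum j m F z"
  unfolding res_sum_def
  by (rule residue_sum_combination[OF kern_times_holomorphic[OF F] kern_times_holomorphic[OF F] z])
    (simp add: kern_def divide_inverse algebra_simps)

text \<open>With w = s - Re z and q = w^2 + (Im z)^2, expand the factor q in q^{-m} = q
  q^{-(m+1)}.\<close>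

lemma res_sum_denominator:
  assumes F: "F holomorphic_on \<Omega>" and z: "z \<in> \<Omega>"
  shows "res_sum j m F z = res_sum (Suc (Suc j)) (Suc m) F z + of_real ((Im z)\<^sup>2) * res_sum j (Suc m) F z"
  unfolding res_sum_def
proof (rule residue_sum_combination[OF kern_times_holomorphic[OF F] kern_times_holomorphic[OF F] z])
  fix s assume "s \<in> \<Omega> - {z, cnj z}"
  then have "(s - of_real (Re z))\<^sup>2 + of_real ((Im z)\<^sup>2) \<noteq> 0"
    by (simp only: kern_denominator) auto
  then show "kern j m z s * F s = kern (Suc (Suc j)) (Suc m) z s * F s +
      of_real ((Im z)\<^sup>2) * (kern j (Suc m) z s * F s)"
    unfolding kern_def by (simp add: divide_simps) (simp add: algebra_simps power2_eq_square)
qed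

lemma cycle_integral_res_sum:
  assumes F: "F holomorphic_on \<Omega>" and K: "compact K" "K \<subseteq> \<Omega>" and "finite G"
    and G: "\<And>\<gamma>. \<gamma> \<in> G \<Longrightarrow> valid_path \<gamma> \<and> pathfinish \<gamma> = pathstart \<gamma> \<and> path_image \<gamma> \<subseteq> K - {z, cnj z}"
    and 0: "\<And>w. w \<notin> K \<Longrightarrow> (\<Sum>\<gamma>\<in>G. winding_number \<gamma> w) = 0"
    and 1: "\<And>p. p \<in> {z, cnj z} \<Longrightarrow> (\<Sum>\<gamma>\<in>G. winding_number \<gamma> p) = 1"
  shows "(\<Sum>\<gamma>\<in>G. contour_integral \<gamma> (\<lambda>s. kern j m z s * F s)) = 2 * pi * \<i> * res_sum j m F z"
  using Residue_theorem_cycle[OF open_dom K \<open>finite G\<close> _ kern_times_holomorphic[OF F] G 0, of j m]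
  by (simp add: 1 res_sum_def)

text \<open>The circles depend on z0 only, so near z0 all dependence of the residue sum on z sits in
  the integrand. This is what permits differentiation under the integral sign.\<close>

lemma local_circles:
  assumes z0: "z0 \<in> \<Omega>"
  obtains r where "r > 0" "cball z0 r \<subseteq> \<Omega>" "cball (cnj z0) r \<subseteq> \<Omega>"
    "\<And>c z s. c \<in> {z0, cnj z0} \<Longrightarrow> z \<in> ball z0 r \<Longrightarrow> s \<in> sphere c r \<Longrightarrow> s \<noteq> z \<and> s \<noteq> cnj z"
    "\<And>F j m z. F holomorphic_on \<Omega> \<Longrightarrow> z \<in> ball z0 r \<Longrightarrow>
       2 * pi * \<i> * res_sum j m F z =
       (\<Sum>c\<in>{z0, cnj z0}. contour_integral (circlepath c r) (\<lambda>s. kern j m z s * F s))"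
proof -
  obtain r0 where r0: "r0 > 0" "cball z0 r0 \<subseteq> \<Omega>"
    using open_dom z0 open_contains_cball by blast
  \<comment> \<open>For nonreal z0 the centres are 2|Im z0|, hence at least 4r, apart, so the closed
    discs are disjoint; for real z0 there is a single disc.\<close>
  define r where "r = (if Im z0 = 0 then r0 else min r0 (\<bar>Im z0\<bar> / 2))"
  have r: "r > 0" "r \<le> r0" using r0 by (auto simp: r_def)
  have r_im: "2 * r \<le> \<bar>Im z0\<bar>" if "Im z0 \<noteq> 0" using that by (auto simp: r_def)
  have dc: "dist (cnj a) (cnj b) = dist a b" for a b
    by (metis complex_cnj_diff complex_mod_cnj dist_norm)
  have cb: "cball z0 r \<subseteq> \<Omega>" using r0 r by auto
  have cb': "cball (cnj z0) r \<subseteq> \<Omega>"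
  proof
    fix z assume "z \<in> cball (cnj z0) r"
    then have "cnj z \<in> cball z0 r" using dc[of "cnj z0" z] by simp
    then show "z \<in> \<Omega>" using cb cnj_dom by fastforce
  qed
  have sep: "dist z0 (cnj z0) \<ge> 2 * (2 * r)" if "Im z0 \<noteq> 0"
  proof -
    have "dist z0 (cnj z0) \<ge> \<bar>Im (z0 - cnj z0)\<bar>"
      by (metis abs_Im_le_cmod dist_norm)
    then show ?thesis using r_im[OF that] by simp
  qed
  have avoid: "s \<noteq> z \<and> s \<noteq> cnj z"
    if "c \<in> {z0, cnj z0}" "z \<in> ball z0 r" "s \<in> sphere c r" for c z s
  proof (cases "Im z0 = 0")
    case True
    then have "cnj z0 = z0" by (simp add: complex_eq_iff)
    then show ?thesis using that dc[of z0 z] by auto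
  next
    case False
    have "dist (cnj z0) (cnj z) < r" using that dc[of z0 z] by simp
    moreover have "dist z0 z < r" using that by simp
    moreover have "dist c s = r" using that by simp
    moreover have "dist (cnj z0) z = dist z0 (cnj z)" using dc[of z0 "cnj z"] by simp
    ultimately show ?thesis
      using sep[OF False] that(1) r(1) dist_triangle2[of z0 "cnj z0" s] dist_triangle2[of z0 "cnj z0" z]
        dist_triangle2[of z0 "cnj z0" "cnj z"] by (elim insertE emptyE; intro conjI notI; simp; linarith)
  qed
  have int: "2 * pi * \<i> * res_sum j m F z =
       (\<Sum>c\<in>{z0, cnj z0}. contour_integral (circlepath c r) (\<lambda>s. kern j m z s * F s))"
    if F: "F holomorphic_on \<Omega>" and z: "z \<in> ball z0 r" for F j m z
  proof -
    \<comment> \<open>For real z0 the two circles are one element and count once, just like the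
      residues.\<close>
    define G where "G = (\<lambda>c. circlepath c r) ` {z0, cnj z0}"
    have inj: "inj_on (\<lambda>c. circlepath c r) {z0, cnj z0}"
      by (rule inj_onI) (metis add_right_cancel pathstart_circlepath)
    have sumG: "(\<Sum>\<gamma>\<in>G. h \<gamma>) = (\<Sum>c\<in>{z0, cnj z0}. h (circlepath c r))" for h :: "_ \<Rightarrow> complex"
      unfolding G_def sum.reindex[OF inj] o_def ..
    have in1: "winding_number (circlepath c r) p = 1" if "p \<in> ball c r" for c p
      using that by (intro winding_number_circlepath) (simp add: dist_norm norm_minus_commute)
    have out0: "winding_number (circlepath c r) p = 0" if "p \<notin> cball c r" for c p
      by (rule winding_number_zero_outside[of _ "cball c r"]) (use that r in auto)
    \<comment> \<open>For nonreal z0 each of the two poles lies in exactly one of the discs and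
      outside the other closed disc.\<close>
    have w1: "(\<Sum>\<gamma>\<in>G. winding_number \<gamma> p) = 1" if p: "p \<in> {z, cnj z}" for p
    proof (cases "Im z0 = 0")
      case True
      then have eq: "cnj z0 = z0" by (simp add: complex_eq_iff)
      have "p \<in> ball z0 r" using z p dc[of z0 z] eq by auto
      then show ?thesis unfolding sumG using in1 eq by simp
    next
      case False
      have ne: "z0 \<noteq> cnj z0" using False by (auto simp: complex_eq_iff)
      have zz: "dist z0 z < r" "dist (cnj z0) (cnj z) < r" using z dc[of z0 z] by auto
      have "p \<in> ball z0 r \<and> p \<notin> cball (cnj z0) r \<or> p \<in> ball (cnj z0) r \<and> p \<notin> cball z0 r"
        using p zz sep[OF False] r(1) dist_triangle2[of z0 "cnj z0" p] by (auto simp: dist_commute)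
      then show ?thesis unfolding sumG using in1 out0 ne by auto
    qed
    have "(\<Sum>\<gamma>\<in>G. contour_integral \<gamma> (\<lambda>s. kern j m z s * F s)) = 2 * pi * \<i> * res_sum j m F z"
    proof (rule cycle_integral_res_sum[OF F])
      show "compact (cball z0 r \<union> cball (cnj z0) r)" "finite G" by (auto simp: G_def)
      show "cball z0 r \<union> cball (cnj z0) r \<subseteq> \<Omega>" using cb cb' by blast
      show "valid_path \<gamma> \<and> pathfinish \<gamma> = pathstart \<gamma> \<and>
          path_image \<gamma> \<subseteq> cball z0 r \<union> cball (cnj z0) r - {z, cnj z}" if \<gamma>: "\<gamma> \<in> G" for \<gamma>
      proof -
        obtain c where c: "c \<in> {z0, cnj z0}" "\<gamma> = circlepath c r" using \<gamma> by (auto simp: G_def)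
        have im: "path_image \<gamma> = sphere c r" using c r by simp
        have "path_image \<gamma> \<subseteq> cball z0 r \<union> cball (cnj z0) r"
          using c(1) unfolding im by auto
        moreover have "z \<notin> path_image \<gamma>" "cnj z \<notin> path_image \<gamma>"
          using avoid[OF c(1) z] unfolding im by blast+
        ultimately show ?thesis unfolding c(2) by (simp only: valid_path_circlepath) auto
      qed
      show "(\<Sum>\<gamma>\<in>G. winding_number \<gamma> w) = 0" if "w \<notin> cball z0 r \<union> cball (cnj z0) r" for w
        unfolding sumG by (intro sum.neutral) (use that out0 in auto)
    qed (rule w1)
    then show ?thesis by (simp add: sumG)
  qed
  show ?thesis by (rule that[OF r(1) cb cb' avoid int]) 
qed

text \<open>Conjugation carries the circle about c to the reversed circle about the conjugate of c
  and, by the symmetry of F, leaves the integrand unchanged. So 2 pi i times the residue sum is the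
  negative of its own conjugate.\<close>

lemma res_sum_real:
  assumes F: "F holomorphic_on \<Omega>" and sym: "\<And>s. s \<in> \<Omega> \<Longrightarrow> F (cnj s) = cnj (F s)" and z: "z \<in> \<Omega>"
  shows "Im (res_sum j m F z) = 0"
proof -
  obtain r where r: "r > 0" "cball z r \<subseteq> \<Omega>" "cball (cnj z) r \<subseteq> \<Omega>"
    "\<And>c w s. c \<in> {z, cnj z} \<Longrightarrow> w \<in> ball z r \<Longrightarrow> s \<in> sphere c r \<Longrightarrow> s \<noteq> w \<and> s \<noteq> cnj w"
    and circles: "\<And>F j m w. F holomorphic_on \<Omega> \<Longrightarrow> w \<in> ball z r \<Longrightarrow>
       2 * pi * \<i> * res_sum j m F w =
       (\<Sum>c\<in>{z, cnj z}. contour_integral (circlepath c r) (\<lambda>s. kern j m w s * F s))"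
    by (rule local_circles[OF z]) (rule that; assumption)
  have int: "2 * pi * \<i> * res_sum j m F z =
       (\<Sum>c\<in>{z, cnj z}. contour_integral (circlepath c r) (\<lambda>s. kern j m z s * F s))"
    by (rule circles[OF F]) (use r in simp)
  define g where "g = (\<lambda>s. kern j m z s * F s)"
  have kc: "cnj (kern j m z (cnj s)) = kern j m z s" for s
    by (simp add: kern_def)
  have c: "cnj (contour_integral (circlepath c r) g) = - contour_integral (circlepath (cnj c) r) g"
    if c: "c \<in> {z, cnj z}" for c
  proof -
    have "contour_integral (circlepath c r) g = contour_integral (circlepath c r) (cnj \<circ> g \<circ> cnj)"
    proof (rule contour_integral_eq)
      fix s assume "s \<in> path_image (circlepath c r)"
      then have "s \<in> cball c r" using r(1) by simp
      then have "s \<in> \<Omega>" using r(2,3) c by auto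
      then have "cnj s \<in> \<Omega>" "F s = cnj (F (cnj s))" using cnj_dom sym by auto
      then show "g s = (cnj \<circ> g \<circ> cnj) s" by (simp add: g_def kc)
    qed
    also have "cnj \<dots> = contour_integral (cnj \<circ> circlepath c r) g"
      by (subst contour_integral_cnj) simp_all
    also have "cnj \<circ> circlepath c r = reversepath (circlepath (cnj c) r)"
      by (rule ext) (simp add: circlepath reversepath_def exp_cnj exp_diff exp_minus right_diff_distrib field_simps)
    also have "contour_integral \<dots> g = - contour_integral (circlepath (cnj c) r) g"
      by (rule contour_integral_reversepath) simp
    finally show ?thesis .
  qed
  have "cnj (2 * pi * \<i> * res_sum j m F z) = - (2 * pi * \<i> * res_sum j m F z)"
  proof -
    have "cnj (\<Sum>c\<in>{z, cnj z}. contour_integral (circlepath c r) g) =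
        - (\<Sum>c\<in>{z, cnj z}. contour_integral (circlepath (cnj c) r) g)"
      unfolding cnj_sum sum_negf[symmetric] by (rule sum.cong[OF refl c])
    also have "(\<Sum>c\<in>{z, cnj z}. contour_integral (circlepath (cnj c) r) g) =
        (\<Sum>c\<in>{z, cnj z}. contour_integral (circlepath c r) g)"
      by (rule sum.reindex_bij_witness[of _ cnj cnj]) auto
    finally show ?thesis unfolding int g_def[symmetric] .
  qed
  then show ?thesis
    by (simp add: complex_eq_iff)
qed

text \<open>At a nonreal pole p the factor w/(s - cnj p) takes the value 1/2; at a real point w/q is
  just 1/w. For symmetric F the result is the real part of F, the source of \<alpha>.\<close>

lemma res_sum_1_1:
  assumes F: "F holomorphic_on \<Omega>" and z: "z \<in> \<Omega>"
  shows "res_sum 1 1 F z = (F z + F (cnj z)) / 2"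
proof (cases "Im z = 0")
  case True
  then have eq: "cnj z = z" "of_real (Re z) = z" by (auto simp: complex_eq_iff)
  have "residue (\<lambda>s. kern 1 1 z s * F s) z = residue (\<lambda>s. F s / (s - z)) z"
    by (rule residue_cong) (auto simp: kern_def eq True power2_eq_square eventually_at_filter)
  also have "\<dots> = F z" by (rule residue_simple[OF open_dom z F])
  finally show ?thesis by (simp add: res_sum_def eq)
next
  case False
  have "residue (\<lambda>s. kern 1 1 z s * F s) p = F p / 2" if p: "p \<in> {z, cnj z}" for p
  proof -
    have p\<Omega>: "p \<in> \<Omega>" "Im p \<noteq> 0" using p z cnj_dom[OF z] False by auto
    define g where "g = (\<lambda>s. (s - of_real (Re z)) * F s / (s - cnj p))"
    have pp: "(s - z) * (s - cnj z) = (s - p) * (s - cnj p)" for s using p by auto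
    have "residue (\<lambda>s. kern 1 1 z s * F s) p = residue (\<lambda>s. g s / (s - p)) p"
      by (simp only: kern_def g_def kern_denominator pp power_one_right power_0)
        (simp add: divide_inverse mult_ac)
    also have "\<dots> = g p"
    proof (rule residue_simple)
      show "open (\<Omega> - {cnj p})" using open_dom by (simp add: open_Diff)
      show "p \<in> \<Omega> - {cnj p}" using p\<Omega> by (simp add: complex_eq_iff)
      show "g holomorphic_on \<Omega> - {cnj p}"
        unfolding g_def by (intro holomorphic_intros holomorphic_on_subset[OF F]) auto
    qed
    also have "\<dots> = F p / 2"
    proof -
      have "p - cnj p = 2 * (p - of_real (Re z))" "p - of_real (Re z) \<noteq> 0"
        using p False by (auto simp: complex_eq_iff)
      then have "g p = (p - of_real (Re z)) * F p / (2 * (p - of_real (Re z)))"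
        unfolding g_def by simp
      moreover have "a * b / (2 * a) = b / 2" if "a \<noteq> 0" for a b :: complex
        using that by simp
      ultimately show ?thesis
        by (simp only: \<open>p - of_real (Re z) \<noteq> 0\<close> not_False_eq_True)
    qed
    finally show ?thesis .
  qed
  then have "res_sum 1 1 F z = (\<Sum>p\<in>{z, cnj z}. F p / 2)"
    unfolding res_sum_def by (rule sum.cong[OF refl])
  moreover have "z \<noteq> cnj z" using False by (auto simp: complex_eq_iff)
  ultimately show ?thesis by (simp add: add_divide_distrib)
qed

text \<open>Off the real axis both poles are simple. For symmetric F the value is Im (F z) / Im z,
  the source of \<beta> divided by the norm of the vector part.\<close>

lemma res_sum_0_1:
  assumes F: "F holomorphic_on \<Omega>" and z: "z \<in> \<Omega>" and "Im z \<noteq> 0"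
  shows "res_sum 0 1 F z = (F z - F (cnj z)) / (2 * \<i> * Im z)"
proof -
  have "residue (\<lambda>s. kern 0 1 z s * F s) p = F p / (p - cnj p)" if p: "p \<in> {z, cnj z}" for p
  proof -
    have p\<Omega>: "p \<in> \<Omega>" "Im p \<noteq> 0" using p z cnj_dom[OF z] assms(3) by auto
    define g where "g = (\<lambda>s. F s / (s - cnj p))"
    have pp: "(s - z) * (s - cnj z) = (s - p) * (s - cnj p)" for s using p by auto
    have "residue (\<lambda>s. kern 0 1 z s * F s) p = residue (\<lambda>s. g s / (s - p)) p"
      by (simp only: kern_def g_def kern_denominator pp power_one_right power_0)
        (simp add: divide_inverse mult_ac)
    also have "\<dots> = g p"
    proof (rule residue_simple)
      show "open (\<Omega> - {cnj p})" using open_dom by (simp add: open_Diff)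
      show "p \<in> \<Omega> - {cnj p}" using p\<Omega> by (simp add: complex_eq_iff)
      show "g holomorphic_on \<Omega> - {cnj p}"
        unfolding g_def by (intro holomorphic_intros holomorphic_on_subset[OF F]) auto
    qed
    finally show ?thesis by (simp add: g_def)
  qed
  then have "res_sum 0 1 F z = (\<Sum>p\<in>{z, cnj z}. F p / (p - cnj p))"
    unfolding res_sum_def by (rule sum.cong[OF refl])
  moreover have "z \<noteq> cnj z" using assms by (auto simp: complex_eq_iff)
  moreover have "z - cnj z = 2 * \<i> * Im z" "cnj z - z = - (2 * \<i> * Im z)"
    by (auto simp: complex_eq_iff)
  ultimately show ?thesis by (simp add: diff_divide_distrib)
qed

end

section \<open>Differentiation of residue sums\<close>

definition half_plane_point :: "real \<times> 'v::real_normed_vector \<Rightarrow> complex" where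
  "half_plane_point x = Complex (fst x) (norm (snd x))"

lemma continuous_half_plane_point [continuous_intros]:
  "continuous_on S half_plane_point"
  unfolding half_plane_point_def complex_eq by (intro continuous_intros)

text \<open>The squared norm becomes an inner product, so along a line the denominator is polynomial
  in the parameter even where the vector part vanishes.\<close>

lemma kern_half_plane_point:
  fixes x :: "real \<times> 'v::real_inner"
  shows "kern j m (half_plane_point x) s =
    (s - of_real (fst x)) ^ j / ((s - of_real (fst x))\<^sup>2 + of_real (snd x \<bullet> snd x)) ^ m"
  by (simp add: kern_def half_plane_point_def power2_norm_eq_inner flip: of_real_power)

text \<open>Along a line w is affine and q quadratic. The factor w^j contributes the term with -j;
  q^{-m} contributes 2m w from the real direction and the inner product from the vector directions.
  For j = 0 the truncated \<open>j - 1\<close> carries coefficient 0. The derivative is given at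
  every t, as the Leibniz rule requires.\<close>

lemma kern_directional_derivative:
  fixes x b :: "real \<times> 'v::real_inner" and t :: real
  defines "y \<equiv> x + t *\<^sub>R b"
  assumes s: "s \<noteq> half_plane_point y" "s \<noteq> cnj (half_plane_point y)"
  shows "((\<lambda>t. kern j m (half_plane_point (x + t *\<^sub>R b)) s) has_vector_derivative
    of_real (fst b) * (2 * of_nat m * kern (Suc j) (Suc m) (half_plane_point y) s -
      of_nat j * kern (j - 1) m (half_plane_point y) s) -
    of_real (2 * real m * (snd y \<bullet> snd b)) * kern j (Suc m) (half_plane_point y) s) (at t within U)"
proof -
  \<comment> \<open>\<open>W\<close>, \<open>P\<close> and \<open>Q\<close> take a complex parameter
    so that the rules for complex derivatives apply; the restriction to real t comes at the
    end.\<close>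
  define W where "W \<tau> = s - of_real (fst x) - \<tau> * of_real (fst b)" for \<tau> :: complex
  define P where "P \<tau> = of_real (snd x \<bullet> snd x) + 2 * \<tau> * of_real (snd x \<bullet> snd b) +
    \<tau>\<^sup>2 * of_real (snd b \<bullet> snd b)" for \<tau> :: complex
  define Q where "Q \<tau> = (W \<tau>)\<^sup>2 + P \<tau>" for \<tau>
  have W: "s - of_real (fst (x + t *\<^sub>R b)) = W (of_real t)" for t
    by (simp add: W_def)
  have P: "of_real (snd (x + t *\<^sub>R b) \<bullet> snd (x + t *\<^sub>R b)) = P (of_real t)" for t
    by (simp add: P_def inner_commute power2_eq_square algebra_simps)
  have k: "kern j m (half_plane_point (x + t *\<^sub>R b)) s = W (of_real t) ^ j / Q (of_real t) ^ m" for j m t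
    by (simp only: kern_half_plane_point W P Q_def)
  have "(s - of_real (Re (half_plane_point y)))\<^sup>2 + of_real ((Im (half_plane_point y))\<^sup>2) \<noteq> 0"
    unfolding kern_denominator using s by simp
  then have Q0: "Q (of_real t) \<noteq> 0"
    unfolding Q_def W[symmetric] P[symmetric] y_def[symmetric]
    by (simp add: half_plane_point_def power2_norm_eq_inner flip: of_real_power)
  have dW: "(W has_field_derivative - of_real (fst b)) (at \<tau>)" for \<tau>
    unfolding W_def by (auto intro!: derivative_eq_intros)
  have dP: "(P has_field_derivative (2 * of_real (snd x \<bullet> snd b) + 2 * \<tau> * of_real (snd b \<bullet> snd b))) (at \<tau>)" for \<tau>
    unfolding P_def by (auto intro!: derivative_eq_intros)
  have P': "2 * of_real (snd x \<bullet> snd b) + 2 * of_real t * of_real (snd b \<bullet> snd b) =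
      (of_real (2 * (snd y \<bullet> snd b)) :: complex)"
    by (simp add: y_def algebra_simps)
  have dQ: "(Q has_field_derivative (of_real (2 * (snd y \<bullet> snd b)) - 2 * of_real (fst b) * W (of_real t))) (at (of_real t))"
    unfolding Q_def P'[symmetric] by (rule derivative_eq_intros dW dP refl | simp)+
  have dWj: "((\<lambda>\<tau>. W \<tau> ^ j) has_field_derivative - (of_nat j * of_real (fst b) * W (of_real t) ^ (j - 1))) (at (of_real t))"
    by (rule derivative_eq_intros dW refl | simp)+
  have dQm: "((\<lambda>\<tau>. inverse (Q \<tau> ^ m)) has_field_derivative
      - (of_nat m * (of_real (2 * (snd y \<bullet> snd b)) - 2 * of_real (fst b) * W (of_real t)) / Q (of_real t) ^ Suc m)) (at (of_real t))"
  proof (cases m)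
    case (Suc i)
    show ?thesis
      by (rule derivative_eq_intros dQ refl | simp add: Q0)+ (simp add: Suc Q0 field_simps)
  qed simp
  have "((\<lambda>\<tau>. W \<tau> ^ j * inverse (Q \<tau> ^ m)) has_field_derivative
    of_real (fst b) * (2 * of_nat m * (W (of_real t) ^ Suc j / Q (of_real t) ^ Suc m) -
      of_nat j * (W (of_real t) ^ (j - 1) / Q (of_real t) ^ m)) -
    of_real (2 * real m * (snd y \<bullet> snd b)) * (W (of_real t) ^ j / Q (of_real t) ^ Suc m)) (at (of_real t))"
    by (rule DERIV_cong[OF DERIV_mult[OF dWj dQm]]) (use Q0 in \<open>simp add: field_simps\<close>)
  from has_vector_derivative_real_field[OF this] show ?thesis
    unfolding k y_def by (simp add: divide_inverse)
qed

section \<open>Differentiation under the integral sign\<close>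

context symmetric_domain
begin

text \<open>The curves \<open>g c\<close> and the weights \<open>h c\<close> are the same for all j,
  m and all nearby y. Continuity and differentiability in y therefore reduce to those of
  \<open>kern\<close>, which stays away from its poles.\<close>

lemma local_integral_representation:
  fixes x0 :: "real \<times> 'v::euclidean_space"
  assumes F: "F holomorphic_on \<Omega>" and x0: "half_plane_point x0 \<in> \<Omega>"
  obtains N and A :: "complex set" and g h where "open N" "x0 \<in> N" "finite A"
    "\<And>c. c \<in> A \<Longrightarrow> continuous_on {0..1} (g c)" "\<And>c. c \<in> A \<Longrightarrow> continuous_on {0..1} (h c)"
    "\<And>c \<tau> y. c \<in> A \<Longrightarrow> \<tau> \<in> {0..1} \<Longrightarrow> y \<in> N \<Longrightarrow>
       g c \<tau> \<noteq> half_plane_point y \<and> g c \<tau> \<noteq> cnj (half_plane_point y)"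
    "\<And>j m y. y \<in> N \<Longrightarrow> res_sum j m F (half_plane_point y) =
       (\<Sum>c\<in>A. integral (cbox 0 (1::real)) (\<lambda>\<tau>. kern j m (half_plane_point y) (g c \<tau>) * h c \<tau>))"
proof -
  define z0 where "z0 = half_plane_point x0"
  obtain r where r: "r > 0" "cball z0 r \<subseteq> \<Omega>" "cball (cnj z0) r \<subseteq> \<Omega>"
    and avoid: "\<And>c z s. c \<in> {z0, cnj z0} \<Longrightarrow> z \<in> ball z0 r \<Longrightarrow> s \<in> sphere c r \<Longrightarrow> s \<noteq> z \<and> s \<noteq> cnj z"
    and circles: "\<And>F j m z. F holomorphic_on \<Omega> \<Longrightarrow> z \<in> ball z0 r \<Longrightarrow>
       2 * pi * \<i> * res_sum j m F z =
       (\<Sum>c\<in>{z0, cnj z0}. contour_integral (circlepath c r) (\<lambda>s. kern j m z s * F s))"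
    by (rule local_circles[OF x0, folded z0_def]) (rule that; assumption)
  define N where "N = (half_plane_point -` ball z0 r :: (real \<times> 'v) set)"
  \<comment> \<open>F times the velocity of the circle without its factor 2 pi i, which cancels
    against the one in the residue theorem.\<close>
  define h where "h c \<tau> = F (circlepath c r \<tau>) * (r * exp (2 * of_real pi * \<i> * \<tau>))" for c and \<tau> :: real
  have onsphere: "circlepath c r \<tau> \<in> sphere c r" if "\<tau> \<in> {0..1}" for c \<tau>
  proof -
    have "path_image (circlepath c r) = sphere c r" using r(1) by simp
    then show ?thesis using that unfolding path_image_def by blast
  qed
  have g: "continuous_on {0..1} (circlepath c r)" for c
    using valid_path_imp_path[OF valid_path_circlepath[of c r]] by (simp add: path_def)
  have inside: "circlepath c r ` {0..1} \<subseteq> \<Omega>" if "c \<in> {z0, cnj z0}" for c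
  proof -
    have "circlepath c r ` {0..1} \<subseteq> cball c r"
      using onsphere sphere_cball by blast
    then show ?thesis using that r(2,3) by auto
  qed
  show ?thesis
  proof (rule that[of N "{z0, cnj z0}" "\<lambda>c. circlepath c r" h])
    show "open N" unfolding N_def
      by (intro open_vimage open_ball continuous_half_plane_point)
    show "x0 \<in> N" using r(1) by (simp add: N_def z0_def)
    show "continuous_on {0..1} (circlepath c r)" for c by (rule g)
    show "continuous_on {0..1} (h c)" if "c \<in> {z0, cnj z0}" for c
      unfolding h_def
      by (intro continuous_intros g
          continuous_on_compose2[OF holomorphic_on_imp_continuous_on[OF F] g inside[OF that]])
    show "circlepath c r \<tau> \<noteq> half_plane_point y \<and> circlepath c r \<tau> \<noteq> cnj (half_plane_point y)"
      if "c \<in> {z0, cnj z0}" "\<tau> \<in> {0..1}" "y \<in> N" for c \<tau> y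
      by (rule avoid[OF that(1) _ onsphere[OF that(2)]]) (use that(3) in \<open>simp add: N_def\<close>)
    show "res_sum j m F (half_plane_point y) = (\<Sum>c\<in>{z0, cnj z0}. integral (cbox 0 (1::real))
        (\<lambda>\<tau>. kern j m (half_plane_point y) (circlepath c r \<tau>) * h c \<tau>))" if "y \<in> N" for j m y
    proof -
      have "half_plane_point y \<in> ball z0 r" using that by (simp add: N_def)
      note * = circles[OF F this, of j m]
      have "contour_integral (circlepath c r) (\<lambda>s. kern j m (half_plane_point y) s * F s) =
          (2 * pi * \<i>) * integral (cbox 0 (1::real))
            (\<lambda>\<tau>. kern j m (half_plane_point y) (circlepath c r \<tau>) * h c \<tau>)" for c
        unfolding contour_integral_integral vector_derivative_circlepath h_def
        by (subst integral_mult_right[symmetric]) (simp add: mult_ac)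
      then have "(2 * pi * \<i>) * res_sum j m F (half_plane_point y) =
        (2 * pi * \<i>) * (\<Sum>c\<in>{z0, cnj z0}. integral (cbox 0 (1::real))
          (\<lambda>\<tau>. kern j m (half_plane_point y) (circlepath c r \<tau>) * h c \<tau>))"
        unfolding sum_distrib_left using * by simp
      then show ?thesis by simp
    qed
  qed simp
qed

lemma kern_integrand_continuous:
  fixes N :: "(real \<times> 'v::euclidean_space) set"
  assumes "continuous_on {0..1} g" "continuous_on {0..1} h"
    and avoid: "\<And>\<tau> y. \<tau> \<in> {0..1} \<Longrightarrow> y \<in> N \<Longrightarrow>
       g \<tau> \<noteq> half_plane_point y \<and> g \<tau> \<noteq> cnj (half_plane_point y)"
  shows "continuous_on (N \<times> cbox 0 (1::real)) (\<lambda>(y, \<tau>). kern j m (half_plane_point y) (g \<tau>) * h \<tau>)"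
proof -
  have gh: "continuous_on (N \<times> cbox 0 1) (\<lambda>p. g (snd p))" "continuous_on (N \<times> cbox 0 1) (\<lambda>p. h (snd p))"
    by (rule continuous_on_compose2[of "{0..1}"]; auto intro!: continuous_intros assms)+
  have "(g (snd p) - of_real (fst (fst p)))\<^sup>2 + of_real (snd (fst p) \<bullet> snd (fst p)) \<noteq> 0"
    if p: "p \<in> N \<times> cbox 0 1" for p
  proof -
    have "(g (snd p) - of_real (Re (half_plane_point (fst p))))\<^sup>2 +
        of_real ((Im (half_plane_point (fst p)))\<^sup>2) \<noteq> 0"
      unfolding kern_denominator using avoid[of "snd p" "fst p"] p by auto
    then show ?thesis
      by (simp add: half_plane_point_def power2_norm_eq_inner flip: of_real_power)
  qed
  then show ?thesis
    unfolding case_prod_unfold kern_half_plane_point by (intro continuous_intros gh) auto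
qed

lemma res_sum_continuous:
  assumes F: "F holomorphic_on \<Omega>"
  shows "continuous_on {x :: real \<times> 'v::euclidean_space. half_plane_point x \<in> \<Omega>}
    (\<lambda>x. res_sum j m F (half_plane_point x))"
proof (rule continuous_at_imp_continuous_on, rule ballI)
  fix x0 :: "real \<times> 'v" assume "x0 \<in> {x. half_plane_point x \<in> \<Omega>}"
  then have "half_plane_point x0 \<in> \<Omega>" by simp
  then obtain N and A :: "complex set" and g h where N: "open N" "x0 \<in> N" and "finite A"
    and gh: "\<And>c. c \<in> A \<Longrightarrow> continuous_on {0..1} (g c)" "\<And>c. c \<in> A \<Longrightarrow> continuous_on {0..1} (h c)"
    and avoid: "\<And>c \<tau> y. c \<in> A \<Longrightarrow> \<tau> \<in> {0..1} \<Longrightarrow> y \<in> N \<Longrightarrow>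
       g c \<tau> \<noteq> half_plane_point y \<and> g c \<tau> \<noteq> cnj (half_plane_point y)"
    and rep: "\<And>j m y. y \<in> N \<Longrightarrow> res_sum j m F (half_plane_point y) =
       (\<Sum>c\<in>A. integral (cbox 0 (1::real)) (\<lambda>\<tau>. kern j m (half_plane_point y) (g c \<tau>) * h c \<tau>))"
    by (rule local_integral_representation[OF F]) (rule that; assumption)
  have "continuous_on N (\<lambda>y. \<Sum>c\<in>A. integral (cbox 0 (1::real))
      (\<lambda>\<tau>. kern j m (half_plane_point y) (g c \<tau>) * h c \<tau>))"
    by (intro continuous_on_sum integral_continuous_on_param kern_integrand_continuous gh avoid)
  then have "continuous_on N (\<lambda>x. res_sum j m F (half_plane_point x))"
    by (subst continuous_on_cong[OF refl rep])
  then show "isCont (\<lambda>x. res_sum j m F (half_plane_point x)) x0"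
    using N continuous_on_eq_continuous_at by blast
qed

text \<open>The derivative of the integrand is a combination of integrands of the same kind, so that
  after the Leibniz rule the integrals are residue sums again.\<close>

lemma res_sum_directional_derivative:
  fixes x b :: "real \<times> 'v::euclidean_space"
  assumes F: "F holomorphic_on \<Omega>" and x: "half_plane_point x \<in> \<Omega>"
  shows "((\<lambda>t. res_sum j m F (half_plane_point (x + t *\<^sub>R b))) has_vector_derivative
    of_real (fst b) * (2 * of_nat m * res_sum (Suc j) (Suc m) F (half_plane_point x) -
      of_nat j * res_sum (j - 1) m F (half_plane_point x)) -
    of_real (2 * real m * (snd x \<bullet> snd b)) * res_sum j (Suc m) F (half_plane_point x)) (at 0)"
proof -
  obtain N and A :: "complex set" and g h where N: "open N" "x \<in> N" and "finite A"
    and gh: "\<And>c. c \<in> A \<Longrightarrow> continuous_on {0..1} (g c)" "\<And>c. c \<in> A \<Longrightarrow> continuous_on {0..1} (h c)"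
    and avoid: "\<And>c \<tau> y. c \<in> A \<Longrightarrow> \<tau> \<in> {0..1} \<Longrightarrow> y \<in> N \<Longrightarrow>
       g c \<tau> \<noteq> half_plane_point y \<and> g c \<tau> \<noteq> cnj (half_plane_point y)"
    and rep: "\<And>j m y. y \<in> N \<Longrightarrow> res_sum j m F (half_plane_point y) =
       (\<Sum>c\<in>A. integral (cbox 0 (1::real)) (\<lambda>\<tau>. kern j m (half_plane_point y) (g c \<tau>) * h c \<tau>))"
    by (rule local_integral_representation[OF F x]) (rule that; assumption)
  define l where "l t = x + t *\<^sub>R b" for t :: real
  have l: "continuous_on S l" for S
    unfolding l_def by (intro continuous_intros)
  have "open (l -` N)"
    using open_vimage N(1) l by blast
  moreover have "0 \<in> l -` N" using N(2) by (simp add: l_def)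
  \<comment> \<open>A parameter interval on which the line stays within reach of the fixed
    circles.\<close>
  ultimately obtain e where e: "e > 0" "ball (0::real) e \<subseteq> l -` N"
    using openE by blast
  define I where "I j m c t = integral (cbox 0 (1::real)) (\<lambda>\<tau>. kern j m (half_plane_point (l t)) (g c \<tau>) * h c \<tau>)"
    for j m c t
  define dI where "dI c t \<tau> = of_real (fst b) *
      (2 * of_nat m * (kern (Suc j) (Suc m) (half_plane_point (l t)) (g c \<tau>) * h c \<tau>) -
      of_nat j * (kern (j - 1) m (half_plane_point (l t)) (g c \<tau>) * h c \<tau>)) -
    of_real (2 * real m * (snd (l t) \<bullet> snd b)) * (kern j (Suc m) (half_plane_point (l t)) (g c \<tau>) * h c \<tau>)"
    for c t \<tau>
  have joint: "continuous_on (ball (0::real) e \<times> cbox 0 (1::real))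
      (\<lambda>p. kern j m (half_plane_point (l (fst p))) (g c (snd p)) * h c (snd p))" if "c \<in> A" for c j m
  proof -
    have 1: "continuous_on (N \<times> cbox 0 (1::real))
        (\<lambda>p. kern j m (half_plane_point (fst p)) (g c (snd p)) * h c (snd p))"
      using kern_integrand_continuous[OF gh[OF that] avoid[OF that]] by (simp add: case_prod_unfold)
    have 2: "continuous_on (ball (0::real) e \<times> cbox 0 (1::real)) (\<lambda>p. (l (fst p), snd p))"
      by (intro continuous_intros continuous_on_compose2[OF l[of UNIV]]) auto
    have "(\<lambda>p. (l (fst p), snd p)) ` (ball (0::real) e \<times> cbox 0 (1::real)) \<subseteq> N \<times> cbox 0 1"
    proof (rule image_subsetI)
      fix p assume "p \<in> ball (0::real) e \<times> cbox 0 (1::real)"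
      then have "fst p \<in> ball (0::real) e" "snd p \<in> cbox 0 1" by (simp_all only: mem_Times_iff)
      then show "(l (fst p), snd p) \<in> N \<times> cbox 0 1" using subsetD[OF e(2)] by simp
    qed
    from continuous_on_compose2[OF 1 2 this] show ?thesis by simp
  qed
  have joint1: "(\<lambda>\<tau>. kern j m (half_plane_point (l t)) (g c \<tau>) * h c \<tau>) integrable_on cbox 0 1"
    if "c \<in> A" "t \<in> ball (0::real) e" for c t j m
    by (rule integrable_continuous, rule continuous_on_compose2[OF joint[OF that(1)], of _ "\<lambda>\<tau>. (t, \<tau>)", simplified])
      (use that(2) in \<open>auto intro!: continuous_intros\<close>)
  have "(I j m c has_vector_derivative integral (cbox 0 1) (dI c 0)) (at 0 within ball (0::real) e)" if c: "c \<in> A" for c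
    unfolding I_def
  proof (rule leibniz_rule_vector_derivative)
    show "((\<lambda>t. kern j m (half_plane_point (l t)) (g c \<tau>) * h c \<tau>) has_vector_derivative dI c t \<tau>)
        (at t within ball (0::real) e)" if t: "t \<in> ball (0::real) e" and \<tau>: "\<tau> \<in> cbox 0 1" for t \<tau>
    proof -
      have av: "g c \<tau> \<noteq> half_plane_point (l t)" "g c \<tau> \<noteq> cnj (half_plane_point (l t))"
        using avoid[OF c, of \<tau> "l t"] t \<tau> e(2) by auto
      have eq: "dI c t \<tau> = (of_real (fst b) *
          (2 * of_nat m * kern (Suc j) (Suc m) (half_plane_point (l t)) (g c \<tau>) -
           of_nat j * kern (j - 1) m (half_plane_point (l t)) (g c \<tau>)) -
          of_real (2 * real m * (snd (l t) \<bullet> snd b)) * kern j (Suc m) (half_plane_point (l t)) (g c \<tau>)) * h c \<tau>"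
        unfolding dI_def by (simp add: algebra_simps)
      show ?thesis
        unfolding eq l_def
        by (rule bounded_linear.has_vector_derivative[OF bounded_linear_mult_left
            kern_directional_derivative[OF av[unfolded l_def]]])
    qed
    show "(\<lambda>\<tau>. kern j m (half_plane_point (l t)) (g c \<tau>) * h c \<tau>) integrable_on cbox 0 1"
      if "t \<in> ball (0::real) e" for t
      by (rule joint1[OF c that])
    show "continuous_on (ball (0::real) e \<times> cbox 0 1) (\<lambda>(t, \<tau>). dI c t \<tau>)"
    proof -
      have lc: "continuous_on (ball (0::real) e \<times> cbox 0 (1::real))
          (\<lambda>p. of_real (2 * real m * (snd (l (fst p)) \<bullet> snd b)) :: complex)"
        unfolding l_def by (intro continuous_intros)
      show ?thesis
        unfolding dI_def case_prod_unfold
        by (rule continuous_on_diff[OF continuous_on_mult[OF continuous_on_const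
              continuous_on_diff[OF continuous_on_mult[OF continuous_on_const joint[OF c]]
                continuous_on_mult[OF continuous_on_const joint[OF c]]]]
              continuous_on_mult[OF lc joint[OF c]]])
    qed
  qed (use e in auto)
  then have dIc: "(I j m c has_vector_derivative integral (cbox 0 1) (dI c 0)) (at 0)" if "c \<in> A" for c
    using that at_within_open[of 0 "ball (0::real) e"] e(1) by simp
  have res: "res_sum j m F (half_plane_point (l t)) = (\<Sum>c\<in>A. I j m c t)" if "t \<in> ball (0::real) e" for t j m
    unfolding I_def by (rule rep) (use that e(2) in auto)
  have "((\<lambda>t. \<Sum>c\<in>A. I j m c t) has_vector_derivative (\<Sum>c\<in>A. integral (cbox 0 1) (dI c 0))) (at 0)"
    by (intro has_vector_derivative_sum dIc)
  then have "((\<lambda>t. res_sum j m F (half_plane_point (l t))) has_vector_derivative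
      (\<Sum>c\<in>A. integral (cbox 0 1) (dI c 0))) (at 0)"
    by (rule has_vector_derivative_transform_within_open[of _ _ _ "ball (0::real) e"]) (use e res in auto)
  also have "(\<Sum>c\<in>A. integral (cbox 0 1) (dI c 0)) = (\<Sum>c\<in>A. of_real (fst b) *
      (2 * of_nat m * I (Suc j) (Suc m) c 0 - of_nat j * I (j - 1) m c 0) -
      of_real (2 * real m * (snd (l 0) \<bullet> snd b)) * I j (Suc m) c 0)"
  proof (rule sum.cong[OF refl])
    fix c assume c: "c \<in> A"
    note int = joint1[OF c, of 0]
    show "integral (cbox 0 1) (dI c 0) = of_real (fst b) *
      (2 * of_nat m * I (Suc j) (Suc m) c 0 - of_nat j * I (j - 1) m c 0) -
      of_real (2 * real m * (snd (l 0) \<bullet> snd b)) * I j (Suc m) c 0"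
      unfolding dI_def I_def
      by (subst integral_diff integral_mult_right; (intro integrable_diff integrable_on_mult_right int; simp add: e)?)+ simp
  qed
  also have "\<dots> = of_real (fst b) * (2 * of_nat m * res_sum (Suc j) (Suc m) F (half_plane_point (l 0)) -
      of_nat j * res_sum (j - 1) m F (half_plane_point (l 0))) -
    of_real (2 * real m * (snd (l 0) \<bullet> snd b)) * res_sum j (Suc m) F (half_plane_point (l 0))"
    using e(1) by (simp only: res centre_in_ball sum_subtractf sum_distrib_left right_diff_distrib)
  finally show ?thesis by (simp add: l_def)
qed

end

section \<open>Left and right actions of the Clifford algebra\<close>

lemma inner_blade: "a \<bullet> blade A = coord a A"
  by (simp add: inner_clifford_def coord_blade if_distrib if_distribR cong: if_cong)

lemma bounded_linear_coord: "bounded_linear (\<lambda>a. coord a A)"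
  unfolding inner_blade[symmetric] by (rule bounded_linear_inner_left)

lemma clifford_blade_expansion: "a = (\<Sum>A\<in>UNIV. coord a A *\<^sub>R blade A)"
proof -
  have "coord (\<Sum>A\<in>S. coord a A *\<^sub>R blade A) B = (\<Sum>A\<in>S. coord a A * coord (blade A) B)"
    for S :: "'a set set" and B
    by (induction S rule: infinite_finite_induct) simp_all
  then show ?thesis
    by (simp add: clifford_eq_iff coord_blade if_distrib cong: if_cong)
qed

text \<open>Finite dimension makes the product bounded, although the norm is submultiplicative only
  up to a constant; boundedness is what differentiation and integration use.\<close>

lemma bounded_bilinear_clifford_mult:
  "bounded_bilinear ((*) :: 'n::{finite,linorder} clifford \<Rightarrow> _ \<Rightarrow> _)"
  unfolding bilinear_conv_bounded_bilinear[symmetric] bilinear_def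
  by (auto intro!: linearI simp: algebra_simps)

lemma vec_unit_eq: "vec_unit v = (\<Sum>i\<in>UNIV. vec_nth v i *\<^sub>R gen i)"
  by (simp add: paravec_def)

lemma scaleR_2_cancel: "2 *\<^sub>R a = 2 *\<^sub>R b \<Longrightarrow> a = (b :: 'a::real_vector)"
  by simp

text \<open>\<sigma> = 1 gives the operator D and \<sigma> = -1 its conjugate; \<open>mu\<close>
  decides the side on which the generators act.\<close>

definition field_op :: "('n::{finite,linorder} clifford \<Rightarrow> 'n clifford \<Rightarrow> 'n clifford) \<Rightarrow> real \<Rightarrow>
    'n field_fun \<Rightarrow> 'n field_fun" where
  "field_op mu \<sigma> f x = d_0 f x + \<sigma> *\<^sub>R (\<Sum>i\<in>UNIV. mu (gen i) (d_vec i f x))"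

text \<open>
  \<open>mu\<close> is left multiplication or, with the factors exchanged, right multiplication: the relation
  \<open>mult_gen_gen\<close> holds for both, so that the left and the right theory are treated together.
\<close>

locale clifford_action = mult: bounded_bilinear mu
  for mu :: "'n::{finite,linorder} clifford \<Rightarrow> 'n clifford \<Rightarrow> 'n clifford" +
  assumes mult_gen_gen: "mu (gen i) (mu (gen j) y) + mu (gen j) (mu (gen i) y) =
    (if i = j then - 2 *\<^sub>R y else 0)"
begin

lemma mult_vec: "mu (vec_unit v) y = (\<Sum>i\<in>UNIV. vec_nth v i *\<^sub>R mu (gen i) y)"
  by (simp add: vec_unit_eq mult.sum_left mult.scaleR_left)

lemma mult_gen_square: "mu (gen i) (mu (gen i) y) = - y"
proof -
  have "2 *\<^sub>R mu (gen i) (mu (gen i) y) = 2 *\<^sub>R (- y)"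
    using mult_gen_gen[of i i y] by (simp add: scaleR_2)
  then show ?thesis by (rule scaleR_2_cancel)
qed

text \<open>Doubling the sum pairs (i, j) with (j, i): off the diagonal the pair cancels, on it
  remains -2. It is used both for second derivatives and for the coordinate products in the square
  of a vector.\<close>

lemma sum_gen_gen_symmetric:
  assumes "\<And>i j. H i j = H j i"
  shows "(\<Sum>i\<in>UNIV. \<Sum>j\<in>UNIV. mu (gen i) (mu (gen j) (H i j))) = - (\<Sum>i\<in>UNIV. H i i)"
proof -
  let ?S = "\<Sum>i\<in>UNIV. \<Sum>j\<in>UNIV. mu (gen i) (mu (gen j) (H i j))"
  have "?S + ?S = ?S + (\<Sum>j\<in>UNIV. \<Sum>i\<in>UNIV. mu (gen i) (mu (gen j) (H i j)))"
    by (subst (2) sum.swap) simp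
  also have "\<dots> = (\<Sum>i\<in>UNIV. \<Sum>j\<in>UNIV. mu (gen i) (mu (gen j) (H i j)) + mu (gen j) (mu (gen i) (H i j)))"
    by (simp add: sum.distrib assms)
  also have "\<dots> = (\<Sum>i\<in>UNIV. - 2 *\<^sub>R H i i)"
    unfolding mult_gen_gen by simp
  also have "\<dots> = 2 *\<^sub>R (- (\<Sum>i\<in>UNIV. H i i))"
    by (simp add: scaleR_sum_right sum_negf)
  finally have "2 *\<^sub>R ?S = 2 *\<^sub>R (- (\<Sum>i\<in>UNIV. H i i))"
    by (simp only: scaleR_2)
  then show ?thesis by (rule scaleR_2_cancel)
qed

lemma mult_vec_vec: "mu (vec_unit v) (mu (vec_unit v) y) = - ((v \<bullet> v) *\<^sub>R y)"
proof -
  have "mu (vec_unit v) (mu (vec_unit v) y) =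
      (\<Sum>i\<in>UNIV. \<Sum>j\<in>UNIV. mu (gen i) (mu (gen j) ((vec_nth v i * vec_nth v j) *\<^sub>R y)))"
    by (subst mult_vec) (simp only: mult_vec[of v y] mult.sum_right mult.scaleR_right
        scaleR_sum_right scaleR_scaleR)
  also have "\<dots> = - (\<Sum>i\<in>UNIV. (vec_nth v i * vec_nth v i) *\<^sub>R y)"
    by (rule sum_gen_gen_symmetric) (simp add: mult.commute)
  also have "(\<Sum>i\<in>UNIV. (vec_nth v i * vec_nth v i) *\<^sub>R y) = (v \<bullet> v) *\<^sub>R y"
    by (simp add: inner_vec_def scaleR_sum_left)
  finally show ?thesis .
qed

end

locale clifford_action_domain = symmetric_domain \<Omega> + clifford_action mu
  for \<Omega> :: "complex set" and mu :: "'n::{finite,linorder} clifford \<Rightarrow> 'n clifford \<Rightarrow> 'n clifford"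
begin

section \<open>Residue fields and a class of smooth fields closed under differentiation\<close>

definition axial_dom :: "'n point set" where
  "axial_dom = {x. half_plane_point x \<in> \<Omega>}"

lemma open_axial_dom: "open axial_dom"
proof -
  have "axial_dom = half_plane_point -` \<Omega>" by (auto simp: axial_dom_def)
  then show ?thesis
    using open_vimage[OF open_dom continuous_half_plane_point] by simp
qed

text \<open>\<open>Re\<close> is real-linear, so the formulas for residue sums pass to fields
  coefficient by coefficient; for symmetric F the residue sums are real already
  (\<open>res_sum_real\<close>) and nothing is lost.\<close>

definition residue_field :: "('n set \<Rightarrow> complex \<Rightarrow> complex) \<Rightarrow> nat \<Rightarrow> nat \<Rightarrow> 'n field_fun" where
  "residue_field F j m x = (\<Sum>A\<in>UNIV. Re (res_sum j m (F A) (half_plane_point x)) *\<^sub>R blade A)"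

text \<open>The class contains the residue fields, admits the operations from which the operators
  are built, and is closed under partial derivatives (\<open>smooth_field_partial\<close>). Being in
  it thus amounts to smoothness of every order on \<open>axial_dom\<close>, proved by induction on
  the generation. The congruence rule is needed since the fields are controlled on that set
  only.\<close>

inductive smooth_field :: "'n field_fun \<Rightarrow> bool" where
  smooth_field_residue_field: "(\<And>A. F A holomorphic_on \<Omega>) \<Longrightarrow> smooth_field (residue_field F j m)"
| smooth_field_add: "smooth_field f \<Longrightarrow> smooth_field g \<Longrightarrow> smooth_field (\<lambda>x. f x + g x)"
| smooth_field_linear: "smooth_field f \<Longrightarrow> bounded_linear T \<Longrightarrow> smooth_field (\<lambda>x. T (f x))"
| smooth_field_inner: "smooth_field f \<Longrightarrow> smooth_field (\<lambda>x. (x \<bullet> b) *\<^sub>R f x)"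
| smooth_field_cong: "smooth_field f \<Longrightarrow> (\<And>x. x \<in> axial_dom \<Longrightarrow> f x = g x) \<Longrightarrow> smooth_field g"

lemma smooth_field_scaleR: "smooth_field f \<Longrightarrow> smooth_field (\<lambda>x. c *\<^sub>R f x)"
  by (rule smooth_field_linear[OF _ bounded_linear_scaleR_right])

lemma smooth_field_mult: "smooth_field f \<Longrightarrow> smooth_field (\<lambda>x. mu c (f x))"
  by (rule smooth_field_linear[OF _ mult.bounded_linear_right])

lemma smooth_field_diff: "smooth_field f \<Longrightarrow> smooth_field g \<Longrightarrow> smooth_field (\<lambda>x. f x - g x)"
  using smooth_field_add[OF _ smooth_field_scaleR[of g "-1"]] by simp

lemma smooth_field_sum:
  assumes "finite S" "\<And>i. i \<in> S \<Longrightarrow> smooth_field (f i)" "S \<noteq> {}"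
  shows "smooth_field (\<lambda>x. \<Sum>i\<in>S. f i x)"
  using assms(1,3,2)
  by (induction S rule: finite_ne_induct) (auto intro: smooth_field_add)

lemmas smooth_field_intros = smooth_field_add smooth_field_diff smooth_field_scaleR smooth_field_mult smooth_field_inner

definition has_dir_deriv :: "'n field_fun \<Rightarrow> 'n point \<Rightarrow> 'n field_fun \<Rightarrow> bool" where
  "has_dir_deriv f b g \<longleftrightarrow> (\<forall>x\<in>axial_dom. ((\<lambda>t. f (x + t *\<^sub>R b)) has_vector_derivative g x) (at 0))"

lemma has_dir_deriv_partial: "has_dir_deriv f b g \<Longrightarrow> x \<in> axial_dom \<Longrightarrow> partial b f x = g x"
  unfolding has_dir_deriv_def partial_def by (blast intro: vector_derivative_at)

lemma has_dir_deriv_cong: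
  assumes "has_dir_deriv f b g" "\<And>x. x \<in> axial_dom \<Longrightarrow> f x = f' x"
  shows "has_dir_deriv f' b g"
  unfolding has_dir_deriv_def
proof
  fix x assume x: "x \<in> axial_dom"
  have c: "continuous_on UNIV (\<lambda>t::real. x + t *\<^sub>R b)" by (intro continuous_intros)
  show "((\<lambda>t. f' (x + t *\<^sub>R b)) has_vector_derivative g x) (at 0)"
  proof (rule has_vector_derivative_transform_within_open)
    show "((\<lambda>t. f (x + t *\<^sub>R b)) has_vector_derivative g x) (at 0)"
      using assms(1) x by (simp add: has_dir_deriv_def)
    show "open ((\<lambda>t. x + t *\<^sub>R b) -` axial_dom)" by (rule open_vimage[OF open_axial_dom c])
  qed (use x assms(2) in auto)
qed

lemma has_dir_deriv_residue_field:
  assumes "\<And>A. F A holomorphic_on \<Omega>"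
  shows "has_dir_deriv (residue_field F j m) b (\<lambda>x. fst b *\<^sub>R ((2 * real m) *\<^sub>R residue_field F (Suc j) (Suc m) x -
    real j *\<^sub>R residue_field F (j - 1) m x) - (2 * real m) *\<^sub>R ((x \<bullet> (0, snd b)) *\<^sub>R residue_field F j (Suc m) x))"
  unfolding has_dir_deriv_def
proof
  fix x :: "'n point" assume "x \<in> axial_dom"
  then have x: "half_plane_point x \<in> \<Omega>" by (simp add: axial_dom_def)
  let ?R = "\<lambda>j m A. Re (res_sum j m (F A) (half_plane_point x))"
  have "((\<lambda>t. Re (res_sum j m (F A) (half_plane_point (x + t *\<^sub>R b))) *\<^sub>R blade A) has_vector_derivative
      (fst b * (2 * real m * ?R (Suc j) (Suc m) A - real j * ?R (j - 1) m A) -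
       2 * real m * (snd x \<bullet> snd b) * ?R j (Suc m) A) *\<^sub>R blade A) (at 0)" for A
    using bounded_linear.has_vector_derivative[OF
        bounded_linear_compose[OF bounded_linear_scaleR_left[of "blade A"] bounded_linear_Re]
        res_sum_directional_derivative[where j = j and m = m and b = b, OF assms[of A] x]]
    by simp
  then have "((\<lambda>t. residue_field F j m (x + t *\<^sub>R b)) has_vector_derivative
      (\<Sum>A\<in>UNIV. (fst b * (2 * real m * ?R (Suc j) (Suc m) A - real j * ?R (j - 1) m A) -
       2 * real m * (snd x \<bullet> snd b) * ?R j (Suc m) A) *\<^sub>R blade A)) (at 0)"
    unfolding residue_field_def by (rule has_vector_derivative_sum)
  also have "(\<Sum>A\<in>UNIV. (fst b * (2 * real m * ?R (Suc j) (Suc m) A - real j * ?R (j - 1) m A) -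
       2 * real m * (snd x \<bullet> snd b) * ?R j (Suc m) A) *\<^sub>R blade A) =
     fst b *\<^sub>R ((2 * real m) *\<^sub>R residue_field F (Suc j) (Suc m) x - real j *\<^sub>R residue_field F (j - 1) m x) -
     (2 * real m) *\<^sub>R ((x \<bullet> (0, snd b)) *\<^sub>R residue_field F j (Suc m) x)"
    unfolding residue_field_def scaleR_sum_right sum_subtractf[symmetric]
    by (rule sum.cong[OF refl]) (simp add: inner_prod_def algebra_simps)
  finally show "((\<lambda>t. residue_field F j m (x + t *\<^sub>R b)) has_vector_derivative
     fst b *\<^sub>R ((2 * real m) *\<^sub>R residue_field F (Suc j) (Suc m) x - real j *\<^sub>R residue_field F (j - 1) m x) -
     (2 * real m) *\<^sub>R ((x \<bullet> (0, snd b)) *\<^sub>R residue_field F j (Suc m) x)) (at 0)" .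
qed

lemma has_dir_deriv_add: "has_dir_deriv f b f' \<Longrightarrow> has_dir_deriv g b g' \<Longrightarrow> has_dir_deriv (\<lambda>x. f x + g x) b (\<lambda>x. f' x + g' x)"
  unfolding has_dir_deriv_def by (simp add: has_vector_derivative_add)

lemma has_dir_deriv_linear:
  "has_dir_deriv f b f' \<Longrightarrow> bounded_linear T \<Longrightarrow> has_dir_deriv (\<lambda>x. T (f x)) b (\<lambda>x. T (f' x))"
  unfolding has_dir_deriv_def using bounded_linear.has_vector_derivative[of T] by blast

lemma has_dir_deriv_inner:
  assumes "has_dir_deriv f b f'"
  shows "has_dir_deriv (\<lambda>x. (x \<bullet> c) *\<^sub>R f x) b (\<lambda>x. (b \<bullet> c) *\<^sub>R f x + (x \<bullet> c) *\<^sub>R f' x)"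
  unfolding has_dir_deriv_def
proof
  fix x assume x: "x \<in> axial_dom"
  have 1: "((\<lambda>t. (x + t *\<^sub>R b) \<bullet> c) has_vector_derivative b \<bullet> c) (at 0)"
    unfolding inner_add_left inner_scaleR_left has_real_derivative_iff_has_vector_derivative[symmetric]
    by (auto intro!: derivative_eq_intros)
  have 2: "((\<lambda>t. f (x + t *\<^sub>R b)) has_vector_derivative f' x) (at 0)"
    using assms x by (simp add: has_dir_deriv_def)
  show "((\<lambda>t. ((x + t *\<^sub>R b) \<bullet> c) *\<^sub>R f (x + t *\<^sub>R b)) has_vector_derivative
      (b \<bullet> c) *\<^sub>R f x + (x \<bullet> c) *\<^sub>R f' x) (at 0)"
    using bounded_bilinear.has_vector_derivative[OF bounded_bilinear_scaleR 1 2]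
    by (simp add: add.commute)
qed

lemma smooth_field_has_dir_deriv: "smooth_field f \<Longrightarrow> \<exists>f'. smooth_field f' \<and> has_dir_deriv f b f'"
proof (induction rule: smooth_field.induct)
  case (smooth_field_residue_field F j m)
  show ?case
    by (rule exI, rule conjI[OF _ has_dir_deriv_residue_field[OF smooth_field_residue_field]]) (intro smooth_field_intros smooth_field.smooth_field_residue_field smooth_field_residue_field)
next
  case (smooth_field_add f g)
  then show ?case using has_dir_deriv_add smooth_field.smooth_field_add by blast
next
  case (smooth_field_linear f T)
  then show ?case using has_dir_deriv_linear smooth_field.smooth_field_linear by blast
next
  case (smooth_field_inner f c)
  then obtain f' where "smooth_field f'" "has_dir_deriv f b f'" by blast
  then show ?case
    using has_dir_deriv_inner smooth_field_inner.hyps by (blast intro: smooth_field_intros)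
next
  case (smooth_field_cong f g)
  then show ?case using has_dir_deriv_cong by blast
qed

lemma has_dir_deriv_partial_smooth_field:
  assumes "smooth_field f"
  shows "has_dir_deriv f b (partial b f)"
proof -
  obtain f' where f': "has_dir_deriv f b f'" using smooth_field_has_dir_deriv[OF assms] by blast
  then show ?thesis by (simp add: has_dir_deriv_partial[OF f'] has_dir_deriv_def)
qed

lemma smooth_field_partial:
  assumes "smooth_field f"
  shows "smooth_field (partial b f)"
proof -
  obtain f' where f': "smooth_field f'" "has_dir_deriv f b f'" using smooth_field_has_dir_deriv[OF assms] by blast
  show ?thesis by (rule smooth_field_cong[OF f'(1)]) (simp add: has_dir_deriv_partial[OF f'(2)])
qed

lemma partial_cong:
  assumes "smooth_field f" "\<And>x. x \<in> axial_dom \<Longrightarrow> f x = g x" "x \<in> axial_dom"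
  shows "partial b f x = partial b g x"
  using has_dir_deriv_partial[OF has_dir_deriv_cong[OF has_dir_deriv_partial_smooth_field[OF assms(1)] assms(2)] assms(3)] by simp

lemma partial_add: "smooth_field f \<Longrightarrow> smooth_field g \<Longrightarrow> x \<in> axial_dom \<Longrightarrow>
    partial b (\<lambda>x. f x + g x) x = partial b f x + partial b g x"
  by (rule has_dir_deriv_partial[OF has_dir_deriv_add[OF has_dir_deriv_partial_smooth_field has_dir_deriv_partial_smooth_field]])

lemma partial_linear: "smooth_field f \<Longrightarrow> bounded_linear (T :: 'n clifford \<Rightarrow> 'n clifford) \<Longrightarrow> x \<in> axial_dom \<Longrightarrow>
    partial b (\<lambda>x. T (f x)) x = T (partial b f x)"
  by (rule has_dir_deriv_partial[OF has_dir_deriv_linear[where T = T, OF has_dir_deriv_partial_smooth_field]])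

lemma partial_inner: "smooth_field f \<Longrightarrow> x \<in> axial_dom \<Longrightarrow>
    partial b (\<lambda>x. (x \<bullet> c) *\<^sub>R f x) x = (b \<bullet> c) *\<^sub>R f x + (x \<bullet> c) *\<^sub>R partial b f x"
  by (rule has_dir_deriv_partial[OF has_dir_deriv_inner[OF has_dir_deriv_partial_smooth_field]])

lemma partial_scaleR: "smooth_field f \<Longrightarrow> x \<in> axial_dom \<Longrightarrow> partial b (\<lambda>x. c *\<^sub>R f x) x = c *\<^sub>R partial b f x"
  by (rule partial_linear[OF _ bounded_linear_scaleR_right])

lemma partial_mult: "smooth_field f \<Longrightarrow> x \<in> axial_dom \<Longrightarrow> partial b (\<lambda>x. mu c (f x)) x = mu c (partial b f x)"
  by (rule partial_linear[OF _ mult.bounded_linear_right])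

lemma partial_diff: "smooth_field f \<Longrightarrow> smooth_field g \<Longrightarrow> x \<in> axial_dom \<Longrightarrow>
    partial b (\<lambda>x. f x - g x) x = partial b f x - partial b g x"
  using partial_add[of f "\<lambda>x. (-1) *\<^sub>R g x" x b] smooth_field_scaleR[of g "-1"] partial_scaleR[of g x b "-1"]
  by simp

lemma partial_sum:
  assumes "finite S" "\<And>i. i \<in> S \<Longrightarrow> smooth_field (f i)" "x \<in> axial_dom" "S \<noteq> {}"
  shows "partial b (\<lambda>x. \<Sum>i\<in>S. f i x) x = (\<Sum>i\<in>S. partial b (f i) x)"
  using assms(1,4,2)
proof (induction S rule: finite_ne_induct)
  case (insert i S)
  then show ?case
    using partial_add[of "f i" "\<lambda>x. \<Sum>i\<in>S. f i x" x b] smooth_field_sum[of S f] assms(3) by simp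
qed simp

lemma partial_residue_field:
  assumes "\<And>A. F A holomorphic_on \<Omega>" "x \<in> axial_dom"
  shows "partial b (residue_field F j m) x = fst b *\<^sub>R ((2 * real m) *\<^sub>R residue_field F (Suc j) (Suc m) x -
    real j *\<^sub>R residue_field F (j - 1) m x) - (2 * real m) *\<^sub>R ((x \<bullet> (0, snd b)) *\<^sub>R residue_field F j (Suc m) x)"
  by (rule has_dir_deriv_partial[OF has_dir_deriv_residue_field[OF assms(1)] assms(2)])

lemma partial_partial_residue_field:
  assumes F: "\<And>A. F A holomorphic_on \<Omega>" and x: "x \<in> axial_dom"
  shows "partial b (partial c (residue_field F j m)) x = partial c (partial b (residue_field F j m)) x"
proof -
  note J = smooth_field_residue_field[of F, OF F]
  have *: "partial b (partial c (residue_field F j m)) x =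
    fst c *\<^sub>R ((2 * real m) *\<^sub>R partial b (residue_field F (Suc j) (Suc m)) x - real j *\<^sub>R partial b (residue_field F (j - 1) m) x) -
    (2 * real m) *\<^sub>R ((b \<bullet> (0, snd c)) *\<^sub>R residue_field F j (Suc m) x + (x \<bullet> (0, snd c)) *\<^sub>R partial b (residue_field F j (Suc m)) x)"
    for b c
  proof -
    have "partial b (partial c (residue_field F j m)) x = partial b (\<lambda>x. fst c *\<^sub>R ((2 * real m) *\<^sub>R residue_field F (Suc j) (Suc m) x -
      real j *\<^sub>R residue_field F (j - 1) m x) - (2 * real m) *\<^sub>R ((x \<bullet> (0, snd c)) *\<^sub>R residue_field F j (Suc m) x)) x"
      by (rule partial_cong[OF smooth_field_partial[OF J] partial_residue_field[OF F] x])
    also have "\<dots> = fst c *\<^sub>R ((2 * real m) *\<^sub>R partial b (residue_field F (Suc j) (Suc m)) x - real j *\<^sub>R partial b (residue_field F (j - 1) m) x) -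
    (2 * real m) *\<^sub>R ((b \<bullet> (0, snd c)) *\<^sub>R residue_field F j (Suc m) x + (x \<bullet> (0, snd c)) *\<^sub>R partial b (residue_field F j (Suc m)) x)"
      by (simp only: partial_diff partial_scaleR partial_inner smooth_field_intros J x)
    finally show ?thesis .
  qed
  define \<beta> \<gamma> \<epsilon> where "\<beta> = x \<bullet> (0, snd b)" and "\<gamma> = x \<bullet> (0, snd c)" and "\<epsilon> = b \<bullet> (0, snd c)"
  have \<epsilon>: "c \<bullet> (0, snd b) = \<epsilon>"
    by (simp add: \<epsilon>_def inner_prod_def inner_commute)
  show ?thesis
    unfolding * partial_residue_field[OF F x] \<epsilon> \<beta>_def[symmetric] \<gamma>_def[symmetric] \<epsilon>_def[symmetric]
    \<comment> \<open>Differentiating index j - 1 produces Suc (j - 1), which equals j only for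
      positive j; at j = 0 the coefficient vanishes.\<close>
    by (cases j) (simp_all add: scaleR_right_diff_distrib scaleR_right_distrib mult_ac)
qed

text \<open>Symmetry holds for residue fields by their explicit derivatives, and each rule
  generating the class preserves it; second total derivatives never enter.\<close>

lemma partial_commute: "smooth_field f \<Longrightarrow> x \<in> axial_dom \<Longrightarrow> partial b (partial c f) x = partial c (partial b f) x"
proof (induction arbitrary: x rule: smooth_field.induct)
  case (smooth_field_residue_field F j m)
  then show ?case by (intro partial_partial_residue_field)
next
  case (smooth_field_add f g)
  have "partial b (partial c (\<lambda>x. f x + g x)) x = partial b (\<lambda>x. partial c f x + partial c g x) x" for b c
    by (rule partial_cong) (simp_all add: smooth_field_add smooth_field_partial smooth_field.smooth_field_add partial_add)
  then show ?case
    using smooth_field_add by (simp add: partial_add smooth_field_partial)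
next
  case (smooth_field_linear f T)
  have "partial b (partial c (\<lambda>x. T (f x))) x = partial b (\<lambda>x. T (partial c f x)) x" for b c
    by (rule partial_cong) (simp_all add: smooth_field_linear smooth_field_partial smooth_field.smooth_field_linear partial_linear)
  then show ?case
    using smooth_field_linear by (simp add: partial_linear smooth_field_partial)
next
  case (smooth_field_inner f d)
  have "partial b (partial c (\<lambda>x. (x \<bullet> d) *\<^sub>R f x)) x =
      partial b (\<lambda>x. (c \<bullet> d) *\<^sub>R f x + (x \<bullet> d) *\<^sub>R partial c f x) x" for b c
    by (rule partial_cong) (simp_all add: smooth_field_inner smooth_field_partial smooth_field.smooth_field_inner partial_inner)
  also have "\<dots> b c = (c \<bullet> d) *\<^sub>R partial b f x + ((b \<bullet> d) *\<^sub>R partial c f x + (x \<bullet> d) *\<^sub>R partial b (partial c f) x)" for b c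
    using smooth_field_inner by (simp add: partial_add partial_scaleR partial_inner smooth_field_partial smooth_field_intros)
  finally show ?case
    using smooth_field_inner by simp
next
  case (smooth_field_cong f g)
  have "partial b (partial c g) x = partial b (partial c f) x" for b c
    by (rule partial_cong[symmetric]; (rule smooth_field_partial smooth_field_cong partial_cong)+)
       (simp_all add: smooth_field_cong)
  then show ?case using smooth_field_cong by simp
qed

lemma smooth_field_continuous: "smooth_field f \<Longrightarrow> continuous_on axial_dom f"
proof (induction rule: smooth_field.induct)
  case (smooth_field_residue_field F j m)
  show ?case unfolding residue_field_def axial_dom_def
    by (intro continuous_intros continuous_on_Re res_sum_continuous smooth_field_residue_field)
next
  case (smooth_field_linear f T)
  then show ?case by (simp add: bounded_linear.continuous_on)
next
  case (smooth_field_cong f g)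
  then show ?case using continuous_on_cong by metis
qed (intro continuous_intros; assumption)+

lemma smooth_field_Ck_on: "smooth_field f \<Longrightarrow> Ck_on k axial_dom f"
proof (induction k arbitrary: f)
  case (Suc k)
  have "(\<lambda>t. f (x + t *\<^sub>R b)) differentiable (at (0::real))" if "x \<in> axial_dom" for x b
    using has_dir_deriv_partial_smooth_field[OF Suc.prems] that unfolding has_dir_deriv_def
    by (blast intro: differentiableI_vector)
  then show ?case using Suc smooth_field_continuous smooth_field_partial by simp
qed (simp add: smooth_field_continuous)

end

section \<open>Dirac operators on axial fields\<close>

context clifford_action_domain
begin

lemma smooth_field_field_op: "smooth_field f \<Longrightarrow> smooth_field (field_op mu \<sigma> f)"
  unfolding field_op_def[abs_def] by (intro smooth_field_intros smooth_field_sum smooth_field_partial) auto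

lemma field_op_cong:
  assumes "smooth_field f" "\<And>x. x \<in> axial_dom \<Longrightarrow> f x = g x" "x \<in> axial_dom"
  shows "field_op mu \<sigma> f x = field_op mu \<sigma> g x"
  unfolding field_op_def by (simp only: partial_cong[OF assms])

lemma field_op_add:
  assumes "smooth_field f" "smooth_field g" "x \<in> axial_dom"
  shows "field_op mu \<sigma> (\<lambda>x. f x + g x) x = field_op mu \<sigma> f x + field_op mu \<sigma> g x"
  unfolding field_op_def
  by (simp add: partial_add assms mult.add_right sum.distrib scaleR_add_right)

lemma field_op_scaleR:
  assumes "smooth_field f" "x \<in> axial_dom"
  shows "field_op mu \<sigma> (\<lambda>x. c *\<^sub>R f x) x = c *\<^sub>R field_op mu \<sigma> f x"
  unfolding field_op_def
  by (simp add: partial_scaleR assms mult.scaleR_right scaleR_add_right scaleR_sum_right mult.commute)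

lemma field_op_fst:
  assumes "smooth_field f" "x \<in> axial_dom"
  shows "field_op mu \<sigma> (\<lambda>x. fst x *\<^sub>R f x) x = f x + fst x *\<^sub>R field_op mu \<sigma> f x"
proof -
  have *: "partial b (\<lambda>x. fst x *\<^sub>R f x) x = fst b *\<^sub>R f x + fst x *\<^sub>R partial b f x" for b
    using partial_inner[OF assms, of b "(1, 0)"] by (simp add: inner_prod_def)
  show ?thesis
    unfolding field_op_def *
    by (simp add: mult.scaleR_right scaleR_add_right scaleR_sum_right mult.commute)
qed

lemma smooth_field_fst: "smooth_field f \<Longrightarrow> smooth_field (\<lambda>x. fst x *\<^sub>R f x)"
  using smooth_field_inner[of f "(1, 0)"] by (simp add: inner_prod_def)

lemma smooth_field_iter: "smooth_field f \<Longrightarrow> smooth_field ((field_op mu \<sigma> ^^ k) f)"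
  by (induction k) (auto intro: smooth_field_field_op)

lemma field_op_iter_cong:
  assumes "smooth_field f" "\<And>x. x \<in> axial_dom \<Longrightarrow> f x = g x" "x \<in> axial_dom"
  shows "(field_op mu \<sigma> ^^ k) f x = (field_op mu \<sigma> ^^ k) g x"
  using assms(3)
proof (induction k arbitrary: x)
  case (Suc k)
  then show ?case using field_op_cong[OF smooth_field_iter[OF assms(1)]] by simp
qed (simp add: assms)

lemma field_op_iter_add:
  assumes "smooth_field f" "smooth_field g" "x \<in> axial_dom"
  shows "(field_op mu \<sigma> ^^ k) (\<lambda>x. f x + g x) x = (field_op mu \<sigma> ^^ k) f x + (field_op mu \<sigma> ^^ k) g x"
  using assms(3)
proof (induction k arbitrary: x)
  case (Suc k)
  have "field_op mu \<sigma> ((field_op mu \<sigma> ^^ k) (\<lambda>x. f x + g x)) x =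
      field_op mu \<sigma> (\<lambda>x. (field_op mu \<sigma> ^^ k) f x + (field_op mu \<sigma> ^^ k) g x) x"
    by (rule field_op_cong[OF _ Suc.IH Suc.prems]) (intro smooth_field_iter smooth_field_add assms)
  then show ?case
    using field_op_add[OF smooth_field_iter[OF assms(1)] smooth_field_iter[OF assms(2)] Suc.prems] by simp
qed simp

lemma field_op_iter_scaleR:
  assumes "smooth_field f" "x \<in> axial_dom"
  shows "(field_op mu \<sigma> ^^ k) (\<lambda>x. c *\<^sub>R f x) x = c *\<^sub>R (field_op mu \<sigma> ^^ k) f x"
  using assms(2)
proof (induction k arbitrary: x)
  case (Suc k)
  have "field_op mu \<sigma> ((field_op mu \<sigma> ^^ k) (\<lambda>x. c *\<^sub>R f x)) x =
      field_op mu \<sigma> (\<lambda>x. c *\<^sub>R (field_op mu \<sigma> ^^ k) f x) x"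
    by (rule field_op_cong[OF _ Suc.IH Suc.prems]) (intro smooth_field_iter smooth_field_scaleR assms)
  then show ?case
    using field_op_scaleR[OF smooth_field_iter[OF assms(1)] Suc.prems] by simp
qed simp

text \<open>Only the derivative in x_0 notices the factor x_0, so the commutator of the operator
  with x_0 is the identity, and that of its k-th power is k times the power k - 1. At k = 0 the
  truncated exponent has coefficient 0.\<close>

lemma field_op_iter_fst:
  assumes "smooth_field f" "x \<in> axial_dom"
  shows "(field_op mu \<sigma> ^^ k) (\<lambda>x. fst x *\<^sub>R f x) x =
    fst x *\<^sub>R (field_op mu \<sigma> ^^ k) f x + real k *\<^sub>R (field_op mu \<sigma> ^^ (k - 1)) f x"
  using assms(2)
proof (induction k arbitrary: x)
  case (Suc k)
  note S = smooth_field_iter[OF assms(1)]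
  have "field_op mu \<sigma> ((field_op mu \<sigma> ^^ k) (\<lambda>x. fst x *\<^sub>R f x)) x =
      field_op mu \<sigma> (\<lambda>x. fst x *\<^sub>R (field_op mu \<sigma> ^^ k) f x + real k *\<^sub>R (field_op mu \<sigma> ^^ (k - 1)) f x) x"
    by (rule field_op_cong[OF _ Suc.IH Suc.prems]) (intro smooth_field_iter smooth_field_fst assms)
  also have "\<dots> = (field_op mu \<sigma> ^^ k) f x + fst x *\<^sub>R field_op mu \<sigma> ((field_op mu \<sigma> ^^ k) f) x +
      real k *\<^sub>R field_op mu \<sigma> ((field_op mu \<sigma> ^^ (k - 1)) f) x"
    by (simp add: field_op_add field_op_scaleR field_op_fst S smooth_field_fst smooth_field_scaleR Suc.prems)
  finally show ?case
    by (cases k) (simp_all add: scaleR_left_distrib scaleR_2)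
qed simp

text \<open>The opposite signs cancel the terms mixing x_0 with the other variables; among the
  latter, symmetric second derivatives meet anticommuting generators and only the squares
  survive.\<close>

lemma field_op_field_op:
  assumes f: "smooth_field f" and x: "x \<in> axial_dom" and \<sigma>: "\<sigma> * \<sigma> = 1"
  shows "field_op mu \<sigma> (field_op mu (- \<sigma>) f) x = laplace f x"
proof -
  have p: "partial b (field_op mu (- \<sigma>) f) x =
      partial b (d_0 f) x - \<sigma> *\<^sub>R (\<Sum>i\<in>UNIV. mu (gen i) (partial b (d_vec i f) x))" for b
  proof -
    have S: "smooth_field (\<lambda>x. \<Sum>i\<in>UNIV. mu (gen i) (d_vec i f x))"
      by (intro smooth_field_sum smooth_field_mult smooth_field_partial f) auto
    have "partial b (field_op mu (- \<sigma>) f) x =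
        partial b (d_0 f) x - \<sigma> *\<^sub>R partial b (\<lambda>x. \<Sum>i\<in>UNIV. mu (gen i) (d_vec i f x)) x"
      using partial_diff[OF smooth_field_partial[OF f] smooth_field_scaleR[OF S] x] partial_scaleR[OF S x]
      unfolding field_op_def[abs_def] by simp
    also have "partial b (\<lambda>x. \<Sum>i\<in>UNIV. mu (gen i) (d_vec i f x)) x =
        (\<Sum>i\<in>UNIV. mu (gen i) (partial b (d_vec i f) x))"
      by (subst partial_sum) (auto simp: smooth_field_mult smooth_field_partial f x partial_mult)
    finally show ?thesis .
  qed
  have H: "(\<Sum>i\<in>UNIV. \<Sum>j\<in>UNIV. mu (gen i) (mu (gen j) (d_vec i (d_vec j f) x))) = - (\<Sum>i\<in>UNIV. d_vec i (d_vec i f) x)"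
    by (rule sum_gen_gen_symmetric) (rule partial_commute[OF f x])
  have c: "d_0 (d_vec i f) x = d_vec i (d_0 f) x" for i
    by (rule partial_commute[OF f x])
  have "field_op mu \<sigma> (field_op mu (- \<sigma>) f) x = d_0 (d_0 f) x -
      (\<sigma> * \<sigma>) *\<^sub>R (\<Sum>i\<in>UNIV. \<Sum>j\<in>UNIV. mu (gen i) (mu (gen j) (d_vec i (d_vec j f) x)))"
    unfolding field_op_def[of mu \<sigma>] p
    by (simp add: mult.diff_right mult.scaleR_right mult.sum_right sum_subtractf scaleR_diff_right
        scaleR_sum_right c)
  then show ?thesis
    unfolding H by (simp add: \<sigma> laplace_def)
qed

lemma smooth_field_laplace:
  assumes "smooth_field f"
  shows "smooth_field (laplace f)"
proof (rule smooth_field_cong)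
  show "smooth_field (field_op mu 1 (field_op mu (-1) f))" by (intro smooth_field_field_op assms)
qed (use field_op_field_op[OF assms, of _ 1] in simp)

lemma smooth_field_laplace_iter: "smooth_field f \<Longrightarrow> smooth_field ((laplace ^^ l) f)"
  by (induction l) (auto intro: smooth_field_laplace)

lemma laplace_cong:
  assumes "smooth_field f" "\<And>x. x \<in> axial_dom \<Longrightarrow> f x = g x" "x \<in> axial_dom"
  shows "laplace f x = laplace g x"
proof -
  have "field_op mu 1 (field_op mu (-1) f) x = field_op mu 1 (field_op mu (-1) g) x"
    by (intro field_op_cong smooth_field_field_op assms)
  then show ?thesis
    using field_op_field_op[of f x 1] field_op_field_op[of g x 1] smooth_field_cong[OF assms(1,2)] assms
    by simp
qed

lemma laplace_iter_cong:
  assumes "smooth_field f" "\<And>x. x \<in> axial_dom \<Longrightarrow> f x = g x" "x \<in> axial_dom"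
  shows "(laplace ^^ l) f x = (laplace ^^ l) g x"
  using assms(3)
proof (induction l arbitrary: x)
  case (Suc l)
  then show ?case using laplace_cong[OF smooth_field_laplace_iter[OF assms(1)]] by simp
qed (simp add: assms)

text \<open>Both sides are the same product of three first order operators with signs \<sigma>,
  -\<sigma>, \<sigma>, bracketed differently.\<close>

lemma laplace_field_op:
  assumes f: "smooth_field f" and x: "x \<in> axial_dom" and \<sigma>: "\<sigma> * \<sigma> = 1"
  shows "laplace (field_op mu \<sigma> f) x = field_op mu \<sigma> (laplace f) x"
proof -
  have "laplace (field_op mu \<sigma> f) x = field_op mu \<sigma> (field_op mu (- \<sigma>) (field_op mu \<sigma> f)) x"
    using field_op_field_op[OF smooth_field_field_op[OF f] x \<sigma>] by simp
  also have "\<dots> = field_op mu \<sigma> (laplace f) x"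
    by (rule field_op_cong) (use f x \<sigma> field_op_field_op[of f _ "- \<sigma>"] in \<open>auto intro: smooth_field_field_op\<close>)
  finally show ?thesis .
qed

lemma laplace_iter:
  assumes f: "smooth_field f" and x: "x \<in> axial_dom" and \<sigma>: "\<sigma> * \<sigma> = 1"
  shows "laplace ((field_op mu \<sigma> ^^ k) f) x = (field_op mu \<sigma> ^^ k) (laplace f) x"
  using x
proof (induction k arbitrary: x)
  case (Suc k)
  have "laplace (field_op mu \<sigma> ((field_op mu \<sigma> ^^ k) f)) x = field_op mu \<sigma> (laplace ((field_op mu \<sigma> ^^ k) f)) x"
    by (rule laplace_field_op[OF smooth_field_iter[OF f] Suc.prems \<sigma>])
  also have "\<dots> = field_op mu \<sigma> ((field_op mu \<sigma> ^^ k) (laplace f)) x"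
    by (rule field_op_cong[OF smooth_field_laplace[OF smooth_field_iter[OF f]] Suc.IH Suc.prems])
  finally show ?case by simp
qed simp

text \<open>Needed because the left map applies the Laplacians last and the right map applies them
  first.\<close>

lemma laplace_iter_iter:
  assumes f: "smooth_field f" and x: "x \<in> axial_dom" and \<sigma>: "\<sigma> * \<sigma> = 1"
  shows "(laplace ^^ l) ((field_op mu \<sigma> ^^ k) f) x = (field_op mu \<sigma> ^^ k) ((laplace ^^ l) f) x"
  using x
proof (induction l arbitrary: x)
  case (Suc l)
  have "laplace ((laplace ^^ l) ((field_op mu \<sigma> ^^ k) f)) x = laplace ((field_op mu \<sigma> ^^ k) ((laplace ^^ l) f)) x"
    by (rule laplace_cong[OF smooth_field_laplace_iter[OF smooth_field_iter[OF f]] Suc.IH Suc.prems])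
  also have "\<dots> = (field_op mu \<sigma> ^^ k) (laplace ((laplace ^^ l) f)) x"
    by (rule laplace_iter[OF smooth_field_laplace_iter[OF f] Suc.prems \<sigma>])
  finally show ?case by simp
qed simp

text \<open>Since s minus the conjugate of x equals w plus the vector part, this is the residue sum
  of the kernel numerator times w^j q^{-m} F(s), with the noncommuting vector part kept
  outside.\<close>

definition axial_field :: "('n set \<Rightarrow> complex \<Rightarrow> complex) \<Rightarrow> nat \<Rightarrow> nat \<Rightarrow> 'n field_fun" where
  "axial_field F j m x = residue_field F (Suc j) m x + mu (vec_unit (snd x)) (residue_field F j m x)"

lemma mult_vec_inner: "mu (vec_unit (snd x)) y = (\<Sum>i\<in>UNIV. (x \<bullet> (0, axis i 1)) *\<^sub>R mu (gen i) y)"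
  by (simp add: mult_vec inner_prod_def inner_axis)

lemma smooth_field_vec: "smooth_field f \<Longrightarrow> smooth_field (\<lambda>x. mu (vec_unit (snd x)) (f x))"
  unfolding mult_vec_inner by (intro smooth_field_sum smooth_field_inner smooth_field_mult) auto

lemma partial_vec:
  assumes "smooth_field f" "x \<in> axial_dom"
  shows "partial b (\<lambda>x. mu (vec_unit (snd x)) (f x)) x =
    mu (vec_unit (snd b)) (f x) + mu (vec_unit (snd x)) (partial b f x)"
  unfolding mult_vec_inner
  by (subst partial_sum) (auto simp: smooth_field_inner smooth_field_mult partial_inner partial_mult assms sum.distrib)

lemma smooth_field_axial_field: "(\<And>A. F A holomorphic_on \<Omega>) \<Longrightarrow> smooth_field (axial_field F j m)"
  unfolding axial_field_def[abs_def] by (intro smooth_field_add smooth_field_vec smooth_field_residue_field)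

lemma vec_unit_0: "vec_unit 0 = 0"
  by (simp add: vec_unit_eq)

lemma vec_unit_axis: "vec_unit (axis i 1) = gen i"
  by (simp add: vec_unit_eq axis_def if_distrib if_distribR cong: if_cong)

lemma residue_field_denominator:
  assumes "\<And>A. F A holomorphic_on \<Omega>" "x \<in> axial_dom"
  shows "residue_field F j m x = residue_field F (Suc (Suc j)) (Suc m) x + (snd x \<bullet> snd x) *\<^sub>R residue_field F j (Suc m) x"
proof -
  have "Re (res_sum j m (F A) (half_plane_point x)) = Re (res_sum (Suc (Suc j)) (Suc m) (F A) (half_plane_point x)) +
      (snd x \<bullet> snd x) * Re (res_sum j (Suc m) (F A) (half_plane_point x))" for A
    using res_sum_denominator[OF assms(1)[of A], of "half_plane_point x" j m] assms(2)
    by (simp add: axial_dom_def half_plane_point_def power2_norm_eq_inner flip: of_real_power)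
  then show ?thesis
    by (simp add: residue_field_def scaleR_sum_right sum.distrib scaleR_left_distrib)
qed

lemma residue_field_shift:
  assumes "\<And>A. F A holomorphic_on \<Omega>" "x \<in> axial_dom"
  shows "residue_field (\<lambda>A s. s * F A s) j m x = residue_field F (Suc j) m x + fst x *\<^sub>R residue_field F j m x"
proof -
  have "Re (res_sum j m (\<lambda>s. s * F A s) (half_plane_point x)) = Re (res_sum (Suc j) m (F A) (half_plane_point x)) +
      fst x * Re (res_sum j m (F A) (half_plane_point x))" for A
    using res_sum_shift[OF assms(1)[of A], of "half_plane_point x" j m] assms(2)
    by (simp add: axial_dom_def half_plane_point_def)
  then show ?thesis
    by (simp add: residue_field_def scaleR_sum_right sum.distrib scaleR_left_distrib)
qed

lemma axial_field_shift:
  assumes "\<And>A. F A holomorphic_on \<Omega>" "x \<in> axial_dom"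
  shows "axial_field (\<lambda>A s. s * F A s) j m x = axial_field F (Suc j) m x + fst x *\<^sub>R axial_field F j m x"
  by (simp add: axial_field_def residue_field_shift[OF assms] mult.add_right mult.scaleR_right scaleR_add_right)

lemma sum_gen_coord: "(\<Sum>i\<in>UNIV. mu (gen i) (vec_nth v i *\<^sub>R y)) = mu (vec_unit v) y"
  by (simp add: mult_vec mult.scaleR_right)

lemma field_op_residue_field_0:
  assumes F: "\<And>A. F A holomorphic_on \<Omega>" and x: "x \<in> axial_dom"
  shows "field_op mu (-1) (residue_field F 0 m) x = (2 * real m) *\<^sub>R axial_field F 0 (Suc m) x"
proof -
  have "d_vec i (residue_field F 0 m) x = snd x $ i *\<^sub>R ((- 2 * real m) *\<^sub>R residue_field F 0 (Suc m) x)" for i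
    by (simp add: partial_residue_field[OF F x] inner_prod_def inner_axis mult.commute)
  then have "(\<Sum>i\<in>UNIV. mu (gen i) (d_vec i (residue_field F 0 m) x)) =
      mu (vec_unit (snd x)) ((- 2 * real m) *\<^sub>R residue_field F 0 (Suc m) x)"
    by (simp only: sum_gen_coord)
  then show ?thesis
    by (simp only: field_op_def) (simp add: partial_residue_field[OF F x] axial_field_def mult.scaleR_right mult.minus_right
        scaleR_add_right inner_prod_def)
qed

lemma d_0_axial_field:
  assumes F: "\<And>A. F A holomorphic_on \<Omega>" and x: "x \<in> axial_dom"
  shows "d_0 (axial_field F j m) x = (2 * real m) *\<^sub>R residue_field F (Suc (Suc j)) (Suc m) x - real (Suc j) *\<^sub>R residue_field F j m x +
    mu (vec_unit (snd x)) ((2 * real m) *\<^sub>R residue_field F (Suc j) (Suc m) x - real j *\<^sub>R residue_field F (j - 1) m x)"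
  unfolding axial_field_def[abs_def]
  by (subst partial_add[OF smooth_field_residue_field[OF F] smooth_field_vec[OF smooth_field_residue_field[OF F]] x])
    (simp add: partial_vec[OF smooth_field_residue_field[OF F] x] partial_residue_field[OF F x] vec_unit_0 mult.zero_left
      inner_prod_def)

text \<open>The derivatives of the vector part give -n through the squares of the generators.
  Squaring the vector part gives its norm squared times J_{j,m+1}, which
  \<open>residue_field_denominator\<close> turns into J_{j,m} - J_{j+2,m+1}; then all terms with m +
  1 cancel against the derivative in x_0.\<close>

lemma field_op_axial_field:
  assumes F: "\<And>A. F A holomorphic_on \<Omega>" and x: "x \<in> axial_dom"
  shows "field_op mu 1 (axial_field F j m) x =
    (2 * real m - 1 - real CARD('n)) *\<^sub>R residue_field F j m x - real j *\<^sub>R axial_field F (j - 1) m x"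
proof -
  define X where "X = mu (vec_unit (snd x))"
  have dv: "d_vec i (axial_field F j m) x = snd x $ i *\<^sub>R ((- 2 * real m) *\<^sub>R (residue_field F (Suc j) (Suc m) x + X (residue_field F j (Suc m) x)))
      + mu (gen i) (residue_field F j m x)" for i
    unfolding axial_field_def[abs_def]
    by (subst partial_add[OF smooth_field_residue_field[OF F] smooth_field_vec[OF smooth_field_residue_field[OF F]] x])
      (simp add: partial_vec[OF smooth_field_residue_field[OF F] x] partial_residue_field[OF F x] vec_unit_axis X_def inner_prod_def
        inner_axis mult.minus_right mult.diff_right mult.scaleR_right scaleR_add_right scaleR_diff_right mult_ac)
  have "(\<Sum>i\<in>UNIV. mu (gen i) (d_vec i (axial_field F j m) x)) =
      X ((- 2 * real m) *\<^sub>R (residue_field F (Suc j) (Suc m) x + X (residue_field F j (Suc m) x))) - real CARD('n) *\<^sub>R residue_field F j m x"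
    unfolding dv mult.add_right sum.distrib sum_gen_coord X_def
    by (simp add: mult_gen_square sum_negf sum_constant_scaleR del: sum_constant)
  also have "\<dots> = (- 2 * real m) *\<^sub>R X (residue_field F (Suc j) (Suc m) x) +
      (2 * real m) *\<^sub>R ((snd x \<bullet> snd x) *\<^sub>R residue_field F j (Suc m) x) - real CARD('n) *\<^sub>R residue_field F j m x"
    by (simp add: X_def mult.scaleR_right mult.add_right mult.diff_right mult.minus_right mult_vec_vec scaleR_add_right)
  finally have s: "(\<Sum>i\<in>UNIV. mu (gen i) (d_vec i (axial_field F j m) x)) = (- 2 * real m) *\<^sub>R X (residue_field F (Suc j) (Suc m) x) +
      (2 * real m) *\<^sub>R ((snd x \<bullet> snd x) *\<^sub>R residue_field F j (Suc m) x) - real CARD('n) *\<^sub>R residue_field F j m x" .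
  have d: "(snd x \<bullet> snd x) *\<^sub>R residue_field F j (Suc m) x = residue_field F j m x - residue_field F (Suc (Suc j)) (Suc m) x"
    using residue_field_denominator[where j = j and m = m, OF F x] by simp
  have X: "X (a - b) = X a - X b" "X (a + b) = X a + X b" "X (c *\<^sub>R a) = c *\<^sub>R X a" for a b c
    by (simp_all add: X_def mult.diff_right mult.add_right mult.scaleR_right)
  show ?thesis
    unfolding field_op_def s d d_0_axial_field[OF F x] X_def[symmetric]
    by (cases j) (simp_all add: axial_field_def X_def[symmetric] X algebra_simps scaleR_2)
qed

lemma field_op_conj:
  "field_op mu (-1) f x = 2 *\<^sub>R d_0 f x - field_op mu 1 f x"
  by (simp add: field_op_def scaleR_2)

lemma field_op_conj_axial_field_0:
  assumes F: "\<And>A. F A holomorphic_on \<Omega>" and x: "x \<in> axial_dom"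
  shows "field_op mu (-1) (axial_field F 0 m) x =
    (real CARD('n) - 1 - 2 * real m) *\<^sub>R residue_field F 0 m x + (4 * real m) *\<^sub>R axial_field F 1 (Suc m) x"
  unfolding field_op_conj field_op_axial_field[OF F x] d_0_axial_field[OF F x]
  by (simp add: axial_field_def algebra_simps mult.scaleR_right scaleR_2)

text \<open>D turns the field into a multiple of J_{0,m}, and the conjugate operator turns this back
  into an axial field with m raised by one.\<close>

lemma laplace_axial_field_0:
  assumes F: "\<And>A. F A holomorphic_on \<Omega>" and x: "x \<in> axial_dom"
  shows "laplace (axial_field F 0 m) x = (2 * real m * (2 * real m - 1 - real CARD('n))) *\<^sub>R axial_field F 0 (Suc m) x"
proof -
  have "laplace (axial_field F 0 m) x = field_op mu (-1) (field_op mu 1 (axial_field F 0 m)) x"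
    using field_op_field_op[OF smooth_field_axial_field[OF F] x, of "-1"] by simp
  also have "\<dots> = field_op mu (-1) (\<lambda>x. (2 * real m - 1 - real CARD('n)) *\<^sub>R residue_field F 0 m x) x"
    by (rule field_op_cong[OF smooth_field_field_op[OF smooth_field_axial_field[OF F]] _ x]) (simp add: field_op_axial_field F)
  also have "\<dots> = (2 * real m * (2 * real m - 1 - real CARD('n))) *\<^sub>R axial_field F 0 (Suc m) x"
    by (simp only: field_op_scaleR[OF smooth_field_residue_field[OF F] x] field_op_residue_field_0[OF F x] scaleR_scaleR mult.commute)
  finally show ?thesis .
qed

text \<open>For n = 2h + 1 the factor picked up at index m is -4 m (h + 1 - m); the constant is the
  product of these factors over m = 1, ..., l.\<close>

lemma laplace_iter_axial_field:
  assumes F: "\<And>A. F A holomorphic_on \<Omega>" and x: "x \<in> axial_dom" and n: "CARD('n) = 2 * h + 1" and "l \<le> h"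
  shows "(laplace ^^ l) (axial_field F 0 1) x = ((-4) ^ l * fact l * fact h / fact (h - l)) *\<^sub>R axial_field F 0 (Suc l) x"
  using x \<open>l \<le> h\<close>
proof (induction l arbitrary: x)
  case (Suc l)
  let ?c = "(-4) ^ l * fact l * fact h / fact (h - l) :: real"
  have "(laplace ^^ Suc l) (axial_field F 0 1) x = laplace ((laplace ^^ l) (axial_field F 0 1)) x"
    by simp
  also have "\<dots> = laplace (\<lambda>x. ?c *\<^sub>R axial_field F 0 (Suc l) x) x"
    by (rule laplace_cong[OF smooth_field_laplace_iter[OF smooth_field_axial_field[OF F]] Suc.IH Suc.prems(1)]) (use Suc.prems in auto)
  also have "\<dots> = ?c *\<^sub>R laplace (axial_field F 0 (Suc l)) x"
  proof -
    have "laplace (\<lambda>x. ?c *\<^sub>R axial_field F 0 (Suc l) x) x = field_op mu 1 (field_op mu (-1) (\<lambda>x. ?c *\<^sub>R axial_field F 0 (Suc l) x)) x"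
      using field_op_field_op[OF smooth_field_scaleR[OF smooth_field_axial_field[OF F]] Suc.prems(1), of 1] by simp
    also have "\<dots> = field_op mu 1 (\<lambda>x. ?c *\<^sub>R field_op mu (-1) (axial_field F 0 (Suc l)) x) x"
      by (rule field_op_cong[OF _ _ Suc.prems(1)])
        (auto intro!: smooth_field_field_op smooth_field_scaleR smooth_field_axial_field F field_op_scaleR)
    also have "\<dots> = ?c *\<^sub>R field_op mu 1 (field_op mu (-1) (axial_field F 0 (Suc l))) x"
      by (rule field_op_scaleR[OF smooth_field_field_op[OF smooth_field_axial_field[OF F]] Suc.prems(1)])
    also have "field_op mu 1 (field_op mu (-1) (axial_field F 0 (Suc l))) x = laplace (axial_field F 0 (Suc l)) x"
      using field_op_field_op[OF smooth_field_axial_field[OF F] Suc.prems(1), of 1] by simp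
    finally show ?thesis .
  qed
  also have "\<dots> = (?c * (2 * real (Suc l) * (2 * real (Suc l) - 1 - real CARD('n)))) *\<^sub>R axial_field F 0 (Suc (Suc l)) x"
    by (simp only: laplace_axial_field_0[OF F Suc.prems(1)] scaleR_scaleR)
  also have "?c * (2 * real (Suc l) * (2 * real (Suc l) - 1 - real CARD('n))) =
      (-4) ^ Suc l * fact (Suc l) * fact h / fact (h - Suc l)"
  proof -
    obtain d where d: "h = Suc (l + d)" using le_Suc_ex[OF Suc.prems(2)] by auto
    then have hd: "h - l = Suc d" "h - Suc l = d" by auto
    show ?thesis
      unfolding hd n by (simp add: d field_simps del: of_nat_Suc) (simp add: field_simps)
  qed
  finally show ?case .
qed simp

text \<open>With m = h - k, one application gives 2k J_{0,m} + 4m Y_{1,m+1}. Under k further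
  applications both summands produce a multiple of the power k - 1 applied to Y_{0,m+1}: the first
  through the formula for J_{0,m}, the second through the commutator with x_0. These multiples
  cancel, which is why a single field remains.\<close>

lemma field_op_iter_conj_axial_field:
  assumes F: "\<And>A. F A holomorphic_on \<Omega>" and x: "x \<in> axial_dom" and n: "CARD('n) = 2 * h + 1" and "k \<le> h"
  shows "(field_op mu (-1) ^^ k) (axial_field F 0 (Suc h - k)) x = (4 ^ k * fact h / fact (h - k)) *\<^sub>R axial_field F k (Suc h) x"
  using F x \<open>k \<le> h\<close>
proof (induction k arbitrary: F x)
  case (Suc k)
  let ?D = "field_op mu (-1)"
  let ?m = "h - k"
  let ?C = "4 ^ k * fact h / fact (h - k) :: real"
  let ?sF = "\<lambda>A s. s * F A s"
  note F = Suc.prems(1) and x = Suc.prems(2)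
  have sF: "?sF A holomorphic_on \<Omega>" for A
    by (intro holomorphic_intros F)
  have m: "Suc h - Suc k = ?m" "Suc ?m = Suc h - k" "real CARD('n) - 1 - 2 * real ?m = 2 * real k"
    using Suc.prems(3) n by auto
  have Y1: "axial_field F 1 (Suc ?m) x = axial_field ?sF 0 (Suc ?m) x + (-1) *\<^sub>R (fst x *\<^sub>R axial_field F 0 (Suc ?m) x)" if "x \<in> axial_dom" for x
    using axial_field_shift[where j = 0 and m = "Suc ?m", OF F that] by simp
  \<comment> \<open>The factor k covers k = 0, where there is no power k - 1.\<close>
  have DJ: "real k *\<^sub>R (?D ^^ k) (residue_field F 0 ?m) x = (2 * real k * real ?m) *\<^sub>R (?D ^^ (k - 1)) (axial_field F 0 (Suc ?m)) x"
  proof (cases k)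
    case (Suc i)
    have "(?D ^^ Suc i) (residue_field F 0 ?m) x = (?D ^^ i) (?D (residue_field F 0 ?m)) x"
      by (simp only: funpow_Suc_right o_apply)
    also have "\<dots> = (?D ^^ i) (\<lambda>x. (2 * real ?m) *\<^sub>R axial_field F 0 (Suc ?m) x) x"
      by (rule field_op_iter_cong[OF smooth_field_field_op[OF smooth_field_residue_field[OF F]] field_op_residue_field_0[OF F] x])
    also have "\<dots> = (2 * real ?m) *\<^sub>R (?D ^^ i) (axial_field F 0 (Suc ?m)) x"
      by (rule field_op_iter_scaleR[OF smooth_field_axial_field[OF F] x])
    finally show ?thesis by (simp add: Suc mult_ac)
  qed simp
  have "(?D ^^ k) (axial_field F 1 (Suc ?m)) x = (?D ^^ k) (\<lambda>x. axial_field ?sF 0 (Suc ?m) x + (-1) *\<^sub>R (fst x *\<^sub>R axial_field F 0 (Suc ?m) x)) x"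
    by (rule field_op_iter_cong[OF smooth_field_axial_field[OF F] Y1 x])
  also have "\<dots> = (?D ^^ k) (axial_field ?sF 0 (Suc ?m)) x +
      (-1) *\<^sub>R (fst x *\<^sub>R (?D ^^ k) (axial_field F 0 (Suc ?m)) x + real k *\<^sub>R (?D ^^ (k - 1)) (axial_field F 0 (Suc ?m)) x)"
    by (simp only: field_op_iter_add field_op_iter_scaleR field_op_iter_fst smooth_field_axial_field F sF smooth_field_scaleR smooth_field_fst x)
  also have "(?D ^^ k) (axial_field ?sF 0 (Suc ?m)) x = ?C *\<^sub>R axial_field ?sF k (Suc h) x"
    unfolding m by (rule Suc.IH[OF sF x]) (use Suc.prems in auto)
  also have "(?D ^^ k) (axial_field F 0 (Suc ?m)) x = ?C *\<^sub>R axial_field F k (Suc h) x"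
    unfolding m by (rule Suc.IH[OF F x]) (use Suc.prems in auto)
  also have "axial_field ?sF k (Suc h) x = axial_field F (Suc k) (Suc h) x + fst x *\<^sub>R axial_field F k (Suc h) x"
    by (rule axial_field_shift[OF F x])
  finally have DY: "(?D ^^ k) (axial_field F 1 (Suc ?m)) x = ?C *\<^sub>R axial_field F (Suc k) (Suc h) x - real k *\<^sub>R (?D ^^ (k - 1)) (axial_field F 0 (Suc ?m)) x"
    by (simp add: scaleR_add_right mult.commute)
  have "(?D ^^ Suc k) (axial_field F 0 (Suc h - Suc k)) x = (?D ^^ k) (?D (axial_field F 0 ?m)) x"
    by (simp only: funpow_Suc_right o_apply m)
  also have "\<dots> = (?D ^^ k) (\<lambda>x. (2 * real k) *\<^sub>R residue_field F 0 ?m x + (4 * real ?m) *\<^sub>R axial_field F 1 (Suc ?m) x) x"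
    by (rule field_op_iter_cong[OF smooth_field_field_op[OF smooth_field_axial_field[OF F]] _ x]) (simp only: field_op_conj_axial_field_0[OF F] m)
  also have "\<dots> = 2 *\<^sub>R (real k *\<^sub>R (?D ^^ k) (residue_field F 0 ?m) x) + (4 * real ?m) *\<^sub>R (?D ^^ k) (axial_field F 1 (Suc ?m)) x"
    by (simp only: field_op_iter_add field_op_iter_scaleR smooth_field_axial_field smooth_field_residue_field F smooth_field_scaleR x scaleR_scaleR)
  \<comment> \<open>The unwanted terms cancel here: 2 * 2 k m from the J part against 4 m * k from
    the commutator.\<close>
  also have "\<dots> = (4 * real ?m * ?C) *\<^sub>R axial_field F (Suc k) (Suc h) x"
    unfolding DJ DY by (simp add: scaleR_diff_right mult_ac)
  also have "4 * real ?m * ?C = 4 ^ Suc k * fact h / fact (h - Suc k)"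
  proof -
    obtain d where "h - k = Suc d" "h - Suc k = d"
      using Suc.prems(3) by (metis Suc_diff_Suc Suc_le_lessD)
    then show ?thesis by (simp add: field_simps del: of_nat_Suc)
  qed
  finally show ?case .
qed simp

text \<open>At m = h + 1 the coefficient 2m - 1 - n vanishes, so each D only lowers the first index,
  and index 0 is sent to 0.\<close>

lemma field_op_iter_axial_field_zero:
  assumes F: "\<And>A. F A holomorphic_on \<Omega>" and x: "x \<in> axial_dom" and n: "CARD('n) = 2 * h + 1"
  shows "(field_op mu 1 ^^ Suc k) (axial_field F k (Suc h)) x = 0"
proof (induction k)
  case 0
  show ?case by (simp add: field_op_axial_field[OF F x] n)
next
  case (Suc k)
  have "(field_op mu 1 ^^ Suc (Suc k)) (axial_field F (Suc k) (Suc h)) x =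
      (field_op mu 1 ^^ Suc k) (field_op mu 1 (axial_field F (Suc k) (Suc h))) x"
    by (simp only: funpow_Suc_right o_apply)
  also have "\<dots> = (field_op mu 1 ^^ Suc k) (\<lambda>x. (- real (Suc k)) *\<^sub>R axial_field F k (Suc h) x) x"
  proof (rule field_op_iter_cong[OF smooth_field_field_op[OF smooth_field_axial_field[OF F]] _ x])
    fix x assume x: "x \<in> axial_dom"
    have "2 * real (Suc h) - 1 - real CARD('n) = 0" by (simp add: n)
    then show "field_op mu 1 (axial_field F (Suc k) (Suc h)) x = (- real (Suc k)) *\<^sub>R axial_field F k (Suc h) x"
      by (simp only: field_op_axial_field[OF F x] scaleR_zero_left diff_0 scaleR_minus_left diff_Suc_1)
  qed
  also have "\<dots> = (- real (Suc k)) *\<^sub>R (field_op mu 1 ^^ Suc k) (axial_field F k (Suc h)) x"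
    by (rule field_op_iter_scaleR[OF smooth_field_axial_field[OF F] x])
  finally show ?case using Suc.IH by simp
qed

end

section \<open>Left and right multiplication as actions\<close>

lemma clifford_action_left: "clifford_action ((*) :: 'n::{finite,linorder} clifford \<Rightarrow> _)"
proof (intro clifford_action.intro clifford_action_axioms.intro bounded_bilinear_clifford_mult)
  fix i j :: 'n and y :: "'n clifford"
  have "gen i * (gen j * y) + gen j * (gen i * y) = (gen i * gen j + gen j * gen i) * y"
    by (simp add: algebra_simps)
  then show "gen i * (gen j * y) + gen j * (gen i * y) = (if i = j then - 2 *\<^sub>R y else 0)"
    by (simp add: gen_anticommute scaleR_2 mult_2)
qed

lemma clifford_action_right: "clifford_action (\<lambda>a b :: 'n::{finite,linorder} clifford. b * a)"
proof (intro clifford_action.intro clifford_action_axioms.intro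
    bounded_bilinear.flip[OF bounded_bilinear_clifford_mult])
  fix i j :: 'n and y :: "'n clifford"
  have "y * gen j * gen i + y * gen i * gen j = y * (gen i * gen j + gen j * gen i)"
    by (simp add: algebra_simps)
  then show "y * gen j * gen i + y * gen i * gen j = (if i = j then - 2 *\<^sub>R y else 0)"
    by (simp add: gen_anticommute scaleR_2 mult_2_right)
qed

lemma Dbar_left_eq: "Dbar_left = field_op (*) (-1)"
  and D_left_eq: "D_left = field_op (*) 1"
  and Dbar_right_eq: "Dbar_right = field_op (\<lambda>a b. b * a) (-1)"
  and D_right_eq: "D_right = field_op (\<lambda>a b. b * a) 1"
  by (auto simp: fun_eq_iff field_op_def Dbar_left_def D_left_def Dbar_right_def D_right_def)

lemma paravec_eq: "paravec x = fst x *\<^sub>R 1 + vec_unit (snd x)"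
  by (simp add: paravec_def)

lemma vec_unit_scaleR: "vec_unit (c *\<^sub>R v) = c *\<^sub>R vec_unit v"
  by (simp add: vec_unit_eq scaleR_sum_right)

lemma vec_unit_minus: "vec_unit (- v) = - vec_unit v"
  by (simp add: vec_unit_eq sum_negf)

lemma paravec_para_cnj: "paravec (para_cnj x) = fst x *\<^sub>R 1 - vec_unit (snd x)"
  by (subst paravec_eq) (simp add: para_cnj_def vec_unit_minus)

lemma vec_unit_square:
  assumes "I \<in> sphere 0 1"
  shows "vec_unit I * vec_unit I = - 1"
  using clifford_action.mult_vec_vec[OF clifford_action_left, of I 1] assms
  by (simp add: power2_norm_eq_inner[symmetric])

section \<open>Slices\<close>

text \<open>The embedding of the complex numbers onto the plane of I inside the algebra. For a unit
  vector I it is multiplicative, so kernels on that plane can be computed as complex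
  functions.\<close>

definition slice_emb :: "real ^ ('n::{finite,linorder}) \<Rightarrow> complex \<Rightarrow> 'n clifford" where
  "slice_emb I z = Re z *\<^sub>R 1 + Im z *\<^sub>R vec_unit I"

lemma paravec_embed_C: "paravec (embed_C I z) = slice_emb I z"
  by (subst paravec_eq) (simp add: embed_C_def slice_emb_def vec_unit_scaleR)

lemma slice_emb_bounded_linear: "bounded_linear (slice_emb I)"
  unfolding slice_emb_def[abs_def]
  by (intro bounded_linear_add bounded_linear_compose[OF bounded_linear_scaleR_left]
      bounded_linear_Re bounded_linear_Im)

lemma slice_emb_of_real: "slice_emb I (of_real r) = r *\<^sub>R 1"
  and slice_emb_1 [simp]: "slice_emb I 1 = 1"
  and slice_emb_add: "slice_emb I (z + w) = slice_emb I z + slice_emb I w"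
  and slice_emb_diff: "slice_emb I (z - w) = slice_emb I z - slice_emb I w"
  by (simp_all add: slice_emb_def algebra_simps)

context
  fixes I :: "real ^ ('n::{finite,linorder})"
  assumes I: "I \<in> sphere 0 1"
begin

lemma slice_emb_mult: "slice_emb I (z * w) = slice_emb I z * slice_emb I w"
  by (simp add: slice_emb_def algebra_simps vec_unit_square[OF I])

lemma slice_emb_power: "slice_emb I (z ^ k) = slice_emb I z ^ k"
  by (induction k) (simp_all add: slice_emb_mult)

lemma clifford_inverse_slice_emb:
  assumes "z \<noteq> 0"
  shows "clifford_inverse (slice_emb I z) = slice_emb I (inverse z)"
  unfolding clifford_inverse_def
proof (rule the_equality)
  have 1: "slice_emb I z * slice_emb I (inverse z) = 1" "slice_emb I (inverse z) * slice_emb I z = 1"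
    using assms by (simp_all flip: slice_emb_mult)
  then show "slice_emb I z * slice_emb I (inverse z) = 1 \<and> slice_emb I (inverse z) * slice_emb I z = 1"
    by simp
  fix b assume b: "slice_emb I z * b = 1 \<and> b * slice_emb I z = 1"
  have "b = slice_emb I (inverse z) * slice_emb I z * b" using 1 by simp
  also have "\<dots> = slice_emb I (inverse z)" using b by (simp add: mult.assoc)
  finally show "b = slice_emb I (inverse z)" .
qed

text \<open>The point x enters only through x_0 and its norm, so the value lies in the plane of s
  even when x does not.\<close>

lemma Q_c_embed_C:
  "Q_c (embed_C I s) x = slice_emb I ((s - of_real (fst x))\<^sup>2 + of_real ((norm (snd x))\<^sup>2))"
proof -
  have "(s - of_real (fst x))\<^sup>2 + of_real ((norm (snd x))\<^sup>2) =
      s\<^sup>2 - of_real (2 * fst x) * s + of_real ((norm x)\<^sup>2)"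
    by (simp add: norm_prod_def power2_diff algebra_simps)
  then show ?thesis
    by (simp only: Q_c_def paravec_embed_C slice_emb_add slice_emb_diff slice_emb_mult slice_emb_power
        slice_emb_of_real) simp
qed

lemma kernel_factor:
  fixes x :: "'n point"
  assumes "s \<noteq> half_plane_point x" "s \<noteq> cnj (half_plane_point x)"
  shows "clifford_inverse (Q_c (embed_C I s) x) ^ m * slice_emb I ((s - of_real (fst x)) ^ k) =
    slice_emb I (kern k m (half_plane_point x) s)"
proof -
  have "(s - of_real (fst x))\<^sup>2 + of_real ((norm (snd x))\<^sup>2) \<noteq> 0"
    using kern_denominator[of s "half_plane_point x"] assms by (simp add: half_plane_point_def)
  then show ?thesis
    by (simp add: Q_c_embed_C clifford_inverse_slice_emb kern_def half_plane_point_def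
        divide_inverse power_inverse mult.commute flip: slice_emb_power slice_emb_mult)
qed

text \<open>All factors but the vector part of x lie in the commutative plane of I. The vector part
  comes with the leftmost factor, so it stays on the left while the powers of w and q merge into
  \<open>kern\<close>.\<close>

lemma P_left_embed_C:
  fixes x :: "'n point"
  assumes s: "s \<noteq> half_plane_point x" "s \<noteq> cnj (half_plane_point x)"
    and n: "CARD('n) = 2 * h + 1" and k: "k = h - l"
  shows "P_left l (embed_C I s) x = (gamma_const TYPE('n) * (- 1) ^ k / fact k) *\<^sub>R
    (slice_emb I (kern (Suc k) (Suc h) (half_plane_point x) s) +
     vec_unit (snd x) * slice_emb I (kern k (Suc h) (half_plane_point x) s))"
proof -
  let ?w = "s - of_real (fst x)"
  let ?q = "clifford_inverse (Q_c (embed_C I s) x) ^ Suc h"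
  have h: "sce_exponent TYPE('n) - l = k" "(CARD('n) + 1) div 2 = Suc h"
    by (simp_all add: sce_exponent_def n k)
  have a: "paravec (embed_C I s) - fst x *\<^sub>R 1 = slice_emb I ?w"
    "paravec (embed_C I s) - paravec (para_cnj x) = slice_emb I ?w + vec_unit (snd x)"
    unfolding paravec_embed_C
    by (simp_all add: paravec_para_cnj slice_emb_diff slice_emb_of_real)
  have q: "?q = slice_emb I (kern 0 (Suc h) (half_plane_point x) s)"
    using kernel_factor[OF s, of "Suc h" 0] by simp
  have k1: "kern 0 m z s * ?w ^ k = kern k m z s" "?w * kern k m z s = kern (Suc k) m z s"
    if "z = half_plane_point x" for m z k
    by (simp_all add: kern_def that half_plane_point_def)
  have "(slice_emb I ?w + vec_unit (snd x)) * ?q * slice_emb I ?w ^ k =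
      slice_emb I (?w * (kern 0 (Suc h) (half_plane_point x) s * ?w ^ k)) +
      vec_unit (snd x) * slice_emb I (kern 0 (Suc h) (half_plane_point x) s * ?w ^ k)"
    unfolding q slice_emb_power[symmetric] by (simp only: slice_emb_mult distrib_right mult.assoc)
  then show ?thesis
    unfolding P_left_def F_left_def h a Let_def k1[OF refl] by (simp add: mult.commute)
qed

lemma P_right_embed_C:
  fixes x :: "'n point"
  assumes s: "s \<noteq> half_plane_point x" "s \<noteq> cnj (half_plane_point x)"
    and n: "CARD('n) = 2 * h + 1" and k: "k = h - l"
  shows "P_right l (embed_C I s) x = (gamma_const TYPE('n) * (- 1) ^ k / fact k) *\<^sub>R
    (slice_emb I (kern (Suc k) (Suc h) (half_plane_point x) s) +
     slice_emb I (kern k (Suc h) (half_plane_point x) s) * vec_unit (snd x))"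
proof -
  let ?w = "s - of_real (fst x)"
  let ?q = "clifford_inverse (Q_c (embed_C I s) x) ^ Suc h"
  have h: "sce_exponent TYPE('n) - l = k" "(CARD('n) + 1) div 2 = Suc h"
    by (simp_all add: sce_exponent_def n k)
  have a: "paravec (embed_C I s) - fst x *\<^sub>R 1 = slice_emb I ?w"
    "paravec (embed_C I s) - paravec (para_cnj x) = slice_emb I ?w + vec_unit (snd x)"
    unfolding paravec_embed_C
    by (simp_all add: paravec_para_cnj slice_emb_diff slice_emb_of_real)
  have q: "?q = slice_emb I (kern 0 (Suc h) (half_plane_point x) s)"
    using kernel_factor[OF s, of "Suc h" 0] by simp
  have k1: "?w ^ k * kern 0 m z s = kern k m z s" "kern k m z s * ?w = kern (Suc k) m z s"
    if "z = half_plane_point x" for m z k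
    by (simp_all add: kern_def that half_plane_point_def mult.commute)
  have "slice_emb I ?w ^ k * (?q * (slice_emb I ?w + vec_unit (snd x))) =
      slice_emb I ((?w ^ k * kern 0 (Suc h) (half_plane_point x) s) * ?w) +
      slice_emb I (?w ^ k * kern 0 (Suc h) (half_plane_point x) s) * vec_unit (snd x)"
    unfolding q slice_emb_power[symmetric] by (simp only: slice_emb_mult distrib_left mult.assoc)
  then show ?thesis
    unfolding P_right_def F_right_def h a Let_def k1[OF refl] by (simp add: mult.commute)
qed

end

text \<open>(n + 1)/2 = h + 1 turns the Gamma value into h!, and 2^(2h) together with the sign is
  (-4)^h.\<close>

lemma gamma_const_eq:
  assumes "CARD('n::finite) = 2 * h + 1"
  shows "gamma_const TYPE('n) = (-4) ^ h * (fact h)\<^sup>2"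
proof -
  have "(real CARD('n) + 1) / 2 = real (Suc h)" using assms by simp
  then have "Gamma ((real CARD('n) + 1) / 2) = fact h"
    by (metis Gamma_fact of_nat_Suc add.commute)
  then show ?thesis
    unfolding gamma_const_def using assms
    by (simp add: power_mult flip: power_mult_distrib)
qed

lemma embed_C_half_plane_point:
  assumes U: "axially_symmetric U" and x: "x \<in> U" and I: "I \<in> sphere 0 1"
  shows "embed_C I (half_plane_point x) \<in> U" "embed_C I (cnj (half_plane_point x)) \<in> U"
proof -
  have "(fst x, norm (snd x) *\<^sub>R J) \<in> U" if "J \<in> sphere 0 1" for J
    using U x that unfolding axially_symmetric_def axial_class_def by blast
  from this[of I] this[of "- I"] show "embed_C I (half_plane_point x) \<in> U"
      "embed_C I (cnj (half_plane_point x)) \<in> U"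
    using I by (simp_all add: embed_C_def half_plane_point_def)
qed

text \<open>Axial symmetry spreads membership from one unit vector to all; a negative second
  coordinate is absorbed by passing to the opposite unit vector.\<close>

lemma slice_iff_uv_set:
  assumes W: "axially_symmetric W" and I: "I \<in> sphere 0 1"
  shows "z \<in> slice W I \<longleftrightarrow> (Re z, Im z) \<in> uv_set W"
proof
  assume "z \<in> slice W I"
  then have z: "(Re z, Im z *\<^sub>R I) \<in> W" by (simp add: slice_def embed_C_def)
  show "(Re z, Im z) \<in> uv_set W"
    unfolding uv_set_def
  proof (clarify)
    fix J :: "real ^ 'a" assume J: "J \<in> sphere 0 1"
    have ax: "(Re z, \<bar>Im z\<bar> *\<^sub>R J') \<in> W" if "J' \<in> sphere 0 1" for J'
      using W z that I unfolding axially_symmetric_def axial_class_def by force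
    show "(Re z, Im z *\<^sub>R J) \<in> W"
      using ax[of J] ax[of "- J"] J by (cases "Im z \<ge> 0") auto
  qed
next
  assume "(Re z, Im z) \<in> uv_set W"
  then show "z \<in> slice W I" using I by (simp add: uv_set_def slice_def embed_C_def)
qed

lemma slice_half_plane_point:
  assumes W: "axially_symmetric W" and I: "I \<in> sphere 0 1"
  shows "half_plane_point x \<in> slice W I \<longleftrightarrow> x \<in> W"
proof
  assume "x \<in> W"
  then show "half_plane_point x \<in> slice W I"
    using embed_C_half_plane_point(1)[OF W _ I] by (simp add: slice_def)
next
  assume "half_plane_point x \<in> slice W I"
  then have uv: "(fst x, norm (snd x)) \<in> uv_set W"
    using slice_iff_uv_set[OF W I] by (simp add: half_plane_point_def)
  show "x \<in> W"
  proof (cases "snd x = 0")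
    case True
    then show ?thesis using uv I by (auto simp: uv_set_def prod_eq_iff intro: back_subst[of "\<lambda>y. y \<in> W"])
  next
    case False
    then have "sgn (snd x) \<in> sphere 0 1" by (simp add: norm_sgn)
    then have "(fst x, norm (snd x) *\<^sub>R sgn (snd x)) \<in> W" using uv by (auto simp: uv_set_def)
    then show ?thesis using False by (simp add: sgn_div_norm)
  qed
qed

lemma continuous_embed_C: "continuous_on S (embed_C I)"
  unfolding embed_C_def by (intro continuous_intros)

lemma open_slice: "open W \<Longrightarrow> open (slice W I)"
  using open_vimage[OF _ continuous_embed_C] by (simp add: slice_def vimage_def)

lemma closure_slice: "closure (slice U I) \<subseteq> slice (closure U) I"
proof (rule closure_minimal)
  show "slice U I \<subseteq> slice (closure U) I"
    using closure_subset by (auto simp: slice_def)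
  show "closed (slice (closure U) I)"
    using closed_vimage[OF closed_closure continuous_embed_C] by (simp add: slice_def vimage_def)
qed

lemma bounded_slice:
  assumes "bounded U" and I: "I \<in> sphere 0 1"
  shows "bounded (slice U I)"
proof -
  obtain b where b: "\<And>x. x \<in> U \<Longrightarrow> norm x \<le> b" using assms(1) bounded_iff by blast
  have "norm (embed_C I z) = cmod z" for z
    using I by (simp add: embed_C_def norm_prod_def cmod_def)
  then show ?thesis
    unfolding bounded_iff slice_def using b by (metis mem_Collect_eq)
qed

text \<open>In each coordinate the Cauchy-Riemann system makes the real derivative of the pair
  multiplication by one complex number; the parity conditions are the reflection symmetry.\<close>

lemma slice_components_holomorphic:
  assumes W: "axially_symmetric W" and I: "I \<in> sphere 0 1" and c: "slice_components W \<alpha> \<beta>" and "open W"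
  defines "F \<equiv> \<lambda>A z. Complex (coord (\<alpha> (Re z, Im z)) A) (coord (\<beta> (Re z, Im z)) A)"
  shows "F A holomorphic_on slice W I" "z \<in> slice W I \<Longrightarrow> F A (cnj z) = cnj (F A z)"
proof -
  have uv: "(Re z, Im z) \<in> uv_set W" if "z \<in> slice W I" for z
    using slice_iff_uv_set[OF W I] that by simp
  show "F A (cnj z) = cnj (F A z)" if "z \<in> slice W I"
    using c uv[OF that] by (auto simp: slice_components_def F_def complex_eq_iff)
  show "F A holomorphic_on slice W I"
  proof (subst holomorphic_on_open[OF open_slice[OF \<open>open W\<close>]], safe)
    fix z assume "z \<in> slice W I"
    then have *: "(Re z, Im z) \<in> uv_set W" by (rule uv)
    define p where "p = (Re z, Im z)"
    have d: "\<alpha> differentiable (at p)" "\<beta> differentiable (at p)"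
      and cr: "partial (1, 0) \<alpha> p = partial (0, 1) \<beta> p" "partial (0, 1) \<alpha> p = - partial (1, 0) \<beta> p"
      using c * by (auto simp: slice_components_def p_def)
    obtain a' where a': "(\<alpha> has_derivative a') (at p)" using d by (auto simp: differentiable_def)
    obtain b' where b': "(\<beta> has_derivative b') (at p)" using d by (auto simp: differentiable_def)
    have part: "partial v g p = g' v" if "(g has_derivative g') (at p)" for g :: "real \<times> real \<Rightarrow> 'a clifford" and g' v
      unfolding partial_def
    proof (rule vector_derivative_at)
      have "((\<lambda>t. p + t *\<^sub>R v) has_derivative (\<lambda>t. t *\<^sub>R v)) (at 0)"
        by (auto intro!: derivative_eq_intros)
      from has_derivative_compose[OF this, of g g'] that
      have "((\<lambda>t. g (p + t *\<^sub>R v)) has_derivative (\<lambda>t. g' (t *\<^sub>R v))) (at 0)" by simp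
      moreover have "g' (t *\<^sub>R v) = t *\<^sub>R g' v" for t
        using has_derivative_linear[OF that] by (rule linear_scale)
      ultimately show "((\<lambda>t. g (p + t *\<^sub>R v)) has_vector_derivative g' v) (at 0)"
        by (simp add: has_vector_derivative_def)
    qed
    have lin: "a' (s, t) = s *\<^sub>R a' (1, 0) + t *\<^sub>R a' (0, 1)" "b' (s, t) = s *\<^sub>R b' (1, 0) + t *\<^sub>R b' (0, 1)" for s t
    proof -
      have *: "(s, t) = s *\<^sub>R (1, 0) + t *\<^sub>R (0, 1)" by simp
      show "a' (s, t) = s *\<^sub>R a' (1, 0) + t *\<^sub>R a' (0, 1)"
        using has_derivative_linear[OF a'] by (subst *) (simp only: linear_add linear_scale)
      show "b' (s, t) = s *\<^sub>R b' (1, 0) + t *\<^sub>R b' (0, 1)"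
        using has_derivative_linear[OF b'] by (subst *) (simp only: linear_add linear_scale)
    qed
    have cr': "a' (1, 0) = b' (0, 1)" "a' (0, 1) = - b' (1, 0)"
      using cr part[OF a'] part[OF b'] by simp_all
    have e: "((\<lambda>z. (Re z, Im z)) has_derivative (\<lambda>z. (Re z, Im z))) (at z)"
      by (intro derivative_intros bounded_linear_imp_has_derivative bounded_linear_Re bounded_linear_Im)
    have "((\<lambda>z. coord (\<alpha> (Re z, Im z)) A) has_derivative (\<lambda>w. coord (a' (Re w, Im w)) A)) (at z)"
      "((\<lambda>z. coord (\<beta> (Re z, Im z)) A) has_derivative (\<lambda>w. coord (b' (Re w, Im w)) A)) (at z)"
      by (intro bounded_linear.has_derivative[OF bounded_linear_coord] has_derivative_compose[OF e]
          a'[unfolded p_def] b'[unfolded p_def])+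
    then have "(F A has_derivative (\<lambda>w. Complex (coord (a' (Re w, Im w)) A) (coord (b' (Re w, Im w)) A))) (at z)"
      unfolding F_def Complex_eq by (intro derivative_intros)
    moreover have "Complex (coord (a' (Re w, Im w)) A) (coord (b' (Re w, Im w)) A) =
        Complex (coord (a' (1, 0)) A) (coord (b' (1, 0)) A) * w" for w
      by (simp add: lin[of "Re w" "Im w"] cr' complex_eq_iff algebra_simps)
    ultimately show "\<exists>f'. (F A has_field_derivative f') (at z)"
      unfolding has_field_derivative_def by (auto simp: mult_commute_abs)
  qed
qed

section \<open>Integral representation\<close>

text \<open>The stem function \<alpha> + i \<beta>, one blade coordinate at a time.\<close>

definition stem_coord :: "(real \<times> real \<Rightarrow> 'n clifford) \<Rightarrow> (real \<times> real \<Rightarrow> 'n clifford) \<Rightarrow>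
    'n set \<Rightarrow> complex \<Rightarrow> complex" where
  "stem_coord \<alpha> \<beta> A z = Complex (coord (\<alpha> (Re z, Im z)) A) (coord (\<beta> (Re z, Im z)) A)"

context clifford_action_domain
begin

lemma field_op_iter_laplace_stem:
  assumes F: "\<And>A. F A holomorphic_on \<Omega>" and f: "\<And>x. x \<in> axial_dom \<Longrightarrow> f x = axial_field F 0 1 x"
    and n: "CARD('n) = 2 * h + 1" and l: "l \<le> h" and k: "k = h - l" and x: "x \<in> axial_dom"
  defines "c \<equiv> gamma_const TYPE('n) * (- 1) ^ k / fact k"
  shows "(field_op mu (-1) ^^ k) ((laplace ^^ l) f) x = c *\<^sub>R axial_field F k (Suc h) x"
    "(laplace ^^ l) ((field_op mu (-1) ^^ k) f) x = c *\<^sub>R axial_field F k (Suc h) x"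
proof -
  have Sf: "smooth_field f" by (rule smooth_field_cong[OF smooth_field_axial_field[OF F] f[symmetric]])
  let ?c = "(-4) ^ l * fact l * fact h / fact (h - l) :: real"
  \<comment> \<open>As k = h - l, the index l + 1 reached by the Laplacians is h + 1 - k, exactly
    where the powers of the conjugate operator start.\<close>
  have lf: "(laplace ^^ l) f x = ?c *\<^sub>R axial_field F 0 (Suc h - k) x" if "x \<in> axial_dom" for x
    using laplace_iter_cong[OF Sf f that, of l] laplace_iter_axial_field[OF F that n l] l k by (simp add: Suc_diff_le)
  have hk: "h - k = l" "k \<le> h" using l k by auto
  have "(field_op mu (-1) ^^ k) ((laplace ^^ l) f) x =
      (field_op mu (-1) ^^ k) (\<lambda>x. ?c *\<^sub>R axial_field F 0 (Suc h - k) x) x"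
    by (rule field_op_iter_cong[OF smooth_field_laplace_iter[OF Sf] lf x])
  also have "\<dots> = ?c *\<^sub>R (field_op mu (-1) ^^ k) (axial_field F 0 (Suc h - k)) x"
    by (rule field_op_iter_scaleR[OF smooth_field_axial_field[OF F] x])
  also have "\<dots> = (?c * (4 ^ k * fact h / fact l)) *\<^sub>R axial_field F k (Suc h) x"
    using field_op_iter_conj_axial_field[OF F x n hk(2)] by (simp add: hk)
  \<comment> \<open>The two constants multiply to (-4)^l 4^k (h!)^2 / k!, while
    \<open>gamma_const\<close> is (-4)^h (h!)^2; comparing the powers leaves the sign (-1)^k of the
    kernel.\<close>
  also have "?c * (4 ^ k * fact h / fact l) = c"
  proof -
    have "h = l + k" using l k by simp
    then have "(-4) ^ h * (-1) ^ k = (-4) ^ l * (4 ^ k :: real)"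
      by (simp add: power_add mult.assoc flip: power_mult_distrib)
    then show ?thesis
      unfolding c_def gamma_const_eq[OF n] k[symmetric] by (simp add: power2_eq_square field_simps)
  qed
  finally show *: "(field_op mu (-1) ^^ k) ((laplace ^^ l) f) x = c *\<^sub>R axial_field F k (Suc h) x" .
  then show "(laplace ^^ l) ((field_op mu (-1) ^^ k) f) x = c *\<^sub>R axial_field F k (Suc h) x"
    by (subst laplace_iter_iter[OF Sf x]) simp_all
qed

text \<open>For the axial form, residue sums depend on z only through the set of z and its
  conjugate, so they are even in v. Writing the vector part as its norm times its direction supplies
  the factor v that makes the second component odd.\<close>

lemma axial_field_polyanalytic:
  assumes F: "\<And>A. F A holomorphic_on \<Omega>" and g: "\<And>x. x \<in> axial_dom \<Longrightarrow> g x = c *\<^sub>R axial_field F k (Suc h) x"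
    and n: "CARD('n) = 2 * h + 1"
  shows "Ck_on m axial_dom g" "x \<in> axial_dom \<Longrightarrow> (field_op mu 1 ^^ Suc k) g x = 0"
    "\<exists>A B. even_odd_on P A B \<and>
      (\<forall>x\<in>axial_dom. g x = A (fst x, norm (snd x)) + mu (vec_unit (sgn (snd x))) (B (fst x, norm (snd x))))"
proof -
  have Sg: "smooth_field g" by (rule smooth_field_cong[OF smooth_field_scaleR[OF smooth_field_axial_field[OF F]] g[symmetric]])
  then show "Ck_on m axial_dom g" by (rule smooth_field_Ck_on)
  show "(field_op mu 1 ^^ Suc k) g x = 0" if x: "x \<in> axial_dom"
  proof -
    have "(field_op mu 1 ^^ Suc k) g x = (field_op mu 1 ^^ Suc k) (\<lambda>x. c *\<^sub>R axial_field F k (Suc h) x) x"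
      by (rule field_op_iter_cong[OF Sg g x])
    also have "\<dots> = c *\<^sub>R (field_op mu 1 ^^ Suc k) (axial_field F k (Suc h)) x"
      by (rule field_op_iter_scaleR[OF smooth_field_axial_field[OF F] x])
    finally show ?thesis using field_op_iter_axial_field_zero[OF F x n] by simp
  qed
  define J where "J j p = c *\<^sub>R (\<Sum>A\<in>UNIV. Re (res_sum j (Suc h) (F A) (Complex (fst p) (snd p))) *\<^sub>R blade A)"
    for j and p :: "real \<times> real"
  have even: "J j (u, - v) = J j (u, v)" for j u v
    using res_sum_cnj[of j "Suc h" _ "Complex u v"] by (simp add: J_def complex_cnj del: res_sum_cnj)
  have "g x = J (Suc k) (fst x, norm (snd x)) +
      mu (vec_unit (sgn (snd x))) (norm (snd x) *\<^sub>R J k (fst x, norm (snd x)))" if x: "x \<in> axial_dom" for x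
  proof -
    have v: "vec_unit (snd x) = norm (snd x) *\<^sub>R vec_unit (sgn (snd x))"
      by (cases "snd x = 0") (simp_all add: vec_unit_0 sgn_div_norm flip: vec_unit_scaleR)
    have J: "J j (fst x, norm (snd x)) = c *\<^sub>R residue_field F j (Suc h) x" for j
      by (simp add: J_def residue_field_def half_plane_point_def)
    show ?thesis
      unfolding g[OF x] axial_field_def v J
      by (simp add: scaleR_add_right mult.scaleR_left mult.scaleR_right mult.commute)
  qed
  moreover have "even_odd_on P (J (Suc k)) (\<lambda>p. snd p *\<^sub>R J k p)"
    by (auto simp: even_odd_on_def even)
  ultimately show "\<exists>A B. even_odd_on P A B \<and>
      (\<forall>x\<in>axial_dom. g x = A (fst x, norm (snd x)) + mu (vec_unit (sgn (snd x))) (B (fst x, norm (snd x))))"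
    by (intro exI[of _ "J (Suc k)"] exI[of _ "\<lambda>p. snd p *\<^sub>R J k p"]) simp
qed

text \<open>Blade by blade the integrand is a real-linear image of a complex integrand. The linear
  maps leave the integral, where the residue theorem for cycles evaluates what remains.\<close>

lemma cycle_integral_axial_field:
  assumes F: "\<And>A. F A holomorphic_on \<Omega>" and sym: "\<And>A s. s \<in> \<Omega> \<Longrightarrow> F A (cnj s) = cnj (F A s)"
    and x: "x \<in> axial_dom" and z: "z = half_plane_point x" and mult_1: "\<And>y. mu 1 y = y"
    and K: "compact K" "K \<subseteq> \<Omega>" and "finite G"
    and G: "\<And>\<gamma>. \<gamma> \<in> G \<Longrightarrow> valid_path \<gamma> \<and> pathfinish \<gamma> = pathstart \<gamma> \<and> path_image \<gamma> \<subseteq> K - {z, cnj z}"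
    and 0: "\<And>w. w \<notin> K \<Longrightarrow> (\<Sum>\<gamma>\<in>G. winding_number \<gamma> w) = 0"
    and 1: "\<And>p. p \<in> {z, cnj z} \<Longrightarrow> (\<Sum>\<gamma>\<in>G. winding_number \<gamma> p) = 1"
    and \<Phi>: "\<And>\<gamma> t. \<gamma> \<in> G \<Longrightarrow> t \<in> {0..1} \<Longrightarrow> \<Phi> \<gamma> t = c *\<^sub>R (\<Sum>A\<in>UNIV.
      mu (slice_emb I (- \<i> * (kern (Suc k) m z (\<gamma> t) * F A (\<gamma> t) * vector_derivative \<gamma> (at t within {0..1})))) (blade A) +
      mu (vec_unit (snd x)) (mu (slice_emb I (- \<i> * (kern k m z (\<gamma> t) * F A (\<gamma> t) *
        vector_derivative \<gamma> (at t within {0..1})))) (blade A)))"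
  shows "(1 / (2 * pi)) *\<^sub>R (\<Sum>\<gamma>\<in>G. integral {0..1} (\<Phi> \<gamma>)) = c *\<^sub>R axial_field F k m x"
proof -
  define L where "L A w = mu (slice_emb I (- \<i> * w)) (blade A)" for A w
  define M where "M A w = mu (vec_unit (snd x)) (L A w)" for A w
  have L: "bounded_linear (L A)" for A
    unfolding L_def
    by (intro bounded_linear_compose[OF mult.bounded_linear_left]
        bounded_linear_compose[OF slice_emb_bounded_linear] bounded_linear_mult_right)
  have M: "bounded_linear (M A)" for A
    unfolding M_def by (intro bounded_linear_compose[OF mult.bounded_linear_right] L)
  define T where "T \<gamma> j A = contour_integral \<gamma> (\<lambda>s. kern j m z s * F A s)" for \<gamma> j A
  have open': "open (\<Omega> - {z, cnj z})"
    using open_dom by (simp add: open_Diff finite_imp_closed)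
  have int: "((\<lambda>t. kern j m z (\<gamma> t) * F A (\<gamma> t) * vector_derivative \<gamma> (at t within {0..1})) has_integral T \<gamma> j A) {0..1}"
    if "\<gamma> \<in> G" for \<gamma> j A
  proof -
    have "((\<lambda>s. kern j m z s * F A s) has_contour_integral T \<gamma> j A) \<gamma>"
      unfolding T_def
      by (rule has_contour_integral_integral[OF contour_integrable_holomorphic_simple[OF
            kern_times_holomorphic[OF F] open']]) (use G[OF that] K in auto)
    then show ?thesis by (simp only: has_contour_integral_def)
  qed
  have "integral {0..1} (\<Phi> \<gamma>) = c *\<^sub>R (\<Sum>A\<in>UNIV. L A (T \<gamma> (Suc k) A) + M A (T \<gamma> k A))"
    if \<gamma>: "\<gamma> \<in> G" for \<gamma>
  proof (rule integral_unique, rule has_integral_eq)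
    show "((\<lambda>t. c *\<^sub>R (\<Sum>A\<in>UNIV.
        (L A \<circ> (\<lambda>t. kern (Suc k) m z (\<gamma> t) * F A (\<gamma> t) * vector_derivative \<gamma> (at t within {0..1}))) t +
        (M A \<circ> (\<lambda>t. kern k m z (\<gamma> t) * F A (\<gamma> t) * vector_derivative \<gamma> (at t within {0..1}))) t))
      has_integral c *\<^sub>R (\<Sum>A\<in>UNIV. L A (T \<gamma> (Suc k) A) + M A (T \<gamma> k A))) {0..1}"
      by (intro has_integral_cmul has_integral_sum has_integral_add has_integral_linear[OF int[OF \<gamma>]] L M) auto
  qed (use \<Phi>[OF \<gamma>] in \<open>simp add: L_def M_def\<close>)
  then have "(\<Sum>\<gamma>\<in>G. integral {0..1} (\<Phi> \<gamma>)) = (\<Sum>\<gamma>\<in>G. c *\<^sub>R (\<Sum>A\<in>UNIV. L A (T \<gamma> (Suc k) A) + M A (T \<gamma> k A)))"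
    by (rule sum.cong[OF refl])
  also have "\<dots> = c *\<^sub>R (\<Sum>A\<in>UNIV. L A (\<Sum>\<gamma>\<in>G. T \<gamma> (Suc k) A) + M A (\<Sum>\<gamma>\<in>G. T \<gamma> k A))"
    unfolding scaleR_sum_right[symmetric]
    by (subst sum.swap) (simp add: sum.distrib linear_sum[OF bounded_linear.linear[OF L]]
        linear_sum[OF bounded_linear.linear[OF M]])
  also have "\<dots> = c *\<^sub>R (\<Sum>A\<in>UNIV. (2 * pi * Re (res_sum (Suc k) m (F A) z)) *\<^sub>R blade A +
      mu (vec_unit (snd x)) ((2 * pi * Re (res_sum k m (F A) z)) *\<^sub>R blade A))"
  proof -
    have "z \<in> \<Omega>" using x z by (simp add: axial_dom_def)
    have "L A (\<Sum>\<gamma>\<in>G. T \<gamma> j A) = (2 * pi * Re (res_sum j m (F A) z)) *\<^sub>R blade A" for j A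
    proof -
      have "Im (res_sum j m (F A) z) = 0"
        by (rule res_sum_real[OF F sym \<open>z \<in> \<Omega>\<close>])
      \<comment> \<open>The -i from ds(-I) meets the i of the residue theorem; as the residue sum is
        real, \<open>slice_emb\<close> yields a real scalar.\<close>
      then have "- \<i> * (2 * pi * \<i> * res_sum j m (F A) z) = of_real (2 * pi * Re (res_sum j m (F A) z))"
        by (simp add: complex_eq_iff)
      moreover have "(\<Sum>\<gamma>\<in>G. T \<gamma> j A) = 2 * pi * \<i> * res_sum j m (F A) z"
        unfolding T_def by (rule cycle_integral_res_sum[OF F K \<open>finite G\<close> G 0 1])
      ultimately show ?thesis
        by (simp only: L_def slice_emb_of_real mult.scaleR_left mult_1)
    qed
    then show ?thesis by (simp only: M_def)
  qed
  also have "\<dots> = (2 * pi) *\<^sub>R (c *\<^sub>R axial_field F k m x)"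
    by (simp add: axial_field_def residue_field_def z sum.distrib mult.sum_right mult.scaleR_right scaleR_sum_right
        scaleR_add_right mult_ac)
  finally show ?thesis by simp
qed

end

section \<open>From the stem function to the slice hyperholomorphic function\<close>

context clifford_action
begin

text \<open>On its slice the function splits into plane-valued factors times constant blades. The
  plane-valued factors commute with the kernel, so the noncommutativity is confined to the
  blades.\<close>

lemma stem_blade_expansion:
  assumes mult_1: "\<And>y. mu 1 y = y"
  shows "\<alpha> (Re s, Im s) + mu (vec_unit I) (\<beta> (Re s, Im s)) =
    (\<Sum>A\<in>UNIV. mu (slice_emb I (stem_coord \<alpha> \<beta> A s)) (blade A))"
proof -
  have "\<alpha> (Re s, Im s) = (\<Sum>A\<in>UNIV. coord (\<alpha> (Re s, Im s)) A *\<^sub>R blade A)"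
    "\<beta> (Re s, Im s) = (\<Sum>A\<in>UNIV. coord (\<beta> (Re s, Im s)) A *\<^sub>R blade A)"
    by (rule clifford_blade_expansion)+
  then have "\<alpha> (Re s, Im s) + mu (vec_unit I) (\<beta> (Re s, Im s)) =
    (\<Sum>A\<in>UNIV. coord (\<alpha> (Re s, Im s)) A *\<^sub>R blade A) +
    mu (vec_unit I) (\<Sum>A\<in>UNIV. coord (\<beta> (Re s, Im s)) A *\<^sub>R blade A)" by simp
  then show ?thesis
    by (simp add: slice_emb_def stem_coord_def mult.add_left mult.scaleR_left mult_1
        sum.distrib mult.sum_right mult.scaleR_right)
qed

context
  fixes W :: "'n::{finite,linorder} point set" and f :: "'n field_fun" and \<alpha> \<beta>
    and I :: "real ^ ('n::{finite,linorder})"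
  assumes W: "open W" "axially_symmetric W" and c: "slice_components W \<alpha> \<beta>"
    and f: "\<And>I u v. I \<in> sphere 0 1 \<Longrightarrow> (u, v) \<in> uv_set W \<Longrightarrow>
      f (u, v *\<^sub>R I) = \<alpha> (u, v) + mu (vec_unit I) (\<beta> (u, v))"
    and I: "I \<in> sphere 0 1"
begin

lemma slice_action_domain: "clifford_action_domain (slice W I) mu"
proof (intro clifford_action_domain.intro symmetric_domain.intro)
  show "open (slice W I)" by (rule open_slice[OF W(1)])
  show "cnj z \<in> slice W I" if "z \<in> slice W I" for z
  proof -
    have "(Re z, Im z) \<in> uv_set W" using that slice_iff_uv_set[OF W(2) I] by blast
    moreover have "- I \<in> sphere 0 1" using I by simp
    ultimately have "(Re z, Im z *\<^sub>R - I) \<in> W" unfolding uv_set_def by blast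
    then show ?thesis by (simp add: slice_def embed_C_def)
  qed
qed (rule clifford_action_axioms)

interpretation clifford_action_domain "slice W I" mu by (rule slice_action_domain)

lemma axial_dom_slice: "axial_dom = W"
  unfolding axial_dom_def using slice_half_plane_point[OF W(2) I] by auto

lemma stem_holomorphic: "stem_coord \<alpha> \<beta> A holomorphic_on slice W I"
  and stem_cnj: "s \<in> slice W I \<Longrightarrow> stem_coord \<alpha> \<beta> A (cnj s) = cnj (stem_coord \<alpha> \<beta> A s)"
  using slice_components_holomorphic[OF W(2) I c W(1)] unfolding stem_coord_def[abs_def] by simp_all

text \<open>J_{1,1} is \<alpha>, and J_{0,1} is \<beta> divided by the norm of the vector part.
  Since \<alpha> and \<beta> do not depend on the unit vector, the one slice fixed here recovers f
  on all of \<open>W\<close>.\<close>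

lemma stem_axial_field:
  assumes x: "x \<in> W"
  shows "f x = axial_field (stem_coord \<alpha> \<beta>) 0 1 x"
proof -
  let ?F = "stem_coord \<alpha> \<beta>" and ?z = "half_plane_point x"
  have z: "?z \<in> slice W I" using x slice_half_plane_point[OF W(2) I] by blast
  then have uv: "(fst x, norm (snd x)) \<in> uv_set W"
    using slice_iff_uv_set[OF W(2) I] by (simp add: half_plane_point_def)
  have cn: "?F A (cnj ?z) = cnj (?F A ?z)" for A by (rule stem_cnj[OF z])
  have 1: "Re (res_sum 1 1 (?F A) ?z) = coord (\<alpha> (fst x, norm (snd x))) A" for A
    unfolding res_sum_1_1[OF stem_holomorphic z] cn by (simp add: stem_coord_def half_plane_point_def)
  then have J1: "residue_field ?F 1 1 x = \<alpha> (fst x, norm (snd x))"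
    by (simp add: residue_field_def clifford_blade_expansion[symmetric])
  show ?thesis
  proof (cases "snd x = 0")
    case True
    \<comment> \<open>At a real point oddness at v = 0 forces \<beta> to vanish there, in accordance
      with the vanishing vector part.\<close>
    then have "\<beta> (fst x, 0) = - \<beta> (fst x, 0)"
      using c uv unfolding slice_components_def by (auto dest!: bspec)
    then have "2 *\<^sub>R \<beta> (fst x, 0) = 2 *\<^sub>R 0"
      by (simp add: scaleR_2 eq_neg_iff_add_eq_0)
    then have "\<beta> (fst x, 0) = 0" by (rule scaleR_2_cancel)
    then have "f x = \<alpha> (fst x, 0)"
      using f[OF I, of "fst x" 0] uv True by (simp add: mult.zero_right prod_eq_iff)
        (metis True add.right_neutral prod.collapse)
    then show ?thesis using J1 True by (simp add: axial_field_def vec_unit_0 mult.zero_left)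
  next
    case False
    then have s: "sgn (snd x) \<in> sphere 0 1" "x = (fst x, norm (snd x) *\<^sub>R sgn (snd x))"
      by (simp_all add: norm_sgn sgn_div_norm prod_eq_iff)
    have "Re (res_sum 0 1 (?F A) ?z) = inverse (norm (snd x)) * coord (\<beta> (fst x, norm (snd x))) A" for A
    proof -
      have v: "Im ?z = norm (snd x)" "norm (snd x) \<noteq> 0"
        using False by (simp_all add: half_plane_point_def)
      have "res_sum 0 1 (?F A) ?z = (2 * \<i> * of_real (Im (?F A ?z))) / (2 * \<i> * of_real (norm (snd x)))"
        using res_sum_0_1[OF stem_holomorphic z, of A] v by (simp add: cn complex_diff_cnj mult_ac)
      also have "\<dots> = of_real (inverse (norm (snd x)) * Im (?F A ?z))"
        using v(2) by (simp add: field_simps)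
      finally have "Re (res_sum 0 1 (?F A) ?z) = inverse (norm (snd x)) * Im (?F A ?z)"
        by (simp only: Re_complex_of_real)
      then show ?thesis by (simp add: stem_coord_def half_plane_point_def)
    qed
    then have "residue_field ?F 0 1 x = inverse (norm (snd x)) *\<^sub>R \<beta> (fst x, norm (snd x))"
      by (simp add: residue_field_def scaleR_sum_right[symmetric] clifford_blade_expansion[symmetric]
          flip: scaleR_scaleR)
    moreover have "vec_unit (snd x) = norm (snd x) *\<^sub>R vec_unit (sgn (snd x))"
      using False by (simp add: sgn_div_norm flip: vec_unit_scaleR)
    ultimately have "mu (vec_unit (snd x)) (residue_field ?F 0 1 x) = mu (vec_unit (sgn (snd x))) (\<beta> (fst x, norm (snd x)))"
      using False by (simp add: mult.scaleR_left mult.scaleR_right)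
    then show ?thesis using J1 f[OF s(1) uv] s(2) by (simp add: axial_field_def)
  qed
qed

text \<open>The disjunction lets one statement serve both orders in which the two maps compose their
  operators.\<close>

lemma stem_poly_map:
  assumes n: "CARD('n) = 2 * h + 1" and l: "l \<le> h" and k: "k = h - l"
    and g: "g = (field_op mu (-1) ^^ k) ((laplace ^^ l) f) \<or> g = (laplace ^^ l) ((field_op mu (-1) ^^ k) f)"
    and x: "x \<in> W"
  shows "g x = (gamma_const TYPE('n) * (- 1) ^ k / fact k) *\<^sub>R axial_field (stem_coord \<alpha> \<beta>) k (Suc h) x"
  using g field_op_iter_laplace_stem[OF stem_holomorphic stem_axial_field n l k, of x] x unfolding axial_dom_slice by blast

lemma stem_polyanalytic:
  assumes n: "CARD('n) = 2 * h + 1" and l: "l \<le> h" and k: "k = h - l"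
    and g: "g = (field_op mu (-1) ^^ k) ((laplace ^^ l) f) \<or> g = (laplace ^^ l) ((field_op mu (-1) ^^ k) f)"
  shows "Ck_on m W g" "x \<in> W \<Longrightarrow> (field_op mu 1 ^^ Suc k) g x = 0"
    "\<exists>A B. even_odd_on P A B \<and>
      (\<forall>x\<in>W. g x = A (fst x, norm (snd x)) + mu (vec_unit (sgn (snd x))) (B (fst x, norm (snd x))))"
  using axial_field_polyanalytic[OF stem_holomorphic stem_poly_map[OF n l k g] n, unfolded axial_dom_slice] by blast+

text \<open>The side-dependent algebra is isolated in the assumption on \<Phi>, which may use that
  the curves avoid the poles and that f has its blade expansion on them; both facts are established
  here once for both sides.\<close>

lemma stem_integral:
  fixes U :: "'n point set"
  assumes n: "CARD('n) = 2 * h + 1" and l: "l \<le> h" and k: "k = h - l"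
    and g: "g = (field_op mu (-1) ^^ k) ((laplace ^^ l) f) \<or> g = (laplace ^^ l) ((field_op mu (-1) ^^ k) f)"
    and U: "open U" "axially_symmetric U" "bounded U" "closure U \<subseteq> W" and x: "x \<in> U"
    and \<Gamma>: "positive_boundary (slice U I) \<Gamma>" and mult_1: "\<And>y. mu 1 y = y"
    and \<Phi>: "\<And>\<gamma> t. \<gamma> \<in> \<Gamma> \<Longrightarrow> t \<in> {0..1} \<Longrightarrow> \<gamma> t \<noteq> half_plane_point x \<Longrightarrow> \<gamma> t \<noteq> cnj (half_plane_point x) \<Longrightarrow>
      f (embed_C I (\<gamma> t)) = (\<Sum>A\<in>UNIV. mu (slice_emb I (stem_coord \<alpha> \<beta> A (\<gamma> t))) (blade A)) \<Longrightarrow>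
      \<Phi> \<gamma> t = (gamma_const TYPE('n) * (- 1) ^ k / fact k) *\<^sub>R (\<Sum>A\<in>UNIV.
      mu (slice_emb I (- \<i> * (kern (Suc k) (Suc h) (half_plane_point x) (\<gamma> t) * stem_coord \<alpha> \<beta> A (\<gamma> t) *
        vector_derivative \<gamma> (at t within {0..1})))) (blade A) +
      mu (vec_unit (snd x)) (mu (slice_emb I (- \<i> * (kern k (Suc h) (half_plane_point x) (\<gamma> t) *
        stem_coord \<alpha> \<beta> A (\<gamma> t) * vector_derivative \<gamma> (at t within {0..1})))) (blade A)))"
  shows "g x = (1 / (2 * pi)) *\<^sub>R (\<Sum>\<gamma>\<in>\<Gamma>. integral {0..1} (\<Phi> \<gamma>))"
proof -
  define V where "V = slice U I"
  define z where "z = half_plane_point x"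
  have xW: "x \<in> W" using x U(4) closure_subset by blast
  have oV: "open V" unfolding V_def by (rule open_slice[OF U(1)])
  have zV: "z \<in> V" "cnj z \<in> V"
    using embed_C_half_plane_point[OF U(2) x I] by (auto simp: V_def z_def slice_def)
  have K: "compact (closure V)" "closure V \<subseteq> slice W I"
    using bounded_slice[OF U(3) I] closure_slice[of U I] U(4)
    by (auto simp: V_def compact_closure slice_def)
  have fr: "(\<Union>\<gamma>\<in>\<Gamma>. path_image \<gamma>) = frontier V" and fin: "finite \<Gamma>"
    and paths: "\<And>\<gamma>. \<gamma> \<in> \<Gamma> \<Longrightarrow> valid_path \<gamma> \<and> pathfinish \<gamma> = pathstart \<gamma>"
    and w1: "\<And>z. z \<in> V \<Longrightarrow> (\<Sum>\<gamma>\<in>\<Gamma>. winding_number \<gamma> z) = 1"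
    and w0: "\<And>z. z \<notin> closure V \<Longrightarrow> (\<Sum>\<gamma>\<in>\<Gamma>. winding_number \<gamma> z) = 0"
    using \<Gamma> unfolding positive_boundary_def V_def by blast+
  \<comment> \<open>The poles lie in the open slice, the curves on its frontier.\<close>
  have im: "path_image \<gamma> \<subseteq> closure V - {z, cnj z}" if "\<gamma> \<in> \<Gamma>" for \<gamma>
  proof -
    have "path_image \<gamma> \<subseteq> frontier V" using that fr by blast
    then show ?thesis using zV oV by (auto simp: frontier_def interior_open)
  qed
  have "(1 / (2 * pi)) *\<^sub>R (\<Sum>\<gamma>\<in>\<Gamma>. integral {0..1} (\<Phi> \<gamma>)) =
      (gamma_const TYPE('n) * (- 1) ^ k / fact k) *\<^sub>R axial_field (stem_coord \<alpha> \<beta>) k (Suc h) x"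
  proof (rule cycle_integral_axial_field[OF stem_holomorphic stem_cnj _ z_def mult_1 K fin _ w0])
    show "x \<in> axial_dom" using xW axial_dom_slice by simp
    show "valid_path \<gamma> \<and> pathfinish \<gamma> = pathstart \<gamma> \<and> path_image \<gamma> \<subseteq> closure V - {z, cnj z}"
      if "\<gamma> \<in> \<Gamma>" for \<gamma> using paths[OF that] im[OF that] by blast
    show "(\<Sum>\<gamma>\<in>\<Gamma>. winding_number \<gamma> p) = 1" if "p \<in> {z, cnj z}" for p
      using that zV w1 by blast
    fix \<gamma> t assume \<gamma>: "\<gamma> \<in> \<Gamma>" and t: "t \<in> {0..1::real}"
    then have "\<gamma> t \<in> path_image \<gamma>" by (simp add: path_image_def)
    then have s: "\<gamma> t \<in> closure V" "\<gamma> t \<noteq> z" "\<gamma> t \<noteq> cnj z" using im[OF \<gamma>] by auto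
    then have "\<gamma> t \<in> slice W I" using K(2) by blast
    then have "(Re (\<gamma> t), Im (\<gamma> t)) \<in> uv_set W" using slice_iff_uv_set[OF W(2) I] by blast
    then have "f (embed_C I (\<gamma> t)) = (\<Sum>A\<in>UNIV. mu (slice_emb I (stem_coord \<alpha> \<beta> A (\<gamma> t))) (blade A))"
      using f[OF I] stem_blade_expansion[OF mult_1, of \<alpha> "\<gamma> t" I \<beta>] by (simp add: embed_C_def)
    from \<Phi>[OF \<gamma> t s(2,3)[unfolded z_def] this]
    show "\<Phi> \<gamma> t = (gamma_const TYPE('n) * (- 1) ^ k / fact k) *\<^sub>R (\<Sum>A\<in>UNIV.
      mu (slice_emb I (- \<i> * (kern (Suc k) (Suc h) z (\<gamma> t) * stem_coord \<alpha> \<beta> A (\<gamma> t) *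
        vector_derivative \<gamma> (at t within {0..1})))) (blade A) +
      mu (vec_unit (snd x)) (mu (slice_emb I (- \<i> * (kern k (Suc h) z (\<gamma> t) *
        stem_coord \<alpha> \<beta> A (\<gamma> t) * vector_derivative \<gamma> (at t within {0..1})))) (blade A)))"
      unfolding z_def .
  qed
  then show ?thesis using stem_poly_map[OF n l k g xW] by simp
qed

end

end

lemma slice_emb_derivative:
  assumes "I \<in> sphere 0 1"
  shows "paravec (embed_C I w) * - vec_unit I = slice_emb I (- \<i> * w)"
proof -
  have "- vec_unit I = slice_emb I (- \<i>)" by (simp add: slice_emb_def)
  then show ?thesis
    by (simp add: paravec_embed_C mult.commute flip: slice_emb_mult[OF assms])
qed

lemma left_polyanalytic_representation:
  fixes W U :: "'n::{finite,linorder} point set"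
  assumes n: "CARD('n) = 2 * h + 1" and l: "l \<le> h"
    and f: "left_slice_hyperholomorphic W f" and UW: "closure U \<subseteq> W"
    and U: "slice_cauchy_domain U" "bounded U"
  shows "left_axially_polyanalytic (Suc (h - l)) W (left_poly_map l f)"
    "I \<in> sphere 0 1 \<Longrightarrow> positive_boundary (slice U I) \<Gamma> \<Longrightarrow> x \<in> U \<Longrightarrow>
      left_poly_map l f x = left_poly_integral l I \<Gamma> f x"
proof -
  obtain \<alpha> \<beta> where W: "open W" "axially_symmetric W" and c: "slice_components W \<alpha> \<beta>"
    and f\<alpha>\<beta>: "\<And>I u v. I \<in> sphere 0 1 \<Longrightarrow> (u, v) \<in> uv_set W \<Longrightarrow>
      f (u, v *\<^sub>R I) = \<alpha> (u, v) + vec_unit I * \<beta> (u, v)"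
    using f unfolding left_slice_hyperholomorphic_def by blast
  interpret clifford_action "(*) :: 'n clifford \<Rightarrow> _" by (rule clifford_action_left)
  define k where "k = h - l"
  have h: "sce_exponent TYPE('n) = h" by (simp add: sce_exponent_def n)
  have g: "left_poly_map l f = (field_op (*) (-1) ^^ k) ((laplace ^^ l) f) \<or>
      left_poly_map l f = (laplace ^^ l) ((field_op (*) (-1) ^^ k) f)"
    by (simp add: left_poly_map_def h Dbar_left_eq k_def)
  \<comment> \<open>Being polyanalytic refers to no slice, so any unit vector may provide the
    residue sums.\<close>
  obtain I0 :: "(real, 'n) vec" where I0: "I0 \<in> sphere 0 1"
    using vector_choose_size[of 1] by auto
  show "left_axially_polyanalytic (Suc (h - l)) W (left_poly_map l f)"
    unfolding left_axially_polyanalytic_def D_left_eq k_def[symmetric]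
    by (intro conjI ballI stem_polyanalytic[OF W c f\<alpha>\<beta> I0 n l k_def g])
  show "left_poly_map l f x = left_poly_integral l I \<Gamma> f x"
    if I: "I \<in> sphere 0 1" and \<Gamma>: "positive_boundary (slice U I) \<Gamma>" and x: "x \<in> U"
    unfolding left_poly_integral_def slice_integral_def
  proof (rule stem_integral[OF W c f\<alpha>\<beta> I n l k_def g _ _ U(2) UW x \<Gamma>])
    show "open U" "axially_symmetric U" using U(1) by (auto simp: slice_cauchy_domain_def)
    fix \<gamma> :: "real \<Rightarrow> complex" and t :: real
    assume s: "\<gamma> t \<noteq> half_plane_point x" "\<gamma> t \<noteq> cnj (half_plane_point x)"
      and fs: "f (embed_C I (\<gamma> t)) = (\<Sum>A\<in>UNIV. slice_emb I (stem_coord \<alpha> \<beta> A (\<gamma> t)) * blade A)"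
    define d where "d = vector_derivative \<gamma> (at t within {0..1})"
    \<comment> \<open>Reordered among commuting complex numbers to kernel, ds, function, so that
      \<open>slice_emb_mult\<close> splits it in the order of the integrand.\<close>
    have e: "- \<i> * (a * b * d) = a * (- \<i> * d) * b" for a b by simp
    show "P_left l (embed_C I (\<gamma> t)) x * (paravec (embed_C I (vector_derivative \<gamma> (at t within {0..1}))) * - vec_unit I) *
        f (embed_C I (\<gamma> t)) = (gamma_const TYPE('n) * (- 1) ^ k / fact k) *\<^sub>R (\<Sum>A\<in>UNIV.
      slice_emb I (- \<i> * (kern (Suc k) (Suc h) (half_plane_point x) (\<gamma> t) * stem_coord \<alpha> \<beta> A (\<gamma> t) *
        vector_derivative \<gamma> (at t within {0..1}))) * blade A +
      vec_unit (snd x) * (slice_emb I (- \<i> * (kern k (Suc h) (half_plane_point x) (\<gamma> t) *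
        stem_coord \<alpha> \<beta> A (\<gamma> t) * vector_derivative \<gamma> (at t within {0..1}))) * blade A))"
      unfolding P_left_embed_C[OF I s n k_def] slice_emb_derivative[OF I] d_def[symmetric] fs e slice_emb_mult[OF I]
      by (simp only: sum_distrib_left mult_scaleR_left scaleR_sum_right distrib_right mult.assoc)
  qed simp_all
qed

lemma right_polyanalytic_representation:
  fixes W U :: "'n::{finite,linorder} point set"
  assumes n: "CARD('n) = 2 * h + 1" and l: "l \<le> h"
    and f: "right_slice_hyperholomorphic W f" and UW: "closure U \<subseteq> W"
    and U: "slice_cauchy_domain U" "bounded U"
  shows "right_axially_polyanalytic (Suc (h - l)) W (right_poly_map l f)"
    "I \<in> sphere 0 1 \<Longrightarrow> positive_boundary (slice U I) \<Gamma> \<Longrightarrow> x \<in> U \<Longrightarrow>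
      right_poly_map l f x = right_poly_integral l I \<Gamma> f x"
proof -
  obtain \<alpha> \<beta> where W: "open W" "axially_symmetric W" and c: "slice_components W \<alpha> \<beta>"
    and f\<alpha>\<beta>: "\<And>I u v. I \<in> sphere 0 1 \<Longrightarrow> (u, v) \<in> uv_set W \<Longrightarrow>
      f (u, v *\<^sub>R I) = \<alpha> (u, v) + \<beta> (u, v) * vec_unit I"
    using f unfolding right_slice_hyperholomorphic_def by blast
  interpret clifford_action "\<lambda>a b :: 'n clifford. b * a" by (rule clifford_action_right)
  define k where "k = h - l"
  have h: "sce_exponent TYPE('n) = h" by (simp add: sce_exponent_def n)
  have g: "right_poly_map l f = (field_op (\<lambda>a b. b * a) (-1) ^^ k) ((laplace ^^ l) f) \<or>
      right_poly_map l f = (laplace ^^ l) ((field_op (\<lambda>a b. b * a) (-1) ^^ k) f)"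
    by (simp add: right_poly_map_def h Dbar_right_eq k_def)
  obtain I0 :: "(real, 'n) vec" where I0: "I0 \<in> sphere 0 1"
    using vector_choose_size[of 1] by auto
  show "right_axially_polyanalytic (Suc (h - l)) W (right_poly_map l f)"
    unfolding right_axially_polyanalytic_def D_right_eq k_def[symmetric]
    by (intro conjI ballI stem_polyanalytic[OF W c f\<alpha>\<beta> I0 n l k_def g])
  show "right_poly_map l f x = right_poly_integral l I \<Gamma> f x"
    if I: "I \<in> sphere 0 1" and \<Gamma>: "positive_boundary (slice U I) \<Gamma>" and x: "x \<in> U"
    unfolding right_poly_integral_def slice_integral_def
  proof (rule stem_integral[OF W c f\<alpha>\<beta> I n l k_def g _ _ U(2) UW x \<Gamma>])
    show "open U" "axially_symmetric U" using U(1) by (auto simp: slice_cauchy_domain_def)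
    fix \<gamma> :: "real \<Rightarrow> complex" and t :: real
    assume s: "\<gamma> t \<noteq> half_plane_point x" "\<gamma> t \<noteq> cnj (half_plane_point x)"
      and fs: "f (embed_C I (\<gamma> t)) = (\<Sum>A\<in>UNIV. blade A * slice_emb I (stem_coord \<alpha> \<beta> A (\<gamma> t)))"
    define d where "d = vector_derivative \<gamma> (at t within {0..1})"
    \<comment> \<open>The mirror order: function, ds, kernel.\<close>
    have e: "- \<i> * (a * b * d) = b * (- \<i> * d) * a" for a b by simp
    show "f (embed_C I (\<gamma> t)) * (paravec (embed_C I (vector_derivative \<gamma> (at t within {0..1}))) * - vec_unit I) *
        P_right l (embed_C I (\<gamma> t)) x = (gamma_const TYPE('n) * (- 1) ^ k / fact k) *\<^sub>R (\<Sum>A\<in>UNIV.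
      blade A * slice_emb I (- \<i> * (kern (Suc k) (Suc h) (half_plane_point x) (\<gamma> t) * stem_coord \<alpha> \<beta> A (\<gamma> t) *
        vector_derivative \<gamma> (at t within {0..1}))) +
      blade A * slice_emb I (- \<i> * (kern k (Suc h) (half_plane_point x) (\<gamma> t) *
        stem_coord \<alpha> \<beta> A (\<gamma> t) * vector_derivative \<gamma> (at t within {0..1}))) * vec_unit (snd x))"
      unfolding P_right_embed_C[OF I s n k_def] slice_emb_derivative[OF I] d_def[symmetric] fs e slice_emb_mult[OF I]
      by (simp only: sum_distrib_right mult_scaleR_right sum.distrib distrib_left mult.assoc)
  qed simp_all
qed

text \<open>Both independence claims follow from the representation: every such integral equals the
  value at x of the operator applied to f, and this value refers neither to the domain, nor to its
  boundary curves, nor to the imaginary unit.\<close>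

theorem theorem8p19:
  fixes U :: "'n::{finite,linorder} point set" and l h :: nat
  assumes n_odd: "odd CARD('n)"
    and h: "h = sce_exponent TYPE('n)"
    and l: "int l \<le> int h - 1"
    and U: "slice_cauchy_domain U" "bounded U"
  shows
    "(\<forall>W f. left_slice_hyperholomorphic W f \<and> closure U \<subseteq> W \<longrightarrow>
        left_axially_polyanalytic (h - l + 1) W (left_poly_map l f) \<and>
        (\<forall>I\<in>sphere 0 1. \<forall>\<Gamma>. positive_boundary (slice U I) \<Gamma> \<longrightarrow>
           (\<forall>x\<in>U. left_poly_map l f x = left_poly_integral l I \<Gamma> f x)))
   \<and> (\<forall>W f. right_slice_hyperholomorphic W f \<and> closure U \<subseteq> W \<longrightarrow>
        right_axially_polyanalytic (h - l + 1) W (right_poly_map l f) \<and>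
        (\<forall>I\<in>sphere 0 1. \<forall>\<Gamma>. positive_boundary (slice U I) \<Gamma> \<longrightarrow>
           (\<forall>x\<in>U. right_poly_map l f x = right_poly_integral l I \<Gamma> f x)))
   \<and> (\<forall>W f V I J \<Gamma> \<Delta>.
        slice_cauchy_domain V \<and> bounded V \<and> closure U \<subseteq> W \<and> closure V \<subseteq> W \<and>
        I \<in> sphere 0 1 \<and> J \<in> sphere 0 1 \<and>
        positive_boundary (slice U I) \<Gamma> \<and> positive_boundary (slice V J) \<Delta> \<longrightarrow>
        (left_slice_hyperholomorphic W f \<longrightarrow>
           (\<forall>x\<in>U \<inter> V. left_poly_integral l I \<Gamma> f x = left_poly_integral l J \<Delta> f x)) \<and>
        (right_slice_hyperholomorphic W f \<longrightarrow>
           (\<forall>x\<in>U \<inter> V. right_poly_integral l I \<Gamma> f x = right_poly_integral l J \<Delta> f x)))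
   \<and> (\<forall>W W' f g I \<Gamma>.
        closure U \<subseteq> W \<and> closure U \<subseteq> W' \<and>
        I \<in> sphere 0 1 \<and> positive_boundary (slice U I) \<Gamma> \<longrightarrow>
        (left_slice_hyperholomorphic W f \<and> left_slice_hyperholomorphic W' g \<and>
         (\<forall>x\<in>U. left_poly_map l f x = left_poly_map l g x) \<longrightarrow>
           (\<forall>x\<in>U. left_poly_integral l I \<Gamma> f x = left_poly_integral l I \<Gamma> g x)) \<and>
        (right_slice_hyperholomorphic W f \<and> right_slice_hyperholomorphic W' g \<and>
         (\<forall>x\<in>U. right_poly_map l f x = right_poly_map l g x) \<longrightarrow>
           (\<forall>x\<in>U. right_poly_integral l I \<Gamma> f x = right_poly_integral l I \<Gamma> g x)))"
proof -
  have n: "CARD('n) = 2 * h + 1"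
    using n_odd unfolding h sce_exponent_def by presburger
  have lh: "l \<le> h" using l by simp
  note L = left_polyanalytic_representation[OF n lh]
  note R = right_polyanalytic_representation[OF n lh]
  show ?thesis
    unfolding Suc_eq_plus1[symmetric]
  proof (intro conjI allI impI ballI; (elim conjE)?)
    fix W f assume a: "left_slice_hyperholomorphic W f" "closure U \<subseteq> W"
    show "left_axially_polyanalytic (Suc (h - l)) W (left_poly_map l f)" by (rule L(1)[OF a U])
    show "left_poly_map l f x = left_poly_integral l I \<Gamma> f x"
      if "I \<in> sphere 0 1" "positive_boundary (slice U I) \<Gamma>" "x \<in> U" for I \<Gamma> x
      by (rule L(2)[OF a U that])
  next
    fix W f assume a: "right_slice_hyperholomorphic W f" "closure U \<subseteq> W"
    show "right_axially_polyanalytic (Suc (h - l)) W (right_poly_map l f)" by (rule R(1)[OF a U])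
    show "right_poly_map l f x = right_poly_integral l I \<Gamma> f x"
      if "I \<in> sphere 0 1" "positive_boundary (slice U I) \<Gamma>" "x \<in> U" for I \<Gamma> x
      by (rule R(2)[OF a U that])
  next
    fix W f V I J \<Gamma> \<Delta> x
    assume V: "slice_cauchy_domain V" "bounded V" and UW: "closure U \<subseteq> W" and VW: "closure V \<subseteq> W"
      and I: "I \<in> sphere 0 1" "positive_boundary (slice U I) \<Gamma>"
      and J: "J \<in> sphere 0 1" "positive_boundary (slice V J) \<Delta>" and x: "x \<in> U \<inter> V"
    show "left_poly_integral l I \<Gamma> f x = left_poly_integral l J \<Delta> f x"
      if f: "left_slice_hyperholomorphic W f"
      using L(2)[OF f UW U I, of x] L(2)[OF f VW V J, of x] x by simp
    show "right_poly_integral l I \<Gamma> f x = right_poly_integral l J \<Delta> f x"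
      if f: "right_slice_hyperholomorphic W f"
      using R(2)[OF f UW U I, of x] R(2)[OF f VW V J, of x] x by simp
  next
    fix W W' f g I \<Gamma> x
    assume W: "closure U \<subseteq> W" "closure U \<subseteq> W'" and I: "I \<in> sphere 0 1" "positive_boundary (slice U I) \<Gamma>"
      and x: "x \<in> U"
    show "left_poly_integral l I \<Gamma> f x = left_poly_integral l I \<Gamma> g x"
      if "left_slice_hyperholomorphic W f" "left_slice_hyperholomorphic W' g"
        "\<forall>x\<in>U. left_poly_map l f x = left_poly_map l g x"
      using L(2)[OF that(1) W(1) U I x] L(2)[OF that(2) W(2) U I x] that(3) x by simp
    show "right_poly_integral l I \<Gamma> f x = right_poly_integral l I \<Gamma> g x"
      if "right_slice_hyperholomorphic W f" "right_slice_hyperholomorphic W' g"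
        "\<forall>x\<in>U. right_poly_map l f x = right_poly_map l g x"
      using R(2)[OF that(1) W(1) U I x] R(2)[OF that(2) W(2) U I x] that(3) x by simp
  qed
qed

end
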